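(* Let $M$ be a smooth manifold of dimension $n\geqslant2$ with a regular Lagrange function $L$, let $H$ be the corresponding Hamilton function, and let $\mathbf Q$ be a smooth extended covector field on $M$ with components $Q_i=Q_i(x,p)$. Fix any symmetric extended connection $\Gamma$ in $M$. Then the Newtonian dynamical system $$\dot x^i=\frac1\Omega\frac{\partial H}{\partial p_i},\qquad \dot p_i=-\frac1\Omega\frac{\partial H}{\partial x^i}+Q_i$$ satisfies the weak normality condition if and only if the following equations (the weak normality equations) hold for every $q=1,\dots,n$ at all points $(p,\mathbf p)$ of $T^*M$ with $\mathbf p\ne0$: $$\sum_{r=1}^n\sum_{s=1}^n\frac{\tilde\nabla^sH}{\Omega}\left(\tilde\nabla^rQ_s+\frac{\tilde\nabla^r\Omega}{\Omega}Q_s\right)P^q_r=0,$$ $$\sum_{r=1}^n\sum_{s=1}^n\Bigg(\Big(\nabla_sQ_r+\frac{\nabla_s\Omega}{\Omega}Q_r-\nabla_rQ_s-\frac{\nabla_r\Omega}{\Omega}Q_s\Big)\frac{\tilde\nabla^sH}{\Omega}+\sum_{m=1}^n\Big(\frac{\nabla_rH}{\Omega}-Q_r\Big)\Big(\tilde\nabla^mQ_s+\frac{\tilde\nabla^m\Omega}{\Omega}Q_s\Big)\frac{\tilde\nabla^sH}{\Omega}p_m-\Big(\frac{\nabla_sH}{\Omega}-Q_s\Big)\Big(\tilde\nabla^sQ_r+\frac{\tilde\nabla^s\Omega}{\Omega}Q_r\Big)\Bigg)P^r_q=0.$$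
   Context: Lagrangian geometry. $L$ is a smooth function on $TM$; in local coordinates $L=L(x^1,\dots,x^n,v^1,\dots,v^n)$. The Legendre map $\lambda:TM\to T^*M$ is $p_i=\partial L/\partial v^i$. Put $\Omega=\sum_i v^i\,\partial L/\partial v^i$, and let $\mu:(x,v)\mapsto(x,u)$ with $u^i=v^i/\Omega$. $L$ is called regular if $\lambda$ is a diffeomorphism, $\Omega>0$ at all points of $TM$ with $\mathbf v\ne0$, and $\mu$ is a diffeomorphism of $TM$ minus the zero section onto itself. The Hamilton function is $H=h\circ\lambda^{-1}$ with $h=\sum_i v^i\,\partial L/\partial v^i-L$, a function of $(x^1,\dots,x^n,p_1,\dots,p_n)$. One has $v^i=\partial H/\partial p_i$, and $\Omega$ viewed as a function on $T^*M$ is $\Omega=\sum_i p_i\,\partial H/\partial p_i$. Put $P^r_s=\delta^r_s-v^rp_s/\Omega$ with $v^r=\partial H/\partial p_r$. Extended tensor fields. An extended tensor field of type $(r,s)$ assigns to each point $(p,\mathbf p)\in T^*M$ a tensor of type $(r,s)$ at $p\in M$; its components are functions of $x^1,\dots,x^n,p_1,\dots,p_n$. An extended connection $\Gamma$ is given in each chart by smooth functions $\Gamma^k_{ij}(x,p)$ on $T^*M$ obeying the usual transformation law of affine connection components; it is symmetric if $\Gamma^k_{ij}=\Gamma^k_{ji}$. Covariant derivatives: $\tilde\nabla^q X=\partial X/\partial p_q$ componentwise for every extended tensor field; for an extended scalar field $f$ (such as $H$, $\Omega$), $\nabla_qf=\partial f/\partial x^q+\sum_{a,b}p_a\Gamma^a_{qb}\,\partial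 f/\partial p_b$; for an extended covector field, $\nabla_qQ_s=\partial Q_s/\partial x^q+\sum_{a,b}p_a\Gamma^a_{qb}\,\partial Q_s/\partial p_b-\sum_b\Gamma^b_{qs}Q_b$. Weak normality condition. Trajectories are solutions $(x(t),\mathbf p(t))$ of the system with $\mathbf p(t)\ne0$. Include a given trajectory in a smooth one-parameter family of trajectories $x^i=x^i(t,y)$, $p_i=p_i(t,y)$, and put $\tau^s=\partial x^s/\partial y$ and $\varphi=\sum_s p_s\tau^s$, evaluated on the given trajectory; each function $\varphi=\varphi(t)$ so obtained (over all such inclusions) is called a deviation function on the given trajectory. The system satisfies the weak normality condition if for each trajectory there is a second order homogeneous linear ordinary differential equation $\ddot\varphi=\mathcal A(t)\dot\varphi+\mathcal B(t)\varphi$ (with $\mathcal A,\mathcal B$ depending only on the trajectory) satisfied by all deviation functions on this trajectory. *)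

theory Defs
  imports "HOL-Analysis.Analysis"
begin

section \<open>Smooth maps and smooth manifolds\<close>

primrec higher_differentiable_on ::
  "'a set \<Rightarrow> ('a::real_normed_vector \<Rightarrow> 'b::real_normed_vector) \<Rightarrow> nat \<Rightarrow> bool" where
  "higher_differentiable_on S f 0 \<longleftrightarrow> continuous_on S f"
| "higher_differentiable_on S f (Suc k) \<longleftrightarrow>
     (\<forall>x\<in>S. f differentiable (at x)) \<and>
     (\<forall>w. higher_differentiable_on S (\<lambda>x. frechet_derivative f (at x) w) k)"

text \<open>Class C-infinity; only used for open \<open>S\<close>.\<close>
definition smooth_on :: "'a set \<Rightarrow> ('a::real_normed_vector \<Rightarrow> 'b::real_normed_vector) \<Rightarrow> bool" where
  "smooth_on S f \<longleftrightarrow> (\<forall>k. higher_differentiable_on S f k)"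

text \<open>A chart is a pair of its domain and its coordinate map; the values of the coordinate
  map outside the domain are irrelevant.\<close>
type_synonym ('a, 'e) chart = "'a set \<times> ('a \<Rightarrow> 'e)"

definition transition :: "('a, 'e) chart \<Rightarrow> ('a, 'f) chart \<Rightarrow> 'e \<Rightarrow> 'f" where
  "transition c c' = snd c' \<circ> inv_into (fst c) (snd c)"

text \<open>The atlas \<open>A\<close> need not be maximal.\<close>
definition smooth_manifold :: "'a topology \<Rightarrow> ('a, 'e::euclidean_space) chart set \<Rightarrow> bool" where
  "smooth_manifold X A \<longleftrightarrow>
     Hausdorff_space X \<and> second_countable X \<and> \<Union>(fst ` A) = topspace X \<and>
     (\<forall>c\<in>A. openin X (fst c) \<and> open (snd c ` fst c) \<and>
        homeomorphic_map (subtopology X (fst c)) (top_of_set (snd c ` fst c)) (snd c)) \<and>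
     (\<forall>c\<in>A. \<forall>c'\<in>A. smooth_on (snd c ` (fst c \<inter> fst c')) (transition c c'))"

text \<open>Smooth maps from \<open>S\<close> to \<open>T\<close>, where \<open>S\<close> and \<open>T\<close> are open subsets of the sets on which the
  atlases \<open>A\<close> and \<open>B\<close> are given. The openness condition expresses the continuity of \<open>f\<close>.\<close>
definition smooth_between ::
  "('a, 'e::real_normed_vector) chart set \<Rightarrow> 'a set \<Rightarrow> ('b, 'f::real_normed_vector) chart set \<Rightarrow> 'b set
    \<Rightarrow> ('a \<Rightarrow> 'b) \<Rightarrow> bool" where
  "smooth_between A S B T f \<longleftrightarrow>
     f ` S \<subseteq> T \<and>
     (\<forall>c\<in>A. \<forall>d\<in>B.
        open (snd c ` (fst c \<inter> S \<inter> f -` fst d)) \<and>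
        smooth_on (snd c ` (fst c \<inter> S \<inter> f -` fst d)) (snd d \<circ> f \<circ> inv_into (fst c) (snd c)))"

definition diffeo_between ::
  "('a, 'e::real_normed_vector) chart set \<Rightarrow> 'a set \<Rightarrow> ('b, 'f::real_normed_vector) chart set \<Rightarrow> 'b set
    \<Rightarrow> ('a \<Rightarrow> 'b) \<Rightarrow> bool" where
  "diffeo_between A S B T f \<longleftrightarrow>
     bij_betw f S T \<and> smooth_between A S B T f \<and> smooth_between B T A S (inv_into S f)"

definition std_atlas :: "('e, 'e) chart set" where
  "std_atlas = {(UNIV, id)}"

section \<open>Tangent and cotangent bundles\<close>

text \<open>\<open>jac c c' x j i\<close> is the derivative of the \<open>j\<close>-th coordinate of \<open>c'\<close> with respect to the
  \<open>i\<close>-th coordinate of \<open>c\<close>; \<open>hess c c' x j i k\<close> is the second derivative with respect to the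
  \<open>i\<close>-th and \<open>k\<close>-th coordinates of \<open>c\<close>.\<close>
definition jac :: "('a, real^'n) chart \<Rightarrow> ('a, real^'n) chart \<Rightarrow> 'a \<Rightarrow> 'n \<Rightarrow> 'n \<Rightarrow> real" where
  "jac c c' x j i = frechet_derivative (transition c c') (at (snd c x)) (axis i 1) $ j"

definition hess :: "('a, real^'n) chart \<Rightarrow> ('a, real^'n) chart \<Rightarrow> 'a \<Rightarrow> 'n \<Rightarrow> 'n \<Rightarrow> 'n \<Rightarrow> real" where
  "hess c c' x j i k =
     frechet_derivative (\<lambda>Y. frechet_derivative (transition c c') (at Y) (axis k 1) $ j)
       (at (snd c x)) (axis i 1)"

text \<open>A tangent vector or covector at \<open>x\<close> is given by its components in all charts around \<open>x\<close>,
  related by the vector or covector transformation law; the entries for all other charts are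
  set to 0, so that distinct functions represent distinct (co)vectors.\<close>
type_synonym ('a, 'e) components = "('a, 'e) chart \<Rightarrow> 'e"

definition tangent_space ::
  "('a, real^'n) chart set \<Rightarrow> 'a \<Rightarrow> ('a, real^'n) components set" where
  "tangent_space A x = {v.
     (\<forall>c. \<not> (c \<in> A \<and> x \<in> fst c) \<longrightarrow> v c = 0) \<and>
     (\<forall>c\<in>A. \<forall>c'\<in>A. x \<in> fst c \<inter> fst c' \<longrightarrow>
        (\<forall>j. v c' $ j = (\<Sum>i\<in>UNIV. jac c c' x j i * v c $ i)))}"

definition cotangent_space ::
  "('a, real^'n) chart set \<Rightarrow> 'a \<Rightarrow> ('a, real^'n) components set" where
  "cotangent_space A x = {p.
     (\<forall>c. \<not> (c \<in> A \<and> x \<in> fst c) \<longrightarrow> p c = 0) \<and>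
     (\<forall>c\<in>A. \<forall>c'\<in>A. x \<in> fst c \<inter> fst c' \<longrightarrow>
        (\<forall>i. p c $ i = (\<Sum>j\<in>UNIV. jac c c' x j i * p c' $ j)))}"

definition zero_vec :: "('a, real^'n) components" where
  "zero_vec = (\<lambda>c. 0)"

type_synonym ('a, 'e) bundle_pt = "'a \<times> ('a, 'e) components"

definition tangent_bundle ::
  "('a, real^'n) chart set \<Rightarrow> ('a, real^'n) bundle_pt set" where
  "tangent_bundle A = {(x, v). x \<in> \<Union>(fst ` A) \<and> v \<in> tangent_space A x}"

definition cotangent_bundle ::
  "('a, real^'n) chart set \<Rightarrow> ('a, real^'n) bundle_pt set" where
  "cotangent_bundle A = {(x, p). x \<in> \<Union>(fst ` A) \<and> p \<in> cotangent_space A x}"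

text \<open>The chart induced on a bundle \<open>E\<close> (tangent or cotangent) by a chart of the base.\<close>
definition bundle_chart ::
  "('a, real^'n) bundle_pt set \<Rightarrow> ('a, real^'n) chart \<Rightarrow>
     (('a, real^'n) bundle_pt, (real^'n) \<times> (real^'n)) chart" where
  "bundle_chart E c = ({z \<in> E. fst z \<in> fst c}, \<lambda>z. (snd c (fst z), snd z c))"

definition bundle_atlas ::
  "('a, real^'n) chart set \<Rightarrow> ('a, real^'n) bundle_pt set \<Rightarrow>
     (('a, real^'n) bundle_pt, (real^'n) \<times> (real^'n)) chart set" where
  "bundle_atlas A E = bundle_chart E ` A"

definition local_rep ::
  "('a, real^'n) bundle_pt set \<Rightarrow> ('a, real^'n) chart \<Rightarrow> (('a, real^'n) bundle_pt \<Rightarrow> real) \<Rightarrow>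
     (real^'n) \<times> (real^'n) \<Rightarrow> real" where
  "local_rep E c f = f \<circ> inv_into (fst (bundle_chart E c)) (snd (bundle_chart E c))"

text \<open>Partial derivatives of a function on \<open>E\<close> with respect to the base coordinates and with
  respect to the fibre coordinates of the chart \<open>c\<close>.\<close>
definition partial_base ::
  "('a, real^'n) bundle_pt set \<Rightarrow> ('a, real^'n) chart \<Rightarrow> 'n \<Rightarrow> (('a, real^'n) bundle_pt \<Rightarrow> real) \<Rightarrow>
     ('a, real^'n) bundle_pt \<Rightarrow> real" where
  "partial_base E c i f z =
     frechet_derivative (local_rep E c f) (at (snd (bundle_chart E c) z)) (axis i 1, 0)"

definition partial_fibre ::
  "('a, real^'n) bundle_pt set \<Rightarrow> ('a, real^'n) chart \<Rightarrow> 'n \<Rightarrow> (('a, real^'n) bundle_pt \<Rightarrow> real) \<Rightarrow>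
     ('a, real^'n) bundle_pt \<Rightarrow> real" where
  "partial_fibre E c i f z =
     frechet_derivative (local_rep E c f) (at (snd (bundle_chart E c) z)) (0, axis i 1)"

section \<open>Lagrangian and Hamiltonian functions\<close>

definition legendre ::
  "('a, real^'n) chart set \<Rightarrow> (('a, real^'n) bundle_pt \<Rightarrow> real) \<Rightarrow>
     ('a, real^'n) bundle_pt \<Rightarrow> ('a, real^'n) bundle_pt" where
  "legendre A L z =
     (fst z, \<lambda>c. if c \<in> A \<and> fst z \<in> fst c
                 then (\<chi> i. partial_fibre (tangent_bundle A) c i L z) else 0)"

definition chart_at :: "('a, real^'n) chart set \<Rightarrow> 'a \<Rightarrow> ('a, real^'n) chart" where
  "chart_at A x = (SOME c. c \<in> A \<and> x \<in> fst c)"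

text \<open>The value of \<open>\<Sum>\<^sub>i v\<^sup>i \<partial>L/\<partial>v\<^sup>i\<close> does not depend on the chart in which it is computed.\<close>
definition Omega ::
  "('a, real^'n) chart set \<Rightarrow> (('a, real^'n) bundle_pt \<Rightarrow> real) \<Rightarrow> ('a, real^'n) bundle_pt \<Rightarrow> real" where
  "Omega A L z = (let c = chart_at A (fst z) in
     \<Sum>i\<in>UNIV. snd z c $ i * partial_fibre (tangent_bundle A) c i L z)"

definition mu_map ::
  "('a, real^'n) chart set \<Rightarrow> (('a, real^'n) bundle_pt \<Rightarrow> real) \<Rightarrow>
     ('a, real^'n) bundle_pt \<Rightarrow> ('a, real^'n) bundle_pt" where
  "mu_map A L z = (fst z, \<lambda>c. (1 / Omega A L z) *\<^sub>R snd z c)"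

definition nonzero_part :: "('a, real^'n) bundle_pt set \<Rightarrow> ('a, real^'n) bundle_pt set" where
  "nonzero_part E = {z \<in> E. snd z \<noteq> zero_vec}"

definition regular_lagrangian ::
  "('a, real^'n) chart set \<Rightarrow> (('a, real^'n) bundle_pt \<Rightarrow> real) \<Rightarrow> bool" where
  "regular_lagrangian A L \<longleftrightarrow>
     (let TM = tangent_bundle A; CM = cotangent_bundle A in
       smooth_between (bundle_atlas A TM) TM std_atlas UNIV L \<and>
       diffeo_between (bundle_atlas A TM) TM (bundle_atlas A CM) CM (legendre A L) \<and>
       (\<forall>z \<in> nonzero_part TM. Omega A L z > 0) \<and>
       diffeo_between (bundle_atlas A TM) (nonzero_part TM)
                      (bundle_atlas A TM) (nonzero_part TM) (mu_map A L))"

definition hamiltonian ::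
  "('a, real^'n) chart set \<Rightarrow> (('a, real^'n) bundle_pt \<Rightarrow> real) \<Rightarrow> ('a, real^'n) bundle_pt \<Rightarrow> real" where
  "hamiltonian A L =
     (\<lambda>z. Omega A L z - L z) \<circ> inv_into (tangent_bundle A) (legendre A L)"

text \<open>The function \<^const>\<open>Omega\<close> transported to the cotangent bundle by the Legendre map.\<close>
definition Omega_cot ::
  "('a, real^'n) chart set \<Rightarrow> (('a, real^'n) bundle_pt \<Rightarrow> real) \<Rightarrow> ('a, real^'n) bundle_pt \<Rightarrow> real" where
  "Omega_cot A L = Omega A L \<circ> inv_into (tangent_bundle A) (legendre A L)"

section \<open>Extended covector fields and extended connections\<close>

definition extended_covector_field ::
  "('a, real^'n) chart set \<Rightarrow> (('a, real^'n) bundle_pt \<Rightarrow> ('a, real^'n) components) \<Rightarrow> bool" where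
  "extended_covector_field A Q \<longleftrightarrow>
     (let CM = cotangent_bundle A in
       (\<forall>z\<in>CM. Q z \<in> cotangent_space A (fst z)) \<and>
       (\<forall>c\<in>A. smooth_between (bundle_atlas A CM) {z \<in> CM. fst z \<in> fst c} std_atlas UNIV (\<lambda>z. Q z c)))"

text \<open>\<open>\<Gamma> c z k i j\<close> is the component of \<open>\<Gamma>\<close> with upper index \<open>k\<close> and lower indices \<open>i\<close>, \<open>j\<close>
  in the chart \<open>c\<close> at the point \<open>z\<close> of the cotangent bundle.\<close>
type_synonym ('a, 'e, 'n) connection =
  "('a, 'e) chart \<Rightarrow> ('a, 'e) bundle_pt \<Rightarrow> 'n \<Rightarrow> 'n \<Rightarrow> 'n \<Rightarrow> real"

definition extended_connection ::
  "('a, real^'n) chart set \<Rightarrow> ('a, real^'n, 'n) connection \<Rightarrow> bool" where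
  "extended_connection A \<Gamma> \<longleftrightarrow>
     (let CM = cotangent_bundle A in
       (\<forall>c\<in>A. \<forall>k i j.
          smooth_between (bundle_atlas A CM) {z \<in> CM. fst z \<in> fst c} std_atlas UNIV (\<lambda>z. \<Gamma> c z k i j)) \<and>
       (\<forall>c\<in>A. \<forall>c'\<in>A. \<forall>z\<in>CM. fst z \<in> fst c \<inter> fst c' \<longrightarrow>
          (\<forall>k i j. \<Gamma> c' z k i j =
             (\<Sum>m\<in>UNIV. \<Sum>r\<in>UNIV. \<Sum>q\<in>UNIV.
                jac c c' (fst z) k m * jac c' c (fst z) r i * jac c' c (fst z) q j * \<Gamma> c z m r q) +
             (\<Sum>m\<in>UNIV. jac c c' (fst z) k m * hess c' c (fst z) m i j))))"

definition symmetric_connection ::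
  "('a, real^'n) chart set \<Rightarrow> ('a, real^'n, 'n) connection \<Rightarrow> bool" where
  "symmetric_connection A \<Gamma> \<longleftrightarrow>
     (\<forall>c\<in>A. \<forall>z\<in>cotangent_bundle A. fst z \<in> fst c \<longrightarrow> (\<forall>k i j. \<Gamma> c z k i j = \<Gamma> c z k j i))"

text \<open>Covariant derivatives, computed in the chart \<open>c\<close>. The derivative \<open>tnabla\<close> acts
  componentwise and serves both scalar fields and components of covector fields.\<close>
definition tnabla ::
  "('a, real^'n) chart set \<Rightarrow> ('a, real^'n) chart \<Rightarrow> 'n \<Rightarrow> (('a, real^'n) bundle_pt \<Rightarrow> real) \<Rightarrow>
     ('a, real^'n) bundle_pt \<Rightarrow> real" where
  "tnabla A c q f z = partial_fibre (cotangent_bundle A) c q f z"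

definition nabla ::
  "('a, real^'n) chart set \<Rightarrow> ('a, real^'n, 'n) connection \<Rightarrow> ('a, real^'n) chart \<Rightarrow> 'n \<Rightarrow>
     (('a, real^'n) bundle_pt \<Rightarrow> real) \<Rightarrow> ('a, real^'n) bundle_pt \<Rightarrow> real" where
  "nabla A \<Gamma> c q f z =
     partial_base (cotangent_bundle A) c q f z +
     (\<Sum>a\<in>UNIV. \<Sum>b\<in>UNIV.
        snd z c $ a * \<Gamma> c z a q b * partial_fibre (cotangent_bundle A) c b f z)"

definition nabla_cov ::
  "('a, real^'n) chart set \<Rightarrow> ('a, real^'n, 'n) connection \<Rightarrow> ('a, real^'n) chart \<Rightarrow> 'n \<Rightarrow>
     (('a, real^'n) bundle_pt \<Rightarrow> ('a, real^'n) components) \<Rightarrow> 'n \<Rightarrow> ('a, real^'n) bundle_pt \<Rightarrow> real" where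
  "nabla_cov A \<Gamma> c q Q s z =
     partial_base (cotangent_bundle A) c q (\<lambda>w. Q w c $ s) z +
     (\<Sum>a\<in>UNIV. \<Sum>b\<in>UNIV.
        snd z c $ a * \<Gamma> c z a q b * partial_fibre (cotangent_bundle A) c b (\<lambda>w. Q w c $ s) z) -
     (\<Sum>b\<in>UNIV. \<Gamma> c z b q s * Q z c $ b)"

text \<open>\<open>P_op A H \<Omega> c z r s\<close> has upper index \<open>r\<close> and lower index \<open>s\<close>.\<close>
definition P_op ::
  "('a, real^'n) chart set \<Rightarrow> (('a, real^'n) bundle_pt \<Rightarrow> real) \<Rightarrow> (('a, real^'n) bundle_pt \<Rightarrow> real) \<Rightarrow>
     ('a, real^'n) chart \<Rightarrow> ('a, real^'n) bundle_pt \<Rightarrow> 'n \<Rightarrow> 'n \<Rightarrow> real" where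
  "P_op A H \<Omega> c z r s =
     (if r = s then 1 else 0) - partial_fibre (cotangent_bundle A) c r H z * snd z c $ s / \<Omega> z"

section \<open>Trajectories, deviation functions and weak normality\<close>

definition trajectory ::
  "('a, real^'n) chart set \<Rightarrow> (('a, real^'n) bundle_pt \<Rightarrow> real) \<Rightarrow> (('a, real^'n) bundle_pt \<Rightarrow> real) \<Rightarrow>
     (('a, real^'n) bundle_pt \<Rightarrow> ('a, real^'n) components) \<Rightarrow>
     real set \<Rightarrow> (real \<Rightarrow> ('a, real^'n) bundle_pt) \<Rightarrow> bool" where
  "trajectory A H \<Omega> Q I \<gamma> \<longleftrightarrow>
     (let CM = cotangent_bundle A in
       open I \<and> is_interval I \<and>
       smooth_between std_atlas I (bundle_atlas A CM) (nonzero_part CM) \<gamma> \<and>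
       (\<forall>t\<in>I. \<forall>c\<in>A. fst (\<gamma> t) \<in> fst c \<longrightarrow>
          ((\<lambda>s. (snd c (fst (\<gamma> s)), snd (\<gamma> s) c)) has_vector_derivative
             ((\<chi> i. 1 / \<Omega> (\<gamma> t) * partial_fibre CM c i H (\<gamma> t)),
              (\<chi> i. - (1 / \<Omega> (\<gamma> t)) * partial_base CM c i H (\<gamma> t) + Q (\<gamma> t) c $ i))) (at t)))"

text \<open>\<open>F (t, y)\<close> is the smooth one-parameter family of trajectories containing \<open>\<gamma>\<close> for \<open>y = 0\<close>.
  The sum expressing \<open>\<phi> t\<close> does not depend on the chart.\<close>
definition deviation_function ::
  "('a, real^'n) chart set \<Rightarrow> (('a, real^'n) bundle_pt \<Rightarrow> real) \<Rightarrow> (('a, real^'n) bundle_pt \<Rightarrow> real) \<Rightarrow>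
     (('a, real^'n) bundle_pt \<Rightarrow> ('a, real^'n) components) \<Rightarrow>
     real set \<Rightarrow> (real \<Rightarrow> ('a, real^'n) bundle_pt) \<Rightarrow> (real \<Rightarrow> real) \<Rightarrow> bool" where
  "deviation_function A H \<Omega> Q I \<gamma> \<phi> \<longleftrightarrow>
     (let CM = cotangent_bundle A in
       \<exists>e>0. \<exists>F :: real \<times> real \<Rightarrow> ('a, real^'n) bundle_pt.
         smooth_between std_atlas (I \<times> {-e<..<e}) (bundle_atlas A CM) (nonzero_part CM) F \<and>
         (\<forall>y\<in>{-e<..<e}. trajectory A H \<Omega> Q I (\<lambda>t. F (t, y))) \<and>
         (\<forall>t\<in>I. F (t, 0) = \<gamma> t) \<and>
         (\<forall>t\<in>I. \<forall>c\<in>A. fst (\<gamma> t) \<in> fst c \<longrightarrow>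
            \<phi> t = (\<Sum>s\<in>UNIV. snd (\<gamma> t) c $ s *
                       vector_derivative (\<lambda>y. snd c (fst (F (t, y)))) (at 0) $ s)))"

definition weak_normality ::
  "('a, real^'n) chart set \<Rightarrow> (('a, real^'n) bundle_pt \<Rightarrow> real) \<Rightarrow> (('a, real^'n) bundle_pt \<Rightarrow> real) \<Rightarrow>
     (('a, real^'n) bundle_pt \<Rightarrow> ('a, real^'n) components) \<Rightarrow> bool" where
  "weak_normality A H \<Omega> Q \<longleftrightarrow>
     (\<forall>I \<gamma>. trajectory A H \<Omega> Q I \<gamma> \<longrightarrow>
       (\<exists>a b :: real \<Rightarrow> real. \<forall>\<phi>. deviation_function A H \<Omega> Q I \<gamma> \<phi> \<longrightarrow>
          (\<forall>t\<in>I. deriv (deriv \<phi>) t = a t * deriv \<phi> t + b t * \<phi> t)))"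

end

theory Submission
  imports Defs
begin

text \<open>
  In a chart the system is an ordinary differential equation on pairs \<open>(x, p)\<close>. A family of
  trajectories yields a solution \<open>W = (\<tau>, \<xi>)\<close> of the variational equation, with
  \<open>\<tau> = \<partial>x/\<partial>y\<close> and \<open>\<xi> = \<partial>p/\<partial>y\<close>, and \<open>\<phi> = p \<cdot> \<tau>\<close>. As \<open>p \<cdot> \<partial>H/\<partial>p = \<Omega>\<close>, the
  velocity \<open>v/\<Omega>\<close> pairs with \<open>p\<close> to 1, so \<open>\<phi>\<close>, its first and its second derivative at a
  point are linear functionals of \<open>W\<close> that depend only on the point: \<open>\<phi>' = Q \<cdot> \<tau> - dH(W)/\<Omega>\<close>,
  and \<open>\<phi>''\<close> contains no second derivatives of \<open>H\<close> because \<open>dH(W)\<close> changes at the rate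
  \<open>d(v \<cdot> Q)(W)\<close>. Local flows are smooth in the initial data, so all \<open>W\<close> occur, and weak
  normality says that the functional \<open>\<phi>''\<close> lies in the span of \<open>\<phi>'\<close> and \<open>\<phi>\<close> at each point.
  Its \<open>\<xi>\<close>-part gives the first normality equation and its \<open>\<tau>\<close>-part the second one for
  \<open>\<Gamma> = 0\<close>; the \<open>\<Gamma>\<close>-terms cancel by symmetry and by the first equation.\<close>

section \<open>Higher differentiability\<close>

text \<open>Two quantifiers shape the proof. One linear equation has to serve all deviation
  functions of a trajectory, so the families that realize different variations must share one curve
  on one time interval; hence the length of the local flow is chosen from the initial point alone,
  and only the width in \<open>y\<close> depends on the direction. Conversely the coefficients are
  arbitrary functions of time, which permits a choice at each instant separately.

  The flow is built in one chart, but a trajectory has to satisfy the equations in every chart. This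
  costs the invariance of the dynamics under coordinate changes, where second derivatives of the
  transition maps enter and cancel. Division by \<Omega> away from the zero section of the cotangent
  bundle requires that nonzero covectors come from nonzero vectors, while regularity states
  positivity on the tangent side.

  The operator P appears because \<open>p . v = \<Omega>\<close>: contraction with P tests whether a
  list of components is a multiple of \<open>v\<close> or of \<open>p\<close>. The two multipliers
  fix the coefficients of the equation, and pairing with \<open>p\<close> and with \<open>v\<close>
  reads them off.\<close>

abbreviation hdo where "hdo \<equiv> higher_differentiable_on"
abbreviation frechet where "frechet \<equiv> frechet_derivative"

lemma hdo_subset: "hdo S f k \<Longrightarrow> T \<subseteq> S \<Longrightarrow> hdo T f k"
  by (induction k arbitrary: f) (auto intro: continuous_on_subset)

lemma hdo_continuous_on: "hdo S f k \<Longrightarrow> continuous_on S f"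
  by (cases k) (simp_all add: continuous_at_imp_continuous_on differentiable_imp_continuous_within)

text \<open>The definition at \<open>Suc k\<close> does not list level \<open>k\<close>. The
  induction descends through the directional derivatives, with continuity of differentiable maps at
  the bottom.\<close>

lemma hdo_SucD: "hdo S f (Suc k) \<Longrightarrow> hdo S f k"
proof (induction k arbitrary: f)
  case 0
  show ?case using hdo_continuous_on[OF 0] by simp
next
  case (Suc k)
  have "hdo S (\<lambda>x. frechet f (at x) w) k" for w
    by (rule Suc.IH) (use Suc.prems in simp)
  then show ?case using Suc.prems by simp
qed

lemma frechet_derivative_cong_open:
  assumes "open S" "x \<in> S" "\<And>x. x \<in> S \<Longrightarrow> f x = g x"
  shows "frechet f (at x) = frechet g (at x)"
proof -
  have "(f has_derivative D) (at x) \<longleftrightarrow> (g has_derivative D) (at x)" for D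
  proof
    assume "(f has_derivative D) (at x)"
    then show "(g has_derivative D) (at x)"
      by (rule has_derivative_transform_within_open[OF _ assms(1,2)]) (rule assms(3))
  next
    assume "(g has_derivative D) (at x)"
    then show "(f has_derivative D) (at x)"
      by (rule has_derivative_transform_within_open[OF _ assms(1,2)]) (rule assms(3)[symmetric])
  qed
  then show ?thesis by (simp add: frechet_derivative_def)
qed

lemma hdo_cong:
  assumes "open S" "hdo S g k" "\<And>x. x \<in> S \<Longrightarrow> f x = g x"
  shows "hdo S f k"
  using assms(2,3)
proof (induction k arbitrary: f g)
  case 0
  have "continuous_on S g" using 0(1) by simp
  then have "continuous_on S f" by (rule continuous_on_eq) (rule 0(2)[symmetric])
  then show ?case by simp
next
  case (Suc k)
  have "f differentiable at x" if x: "x \<in> S" for x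
  proof -
    have "(g has_derivative frechet g (at x)) (at x)"
      using Suc.prems(1) x frechet_derivative_works by auto
    then have "(f has_derivative frechet g (at x)) (at x)"
      by (rule has_derivative_transform_within_open[OF _ assms(1) x]) (rule Suc.prems(2)[symmetric])
    then show ?thesis by (rule differentiableI)
  qed
  moreover have "hdo S (\<lambda>x. frechet f (at x) w) k" for w
  proof (rule Suc.IH)
    show "hdo S (\<lambda>x. frechet g (at x) w) k" using Suc.prems(1) by simp
    show "frechet f (at x) w = frechet g (at x) w" if "x \<in> S" for x
      using frechet_derivative_cong_open[OF assms(1) that Suc.prems(2)] by simp
  qed
  ultimately show ?case by simp
qed

text \<open>Replaces \<open>frechet_derivative\<close> by an explicit formula \<open>f'\<close>. The
  closure properties below then reduce to the induction hypothesis applied to that formula.\<close>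

lemma hdo_SucI:
  assumes "open S" "\<And>x. x \<in> S \<Longrightarrow> (f has_derivative f' x) (at x)"
    and "\<And>w. hdo S (\<lambda>x. f' x w) k"
  shows "hdo S f (Suc k)"
proof -
  have "frechet f (at x) = f' x" if "x \<in> S" for x
    using assms(2)[OF that] frechet_derivative_at by metis
  then have "hdo S (\<lambda>x. frechet f (at x) w) k" for w
    by (intro hdo_cong[OF assms(1) assms(3)[of w]]) auto
  moreover have "f differentiable at x" if "x \<in> S" for x
    using assms(2)[OF that] by (rule differentiableI)
  ultimately show ?thesis by simp
qed

lemma hdo_const: "hdo S (\<lambda>x. c) k"
proof (induction k arbitrary: c)
  case (Suc k) then show ?case by auto
qed auto

lemma hdo_bounded_linear:
  assumes "bounded_linear f" "open S"
  shows "hdo S f k"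
proof (cases k)
  case 0
  then show ?thesis using assms by (simp add: linear_continuous_on)
next
  case (Suc m)
  show ?thesis
    unfolding Suc by (rule hdo_SucI[OF assms(2) bounded_linear_imp_has_derivative[OF assms(1)] hdo_const])
qed

lemma has_frechet_derivative: "f differentiable at x \<Longrightarrow> (f has_derivative frechet f (at x)) (at x)"
  by (rule iffD1[OF frechet_derivative_works])

lemma hdo_has_derivative:
  "hdo S f (Suc k) \<Longrightarrow> x \<in> S \<Longrightarrow> (f has_derivative frechet f (at x)) (at x)"
  by (auto intro: has_frechet_derivative)

lemma hdo_derivative: "hdo S f (Suc k) \<Longrightarrow> hdo S (\<lambda>x. frechet f (at x) w) k"
  by auto

lemma hdo_linear_compose:
  assumes "bounded_linear h" "open S" "hdo S f k"
  shows "hdo S (\<lambda>x. h (f x)) k"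
  using assms(3)
proof (induction k arbitrary: f)
  case 0
  then show ?case using assms(1) by (auto intro: bounded_linear.continuous_on)
next
  case (Suc k)
  show ?case
    by (rule hdo_SucI[OF assms(2) bounded_linear.has_derivative[OF assms(1) hdo_has_derivative[OF Suc.prems]]])
      (use Suc.IH Suc.prems in auto)
qed

lemma hdo_add:
  assumes "open S" "hdo S f k" "hdo S g k"
  shows "hdo S (\<lambda>x. f x + g x) k"
  using assms(2,3)
proof (induction k arbitrary: f g)
  case 0
  then show ?case by (auto intro: continuous_intros)
next
  case (Suc k)
  show ?case
    by (rule hdo_SucI[OF assms(1) has_derivative_add[OF hdo_has_derivative hdo_has_derivative]])
      (use Suc in auto)
qed

lemma hdo_sum:
  assumes "open S" "\<And>i. i \<in> I \<Longrightarrow> hdo S (f i) k"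
  shows "hdo S (\<lambda>x. \<Sum>i\<in>I. f i x) k"
  using assms(2)
  by (induction I rule: infinite_finite_induct) (auto intro!: hdo_add assms(1) hdo_const)

text \<open>The product rule applies the same bilinear map to \<open>f\<close>, \<open>g\<close> and
  their derivatives, so the induction runs over both functions at once.\<close>

lemma hdo_bilinear:
  assumes "bounded_bilinear h" "open S" "hdo S f k" "hdo S g k"
  shows "hdo S (\<lambda>x. h (f x) (g x)) k"
  using assms(3,4)
proof (induction k arbitrary: f g)
  case 0
  then show ?case using bounded_bilinear.continuous_on[OF assms(1)] by auto
next
  case (Suc k)
  show ?case
    by (rule hdo_SucI[OF assms(2) bounded_bilinear.FDERIV[OF assms(1) hdo_has_derivative[OF Suc.prems(1)] hdo_has_derivative[OF Suc.prems(2)]]])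
      (use Suc.prems in \<open>auto intro!: hdo_add[OF assms(2)] Suc.IH intro: hdo_SucD simp del: higher_differentiable_on.simps(2)
        intro: hdo_derivative\<close>)
qed

lemmas hdo_mult = hdo_bilinear[OF bounded_bilinear_mult]
lemmas hdo_scaleR = hdo_bilinear[OF bounded_bilinear_scaleR]
lemmas hdo_inner = hdo_bilinear[OF bounded_bilinear_inner]

lemma hdo_minus: "open S \<Longrightarrow> hdo S f k \<Longrightarrow> hdo S (\<lambda>x. - f x) k"
  by (rule hdo_linear_compose[OF bounded_linear_minus[OF bounded_linear_ident]])

lemma hdo_diff: "open S \<Longrightarrow> hdo S f k \<Longrightarrow> hdo S g k \<Longrightarrow> hdo S (\<lambda>x. f x - g x) k"
  using hdo_add[OF _ _ hdo_minus, of S f k g] by simp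

lemma linear_euclidean_expand:
  fixes f :: "'a::euclidean_space \<Rightarrow> 'b::real_vector"
  assumes "linear f"
  shows "f w = (\<Sum>b\<in>Basis. (w \<bullet> b) *\<^sub>R f b)"
proof -
  have "f w = f (\<Sum>b\<in>Basis. (w \<bullet> b) *\<^sub>R b)" by (simp add: euclidean_representation)
  then show ?thesis by (simp add: linear_sum[OF assms] linear_scale[OF assms])
qed

text \<open>In the chain rule the direction in which \<open>g\<close> is differentiated varies with
  \<open>x\<close>. Expanding it in \<open>Basis\<close> leaves derivatives of \<open>g\<close> in
  fixed directions, to which the induction hypothesis applies.\<close>

lemma hdo_compose:
  fixes g :: "'b::euclidean_space \<Rightarrow> 'c::real_normed_vector" and f :: "'a::real_normed_vector \<Rightarrow> 'b"
  assumes "open S" "open T" "f ` S \<subseteq> T" "hdo S f k" "hdo T g k"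
  shows "hdo S (\<lambda>x. g (f x)) k"
  using assms(4,5)
proof (induction k arbitrary: g)
  case 0
  then show ?case using assms(3) by (auto intro: continuous_on_compose2)
next
  case (Suc k)
  have f: "hdo S f k" using Suc.prems(1) by (rule hdo_SucD)
  have "hdo S (\<lambda>x. \<Sum>b\<in>Basis. (frechet f (at x) w \<bullet> b) *\<^sub>R frechet g (at (f x)) b) k" for w
    using Suc by (intro hdo_sum hdo_scaleR assms(1) hdo_linear_compose[OF bounded_linear_inner_left] Suc.IH f) auto
  moreover have "((\<lambda>x. g (f x)) has_derivative
      (\<lambda>w. \<Sum>b\<in>Basis. (frechet f (at x) w \<bullet> b) *\<^sub>R frechet g (at (f x)) b)) (at x)"
    if "x \<in> S" for x
  proof -
    have g: "g differentiable at (f x)" using Suc.prems(2) assms(3) that by auto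
    have "((\<lambda>x. g (f x)) has_derivative (\<lambda>w. frechet g (at (f x)) (frechet f (at x) w))) (at x)"
      using has_derivative_compose[OF hdo_has_derivative[OF Suc.prems(1) that] has_frechet_derivative[OF g]] .
    then show ?thesis
      by (subst (asm) linear_euclidean_expand[OF linear_frechet_derivative[OF g]])
  qed
  ultimately show ?case by (intro hdo_SucI[OF assms(1)])
qed

lemma hdo_Pair:
  assumes "open S" "hdo S f k" "hdo S g k"
  shows "hdo S (\<lambda>x. (f x, g x)) k"
proof -
  have 1: "bounded_linear (\<lambda>a. (a, 0))" "bounded_linear (\<lambda>a. (0, a))"
    by (auto intro!: bounded_linear_Pair bounded_linear_ident bounded_linear_zero)
  show ?thesis
    using hdo_add[OF assms(1) hdo_linear_compose[OF 1(1) assms(1,2)] hdo_linear_compose[OF 1(2) assms(1,3)]] by simp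
qed

lemma hdo_componentwise:
  fixes f :: "'a::real_normed_vector \<Rightarrow> 'b::euclidean_space"
  assumes "open S" "\<And>b. b \<in> Basis \<Longrightarrow> hdo S (\<lambda>x. f x \<bullet> b) k"
  shows "hdo S f k"
proof -
  have "hdo S (\<lambda>x. \<Sum>b\<in>Basis. (f x \<bullet> b) *\<^sub>R b) k"
    by (intro hdo_sum hdo_scaleR hdo_const assms)
  then show ?thesis by (simp add: euclidean_representation)
qed

lemma hdo_vec:
  fixes f :: "'n::finite \<Rightarrow> 'a::real_normed_vector \<Rightarrow> real"
  assumes "open S" "\<And>i. hdo S (f i) k"
  shows "hdo S (\<lambda>x. \<chi> i. f i x) k"
proof (rule hdo_componentwise[OF assms(1)])
  fix b :: "real^'n" assume "b \<in> Basis"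
  then obtain i where "b = axis i 1" by (auto simp: Basis_vec_def)
  then show "hdo S (\<lambda>x. (\<chi> i. f i x) \<bullet> b) k" using assms(2) by (simp add: inner_axis)
qed

text \<open>The derivative of \<open>inverse\<close> is built from \<open>inverse\<close> and
  constants by products, so the induction closes.\<close>

lemma hdo_inverse_real: "hdo (- {0::real}) inverse k"
proof (induction k)
  case 0
  show ?case by (auto intro!: continuous_intros)
next
  case (Suc k)
  have o: "open (- {0::real})" by auto
  show ?case
    by (rule hdo_SucI[OF o has_derivative_inverse']) (use Suc in \<open>auto intro!: hdo_minus[OF o] hdo_mult[OF o] hdo_const\<close>)
qed

lemma hdo_inverse:
  fixes f :: "'a::real_normed_vector \<Rightarrow> real"
  assumes "open S" "hdo S f k" "\<And>x. x \<in> S \<Longrightarrow> f x \<noteq> 0"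
  shows "hdo S (\<lambda>x. inverse (f x)) k"
  by (rule hdo_compose[OF assms(1) _ _ assms(2) hdo_inverse_real]) (use assms(3) in auto)

lemma smooth_onI: "(\<And>k. hdo S f k) \<Longrightarrow> smooth_on S f"
  by (simp add: smooth_on_def)

lemma smooth_onD: "smooth_on S f \<Longrightarrow> hdo S f k"
  by (simp add: smooth_on_def)

lemma smooth_on_subset: "smooth_on S f \<Longrightarrow> T \<subseteq> S \<Longrightarrow> smooth_on T f"
  by (auto simp: smooth_on_def intro: hdo_subset)

lemma smooth_on_cong: "open S \<Longrightarrow> smooth_on S g \<Longrightarrow> (\<And>x. x \<in> S \<Longrightarrow> f x = g x) \<Longrightarrow> smooth_on S f"
  by (auto simp: smooth_on_def intro: hdo_cong)

lemma smooth_on_has_derivative: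
  "smooth_on S f \<Longrightarrow> x \<in> S \<Longrightarrow> (f has_derivative frechet f (at x)) (at x)"
  by (auto simp: smooth_on_def intro: hdo_has_derivative)

lemma smooth_on_differentiable: "smooth_on S f \<Longrightarrow> x \<in> S \<Longrightarrow> f differentiable at x"
  using smooth_on_has_derivative differentiableI by blast

lemma smooth_on_derivative: "smooth_on S f \<Longrightarrow> smooth_on S (\<lambda>x. frechet f (at x) w)"
  by (auto simp: smooth_on_def intro: hdo_derivative)

lemma smooth_on_continuous_on: "smooth_on S f \<Longrightarrow> continuous_on S f"
  by (auto simp: smooth_on_def intro: hdo_continuous_on)

lemma smooth_on_compose:
  fixes g :: "'b::euclidean_space \<Rightarrow> 'c::real_normed_vector"
  shows "smooth_on S f \<Longrightarrow> smooth_on T g \<Longrightarrow> open S \<Longrightarrow> open T \<Longrightarrow> f ` S \<subseteq> T \<Longrightarrow> smooth_on S (\<lambda>x. g (f x))"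
  by (auto simp: smooth_on_def intro: hdo_compose)

text \<open>Serves for the rate of change of a function along a vector field, where the direction
  depends on the point.\<close>

lemma smooth_on_derivative_dir:
  fixes f :: "'b::euclidean_space \<Rightarrow> 'c::real_normed_vector"
  assumes "open S" "smooth_on S f" "smooth_on S g"
  shows "smooth_on S (\<lambda>x. frechet f (at x) (g x))"
proof (rule smooth_onI, rule hdo_cong[OF assms(1)])
  show "hdo S (\<lambda>x. \<Sum>b\<in>Basis. (g x \<bullet> b) *\<^sub>R frechet f (at x) b) k" for k
    using assms(2,3) by (intro hdo_sum hdo_scaleR assms(1) hdo_linear_compose[OF bounded_linear_inner_left])
     (auto intro: smooth_onD smooth_on_derivative)
  fix x assume "x \<in> S"
  then show "frechet f (at x) (g x) = (\<Sum>b\<in>Basis. (g x \<bullet> b) *\<^sub>R frechet f (at x) b)"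
    using assms(2) by (intro linear_euclidean_expand linear_frechet_derivative smooth_on_differentiable)
qed

section \<open>Derivatives along curves and mixed partial derivatives\<close>

lemma has_vector_derivative_chain:
  assumes "(c has_vector_derivative v) (at t within T)" "(g has_derivative g') (at (c t))"
  shows "((\<lambda>t. g (c t)) has_vector_derivative g' v) (at t within T)"
proof -
  have "((\<lambda>t. g (c t)) has_derivative (\<lambda>x. g' (x *\<^sub>R v))) (at t within T)"
    using has_derivative_compose[where f = c and g = g and x = t] assms
    unfolding has_vector_derivative_def by blast
  then show ?thesis
    using linear_scale[OF has_derivative_linear[OF assms(2)]] by (simp add: has_vector_derivative_def)
qed

lemma has_vector_derivative_fst_const:
  "((\<lambda>t. (t, y)) has_vector_derivative (1, 0)) (at t within T)" for t :: real and y :: real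
  by (intro has_vector_derivative_Pair has_vector_derivative_id has_vector_derivative_const)

lemma has_vector_derivative_snd_const:
  "((\<lambda>y. (t, y)) has_vector_derivative (0, 1)) (at y within T)" for t :: real and y :: real
  by (intro has_vector_derivative_Pair has_vector_derivative_id has_vector_derivative_const)

text \<open>The difference \<open>g (t, y) - g (a - e, y)\<close> is the integral of
  \<open>gt\<close> in the first variable. Differentiation under the integral sign in
  \<open>y\<close>, followed by the fundamental theorem of calculus in \<open>t\<close>, exchanges
  the two derivatives.\<close>

lemma mixed_partials:
  fixes g :: "real \<times> real \<Rightarrow> 'b::euclidean_space"
  assumes N: "open N" "(a, b) \<in> N" "smooth_on N g"
  shows "((\<lambda>t. frechet g (at (t, b)) (0, 1)) has_vector_derivative
           frechet (\<lambda>z. frechet g (at z) (1, 0)) (at (a, b)) (0, 1)) (at a)"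
proof -
  define gy where "gy z = frechet g (at z) (0, 1)" for z
  define gt where "gt z = frechet g (at z) (1, 0)" for z
  define gty where "gty z = frechet gt (at z) (0, 1)" for z
  obtain e where e: "e > 0" "cball a e \<times> cball b e \<subseteq> N"
  proof -
    obtain A B where AB: "open A" "open B" "(a,b) \<in> A \<times> B" "A \<times> B \<subseteq> N"
      using N by (auto elim: open_prod_elim)
    then obtain e1 e2 where "e1 > 0" "cball a e1 \<subseteq> A" "e2 > 0" "cball b e2 \<subseteq> B"
      by (metis SigmaE2 open_contains_cball)
    then show ?thesis using AB by (intro that[of "min e1 e2"]) (auto simp: subset_iff)
  qed
  have sgt: "smooth_on N gt" "smooth_on N gty"
    unfolding gt_def gty_def using N by (auto intro!: smooth_on_derivative)
  have inN: "(t, y) \<in> N" if "t \<in> {a-e..a+e}" "y \<in> {b-e..b+e}" for t y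
    using e(2) that by (auto simp: cball_def dist_real_def subset_iff abs_le_iff)
  have dt: "((\<lambda>t. g (t, y)) has_vector_derivative gt (t, y)) (at t within T)"
    if "(t, y) \<in> N" for t y T
    unfolding gt_def
    by (rule has_vector_derivative_chain[OF has_vector_derivative_fst_const smooth_on_has_derivative[OF N(3) that]])
  have dy: "((\<lambda>y. g (t, y)) has_vector_derivative gy (t, y)) (at y within T)"
    if "(t, y) \<in> N" for t y T
    unfolding gy_def
    by (rule has_vector_derivative_chain[OF has_vector_derivative_snd_const smooth_on_has_derivative[OF N(3) that]])
  have dty: "((\<lambda>y. gt (t, y)) has_vector_derivative gty (t, y)) (at y within T)"
    if "(t, y) \<in> N" for t y T
    unfolding gty_def
    by (rule has_vector_derivative_chain[OF has_vector_derivative_snd_const smooth_on_has_derivative[OF sgt(1) that]])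
  have cont: "continuous_on X (\<lambda>x. h (u x, v x))"
    if "smooth_on N h" "continuous_on X u" "continuous_on X v" "\<And>x. x \<in> X \<Longrightarrow> u x \<in> {a-e..a+e} \<and> v x \<in> {b-e..b+e}"
    for h :: "real \<times> real \<Rightarrow> 'b" and u v and X :: "'z::topological_space set"
    by (rule continuous_on_compose2[OF smooth_on_continuous_on[OF that(1)]])
       (use that inN in \<open>auto intro!: continuous_intros\<close>)
  have key: "gy (t, b) - gy (a - e, b) = integral {a-e..t} (\<lambda>s. gty (s, b))" if t: "t \<in> {a-e..a+e}" for t
  proof -
    have int: "integral {a-e..t} (\<lambda>s. gt (s, y)) = g (t, y) - g (a - e, y)" if "y \<in> {b-e..b+e}" for y
      using t that by (intro integral_unique fundamental_theorem_of_calculus) (auto intro!: dt inN)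
    have "((\<lambda>y. integral (cbox (a-e) t) (\<lambda>s. gt (s, y))) has_vector_derivative
         integral (cbox (a-e) t) (\<lambda>s. gty (s, b))) (at b within {b-e..b+e})"
    proof (rule leibniz_rule_vector_derivative)
      show "((\<lambda>x. gt (s, x)) has_vector_derivative gty (s, x)) (at x within {b - e..b + e})"
        if "x \<in> {b-e..b+e}" "s \<in> cbox (a - e) t" for x s
        using that t by (intro dty inN) auto
      show "(\<lambda>s. gt (s, x)) integrable_on cbox (a - e) t" if "x \<in> {b-e..b+e}" for x
        using that t by (intro integrable_continuous cont sgt) (auto intro!: continuous_intros)
      show "continuous_on ({b - e..b + e} \<times> cbox (a - e) t) (\<lambda>(x, s). gty (s, x))"
        unfolding split_beta using t by (intro cont sgt) (auto intro!: continuous_intros)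
    qed (use e in auto)
    then have "((\<lambda>y. g (t, y) - g (a - e, y)) has_vector_derivative
         integral (cbox (a-e) t) (\<lambda>s. gty (s, b))) (at b within {b-e..b+e})"
      by (rule has_vector_derivative_transform[rotated 2]) (use int e in auto)
    moreover have "((\<lambda>y. g (t, y) - g (a - e, y)) has_vector_derivative gy (t, b) - gy (a - e, b)) (at b within {b-e..b+e})"
      using t e by (intro derivative_intros dy inN) auto
    ultimately show ?thesis
      using e vector_derivative_unique_within_closed_interval[of "b-e" "b+e" b "\<lambda>y. g (t, y) - g (a - e, y)"] by auto
  qed
  have "((\<lambda>t. integral {a-e..t} (\<lambda>s. gty (s, b))) has_vector_derivative gty (a, b)) (at a within {a-e..a+e})"
    using e by (intro integral_has_vector_derivative cont sgt) (auto intro!: continuous_intros)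
  then have "((\<lambda>t. integral {a-e..t} (\<lambda>s. gty (s, b)) + gy (a-e, b)) has_vector_derivative gty (a, b)) (at a within {a-e..a+e})"
    by (auto intro!: derivative_eq_intros)
  then have "((\<lambda>t. gy (t, b)) has_vector_derivative gty (a, b)) (at a within {a-e..a+e})"
    by (rule has_vector_derivative_transform[rotated 2]) (use e in \<open>auto simp: key[symmetric]\<close>)
  then show ?thesis
    using e by (simp add: at_within_Icc_at gy_def gty_def gt_def[abs_def])
qed

section \<open>Ordinary differential equations depending on a parameter\<close>

abbreviation box2 :: "real \<Rightarrow> real \<Rightarrow> (real \<times> real) set" where
  "box2 d e \<equiv> cbox (-d, -e) (d, e)"

section \<open>Bounds on a short time interval and existence of solutions\<close>

lemma interval_bound:
  fixes u :: "real \<Rightarrow> 'a::euclidean_space"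
  assumes d: "d \<ge> 0"
    and u: "\<And>t. t \<in> {-d..d} \<Longrightarrow> (u has_vector_derivative u' t) (at t within {-d..d})"
    and B: "\<And>t. t \<in> {-d..d} \<Longrightarrow> norm (u' t) \<le> B"
    and t: "t \<in> {-d..d}"
  shows "norm (u t - u 0) \<le> B * d"
proof -
  have "norm (u t - u 0) \<le> B * norm (t - 0)"
  proof (rule differentiable_bound[OF convex_real_interval(5)])
    show "(u has_derivative (\<lambda>x. x *\<^sub>R u' s)) (at s within {-d..d})" if "s \<in> {-d..d}" for s
      using u[OF that] by (simp add: has_vector_derivative_def)
    show "onorm (\<lambda>x. x *\<^sub>R u' s) \<le> B" if "s \<in> {-d..d}" for s
      using B[OF that] by (simp add: onorm_scaleR_left[OF bounded_linear_ident] onorm_id)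
  qed (use d t in auto)
  also have "\<dots> \<le> B * d"
    using B[of 0] d t norm_ge_zero[of "u' 0"] by (intro mult_left_mono) (auto intro: order_trans[OF norm_ge_zero])
  finally show ?thesis .
qed

text \<open>On an interval of length at most \<open>1/M\<close> no exponential is needed: the maximum of \<open>norm u\<close>
  is bounded by half of itself plus the error terms.\<close>
lemma gronwall_small_interval:
  fixes u :: "real \<Rightarrow> 'a::euclidean_space"
  assumes d: "d \<ge> 0" and M: "2 * d * M \<le> 1"
    and u: "\<And>t. t \<in> {-d..d} \<Longrightarrow> (u has_vector_derivative u' t) (at t within {-d..d})"
    and B: "\<And>t. t \<in> {-d..d} \<Longrightarrow> norm (u' t) \<le> M * norm (u t) + b"
    and 0: "M \<ge> 0"
    and t: "t \<in> {-d..d}"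
  shows "norm (u t) \<le> 2 * (norm (u 0) + d * b)"
proof -
  have c: "continuous_on {-d..d} (\<lambda>t. norm (u t))"
    using has_vector_derivative_continuous[OF u]
    by (intro continuous_on_norm) (simp add: continuous_on_eq_continuous_within)
  obtain s where s: "s \<in> {-d..d}" and max: "\<And>t. t \<in> {-d..d} \<Longrightarrow> norm (u t) \<le> norm (u s)"
    using continuous_attains_sup[OF _ _ c] d by fastforce
  have "norm (u' t) \<le> M * norm (u s) + b" if "t \<in> {-d..d}" for t
    using B[OF that] mult_left_mono[OF max[OF that] 0] by linarith
  from interval_bound[OF d u this s]
  have "norm (u s - u 0) \<le> (M * norm (u s) + b) * d" by simp
  then have "norm (u s) \<le> norm (u 0) + (d * M) * norm (u s) + d * b"
    using norm_triangle_ineq2[of "u s" "u 0"] by (simp add: algebra_simps)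
  moreover have "(d * M) * norm (u s) \<le> (1/2) * norm (u s)"
    using M by (intro mult_right_mono) auto
  ultimately have "norm (u s) \<le> 2 * (norm (u 0) + d * b)" by simp
  with max[OF t] show ?thesis by simp
qed

text \<open>The contraction acts on functions of \<open>(t, y)\<close> jointly: all parameters are
  treated at once, and joint continuity of the solution comes with the fixed point. The Lipschitz
  bound is global in \<open>v\<close>, so no bound on the size of the solution enters.\<close>

lemma picard_existence:
  fixes f :: "real \<times> real \<Rightarrow> 'a::euclidean_space \<Rightarrow> 'a"
  assumes d: "d \<ge> 0" "e \<ge> 0" and M: "M \<ge> 0" "d * M < 1"
    and cont: "continuous_on (box2 d e \<times> UNIV) (\<lambda>(p, v). f p v)"
    and lip: "\<And>p v w. p \<in> box2 d e \<Longrightarrow> norm (f p v - f p w) \<le> M * norm (v - w)"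
    and u0: "continuous_on {-e..e} u0"
  obtains u where "continuous_on (box2 d e) u" "\<And>y. y \<in> {-e..e} \<Longrightarrow> u (0, y) = u0 y"
    "\<And>t y. t \<in> {-d..d} \<Longrightarrow> y \<in> {-e..e} \<Longrightarrow>
       ((\<lambda>t. u (t, y)) has_vector_derivative f (t, y) (u (t, y))) (at t within {-d..d})"
proof -
  define K where "K = box2 d e"
  define cl where "cl = clamp (-d, -e) (d, e)"
  have clK: "cl p \<in> K" for p
    unfolding cl_def K_def using d by (intro clamp_in_interval) (auto simp: Basis_prod_def)
  have scale: "(s * fst p, snd p) \<in> K" if "s \<in> {0..1}" "p \<in> K" for s p
  proof -
    have "\<bar>s * fst p\<bar> \<le> 1 * d"
      unfolding abs_mult using that by (intro mult_mono) (cases p; auto simp: K_def)+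
    then show ?thesis using that by (cases p) (auto simp: K_def abs_le_iff)
  qed
  \<comment> \<open>The integral from 0 to \<open>t\<close> is written as \<open>t\<close> times an integral over \<open>[0, 1]\<close>, which covers both
    signs of \<open>t\<close>; clamping to the rectangle makes the functions bounded and continuous everywhere.\<close>
  define g where "g u p = u0 (snd p) + fst p *\<^sub>R integral (cbox 0 1) (\<lambda>s. f (s * fst p, snd p) (u (s * fst p, snd p)))"
    for u :: "real \<times> real \<Rightarrow> 'a" and p :: "real \<times> real"
  have cf: "continuous_on X (\<lambda>x. f (a x) (b x))"
    if "continuous_on X a" "continuous_on X b" "\<And>x. x \<in> X \<Longrightarrow> a x \<in> K" for X :: "'z::topological_space set" and a b
    using continuous_on_compose2[OF cont, of X "\<lambda>x. (a x, b x)"] that by (auto simp: K_def intro: continuous_on_Pair)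
  have cg: "continuous_on K (g u)" if "continuous_on K u" for u
  proof -
    have "continuous_on (K \<times> cbox 0 1) (\<lambda>(p, s). f (s * fst p, snd p) (u (s * fst p, snd p)))"
      unfolding split_beta using scale
      by (intro cf continuous_on_compose2[OF that]) (auto intro!: continuous_intros)
    from integral_continuous_on_param[OF this]
    show ?thesis unfolding g_def
      by (intro continuous_intros continuous_on_compose2[OF u0]) (auto simp: K_def)
  qed
  define T where "T u = Bcontfun (\<lambda>p. g (apply_bcontfun u) (cl p))" for u
  have T: "apply_bcontfun (T u) p = g u (cl p)" for u p
  proof -
    have c: "continuous_on K (g u)" by (intro cg) simp
    have "bounded (g u ` K)"
      using compact_imp_bounded[OF compact_continuous_image[OF c]] by (simp add: K_def)
    then have "(\<lambda>p. g u (cl p)) \<in> bcontfun"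
      using c unfolding cl_def K_def bcontfun_def by (auto intro!: clamp_continuous_on clamp_bounded)
    then show ?thesis by (simp add: T_def Bcontfun_inverse)
  qed
  have "dist (T u) (T v) \<le> (d * M) * dist u v" for u v
  proof (rule dist_bound)
    fix p
    let ?p = "cl p"
    let ?I = "\<lambda>u. \<lambda>s. f (s * fst ?p, snd ?p) (apply_bcontfun u (s * fst ?p, snd ?p))"
    have ci: "continuous_on {0..1} (?I u)" for u
      using scale[OF _ clK] by (intro cf continuous_intros continuous_on_compose2[OF continuous_on_apply_bcontfun]) auto
    have "norm (integral {0..1} (\<lambda>s. ?I u s - ?I v s)) \<le> M * dist u v * (1 - 0)"
    proof (rule integral_bound)
      fix s :: real assume s: "s \<in> {0..1}"
      have "norm (?I u s - ?I v s) \<le> M * dist (apply_bcontfun u (s * fst ?p, snd ?p)) (apply_bcontfun v (s * fst ?p, snd ?p))"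
        using lip scale[OF s clK] by (simp add: K_def dist_norm)
      also have "\<dots> \<le> M * dist u v" by (intro mult_left_mono dist_bounded M)
      finally show "norm (?I u s - ?I v s) \<le> M * dist u v" .
    qed (use ci in \<open>auto intro!: continuous_intros\<close>)
    moreover have "T u p - T v p = fst ?p *\<^sub>R integral {0..1} (\<lambda>s. ?I u s - ?I v s)"
      unfolding T g_def using ci
      by (simp add: Henstock_Kurzweil_Integration.integral_diff integrable_continuous_real scaleR_diff_right)
    moreover have "\<bar>fst ?p\<bar> \<le> d" using clK[of p] by (cases "cl p") (auto simp: K_def abs_le_iff)
    ultimately have "norm (T u p - T v p) \<le> d * (M * dist u v)"
      by (auto intro!: mult_mono d)
    then show "dist (T u p) (T v p) \<le> (d * M) * dist u v" by (simp add: dist_norm mult_ac)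
  qed
  then obtain u where u: "T u = u"
    using banach_fix_type[of "d * M" T] d M by auto
  have clp: "cl p = p" if "p \<in> K" for p using that by (simp add: cl_def K_def)
  have up: "u p = g u p" if "p \<in> K" for p
    using T[of u p] u clp[OF that] by simp
  have der: "((\<lambda>t. u (t, y)) has_vector_derivative f (t, y) (u (t, y))) (at t within {-d..d})"
    if t: "t \<in> {-d..d}" and y: "y \<in> {-e..e}" for t y
  proof -
    define h where "h r = f (r, y) (u (r, y))" for r
    have ch: "continuous_on {-d..d} h" unfolding h_def
      using y by (intro cf continuous_on_compose2[OF continuous_on_apply_bcontfun] continuous_intros) (auto simp: K_def)
    then obtain P where P: "\<And>r. r \<in> {-d..d} \<Longrightarrow> (P has_vector_derivative h r) (at r within {-d..d})"
      using antiderivative_continuous by blast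
    \<comment> \<open>The substitution \<open>s * r\<close> turns \<open>r\<close> times the
      integral over \<open>[0, 1]\<close> back into \<open>P r - P 0\<close>, from which
      differentiability in time is read off.\<close>
    have ur: "u (r, y) = (u0 y - P 0) + P r" if r: "r \<in> {-d..d}" for r
    proof -
      have sr: "s * r \<in> {-d..d}" if "s \<in> {0..1}" for s
        using scale[OF that, of "(r, y)"] r y by (auto simp: K_def)
      have "((\<lambda>s. P (s * r)) has_vector_derivative r *\<^sub>R h (s * r)) (at s within {0..1})" if s: "s \<in> {0..1}" for s
      proof -
        have "((\<lambda>s. s * r) has_vector_derivative r) (at s within {0..1})"
          by (auto intro!: derivative_eq_intros)
        moreover have "(P has_vector_derivative h (s * r)) (at (s * r) within (\<lambda>s. s * r) ` {0..1})"
          by (rule has_vector_derivative_within_subset[OF P]) (use sr s in auto)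
        ultimately show ?thesis
          using vector_diff_chain_within[of "\<lambda>s. s * r" r s "{0..1}" P "h (s * r)"] by (simp add: o_def)
      qed
      then have "((\<lambda>s. r *\<^sub>R h (s * r)) has_integral (P (1 * r) - P (0 * r))) {0..1}"
        by (intro fundamental_theorem_of_calculus) auto
      then have "r *\<^sub>R integral {0..1} (\<lambda>s. h (s * r)) = P r - P 0"
        using integral_unique by (metis integral_cmul mult_1 mult_zero_left)
      then show ?thesis using up[of "(r, y)"] r y by (simp add: g_def h_def K_def)
    qed
    have "((\<lambda>r. (u0 y - P 0) + P r) has_vector_derivative h t) (at t within {-d..d})"
      using P[OF t] by (auto intro!: derivative_eq_intros)
    then show ?thesis
      unfolding h_def[symmetric] by (rule has_vector_derivative_transform[OF t, rotated]) (simp add: ur)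
  qed
  show ?thesis
  proof (rule that[of "apply_bcontfun u"])
    show "u (0, y) = u0 y" if "y \<in> {-e..e}" for y
      using up[of "(0, y)"] that d by (simp add: g_def K_def)
    show "continuous_on (box2 d e) u" by simp
  qed (rule der)
qed

section \<open>Differentiability of solutions in a parameter\<close>

lemma uniform_first_order:
  fixes f :: "'a::euclidean_space \<Rightarrow> 'b::euclidean_space"
  assumes C: "compact C" "convex C" "C \<subseteq> W" and f: "hdo W f (Suc 0)" and eps: "\<epsilon> > 0"
  obtains \<delta> where "\<delta> > 0" "\<And>q q0. q \<in> C \<Longrightarrow> q0 \<in> C \<Longrightarrow> dist q q0 < \<delta> \<Longrightarrow>
      norm (f q - f q0 - frechet f (at q0) (q - q0)) \<le> \<epsilon> * norm (q - q0)"
proof -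
  define fd where "fd q = frechet f (at q)" for q
  define n where "n = real DIM('a)"
  have n: "n > 0" by (simp add: n_def)
  have diff: "(f has_derivative fd q) (at q)" if "q \<in> C" for q
    unfolding fd_def using that C by (intro hdo_has_derivative[OF f]) auto
  \<comment> \<open>Uniform continuity on the compact set is used for each basis direction; the
    shares \<open>\<epsilon> / n\<close> add up to \<open>\<epsilon>\<close> over the
    \<open>n\<close> directions.\<close>
  have "\<exists>\<delta>>0. \<forall>q\<in>C. \<forall>q0\<in>C. dist q q0 < \<delta> \<longrightarrow> norm (fd q b - fd q0 b) < \<epsilon> / n" for b
  proof -
    have "continuous_on C (\<lambda>q. fd q b)"
      using hdo_derivative[OF f, of b] C(3) unfolding fd_def by (auto intro: continuous_on_subset)
    then have "uniformly_continuous_on C (\<lambda>q. fd q b)"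
      using C(1) compact_uniformly_continuous by blast
    then show ?thesis using eps n unfolding uniformly_continuous_on_def dist_norm
      by (metis divide_pos_pos norm_minus_commute)
  qed
  then obtain \<delta>b where \<delta>b: "\<And>b. \<delta>b b > 0"
    "\<And>b q q0. q \<in> C \<Longrightarrow> q0 \<in> C \<Longrightarrow> dist q q0 < \<delta>b b \<Longrightarrow> norm (fd q b - fd q0 b) < \<epsilon> / n"
    by metis
  define \<delta> where "\<delta> = Min (\<delta>b ` Basis)"
  have \<delta>: "\<delta> > 0" "\<And>b. b \<in> Basis \<Longrightarrow> \<delta> \<le> \<delta>b b"
    unfolding \<delta>_def using \<delta>b(1) by (auto simp: Min_gr_iff)
  have op: "norm (fd q w - fd q0 w) \<le> \<epsilon> * norm w" if q: "q \<in> C" "q0 \<in> C" "dist q q0 < \<delta>" for q q0 w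
  proof -
    have lin: "linear (\<lambda>w. fd q w - fd q0 w)"
      using q(1,2) by (intro linear_compose_sub has_derivative_linear[OF diff])
    have "norm (fd q w - fd q0 w) \<le> (\<Sum>b\<in>Basis. norm ((w \<bullet> b) *\<^sub>R (fd q b - fd q0 b)))"
      by (subst linear_euclidean_expand[OF lin]) (rule norm_sum)
    also have "\<dots> \<le> (\<Sum>b\<in>(Basis :: 'a set). norm w * (\<epsilon> / n))"
    proof (rule sum_mono)
      fix b :: 'a assume b: "b \<in> Basis"
      then have "norm (fd q b - fd q0 b) \<le> \<epsilon> / n" using \<delta>b(2)[OF q(1,2), of b] \<delta>(2)[OF b] q(3) by linarith
      then show "norm ((w \<bullet> b) *\<^sub>R (fd q b - fd q0 b)) \<le> norm w * (\<epsilon> / n)"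
        unfolding norm_scaleR using Basis_le_norm[OF b, of w] by (intro mult_mono) auto
    qed
    also have "\<dots> = \<epsilon> * norm w" using n by (simp add: n_def)
    finally show ?thesis .
  qed
  show ?thesis
  proof (rule that[OF \<delta>(1)])
    fix q q0 assume q: "q \<in> C" "q0 \<in> C" "dist q q0 < \<delta>"
    \<comment> \<open>After subtraction of the fixed linear map \<open>fd q0\<close> the derivative
      is small on the convex set \<open>S\<close>, and the mean value inequality yields the
      estimate.\<close>
    define S where "S = C \<inter> ball q0 \<delta>"
    have "norm ((f q - fd q0 q) - (f q0 - fd q0 q0)) \<le> \<epsilon> * norm (q - q0)"
    proof (rule differentiable_bound[of S "\<lambda>q. f q - fd q0 q" "\<lambda>x w. fd x w - fd q0 w"])
      show "convex S" unfolding S_def using C by (intro convex_Int) auto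
      fix x assume x: "x \<in> S"
      have bl: "bounded_linear (fd q0)" using diff[OF q(2)] by (rule has_derivative_bounded_linear)
      show "((\<lambda>q. f q - fd q0 q) has_derivative (\<lambda>w. fd x w - fd q0 w)) (at x within S)"
        using x by (intro has_derivative_diff bounded_linear_imp_has_derivative[OF bl] has_derivative_at_withinI[OF diff]) (auto simp: S_def)
      show "onorm (\<lambda>w. fd x w - fd q0 w) \<le> \<epsilon>"
        using x q eps by (intro onorm_bound op) (auto simp: S_def dist_commute)
    qed (use q \<delta>(1) in \<open>auto simp: S_def dist_commute\<close>)
    moreover have "f q - fd q0 q - (f q0 - fd q0 q0) = f q - f q0 - fd q0 (q - q0)"
      using linear_diff[OF has_derivative_linear[OF diff[OF q(2)]], of q q0] by simp
    ultimately show "norm (f q - f q0 - frechet f (at q0) (q - q0)) \<le> \<epsilon> * norm (q - q0)"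
      unfolding fd_def[symmetric] by simp
  qed
qed

lemma hdo_mono: "hdo S f k \<Longrightarrow> m \<le> k \<Longrightarrow> hdo S f m"
proof (induction k)
  case (Suc k)
  then show ?case using hdo_SucD[of S f k] by (cases "m = Suc k") auto
qed simp

text \<open>\<open>Y\<close> solves the variational equation along \<open>u\<close>; the remainder
  \<open>u (t, y') - u (t, y) - (y' - y) Y (t, y)\<close> solves it up to a small error.\<close>
lemma parameter_derivative:
  fixes f :: "(real \<times> real) \<times> 'a::euclidean_space \<Rightarrow> 'a"
  assumes de: "d > 0" "e > 0" and M: "M > 0" "4 * d * M \<le> 1"
    and N: "box2 d e \<subseteq> N" and B: "convex B" and f: "hdo (N \<times> B) f (Suc 0)"
    and fM: "\<And>p v w. p \<in> box2 d e \<Longrightarrow> v \<in> B \<Longrightarrow> norm (frechet f (at (p, v)) (0, w)) \<le> M * norm w"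
    and u: "continuous_on (box2 d e) u" "u ` box2 d e \<subseteq> B"
      "\<And>t y. t \<in> {-d..d} \<Longrightarrow> y \<in> {-e..e} \<Longrightarrow>
         ((\<lambda>t. u (t, y)) has_vector_derivative f ((t, y), u (t, y))) (at t within {-d..d})"
    and Y: "continuous_on (box2 d e) Y"
      "\<And>t y. t \<in> {-d..d} \<Longrightarrow> y \<in> {-e..e} \<Longrightarrow> ((\<lambda>t. Y (t, y)) has_vector_derivative
         frechet f (at ((t, y), u (t, y))) ((0, 1), Y (t, y))) (at t within {-d..d})"
    and init: "\<And>y. y \<in> {-e..e} \<Longrightarrow> ((\<lambda>y. u (0, y)) has_vector_derivative Y (0, y)) (at y within {-e..e})"
    and t: "t \<in> {-d..d}" and y: "y \<in> {-e..e}"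
  shows "((\<lambda>y. u (t, y)) has_vector_derivative Y (t, y)) (at y within {-e..e})"
proof -
  let ?K = "box2 d e"
  define fd where "fd q = frechet f (at q)" for q
  \<comment> \<open>The uniform first order estimate needs a compact convex set, hence the convex
    hull; it stays in the domain of \<open>f\<close> because \<open>B\<close> is convex.\<close>
  define C where "C = ?K \<times> (convex hull (u ` ?K))"
  have C: "compact C" "convex C" "C \<subseteq> N \<times> B"
    unfolding C_def using u N hull_minimal[OF u(2), of convex] B
    by (simp_all add: compact_Times compact_convex_hull compact_continuous_image convex_Times Sigma_mono)
  have inC: "((t, y), u (t, y)) \<in> C" if "t \<in> {-d..d}" "y \<in> {-e..e}" for t y
    unfolding C_def using that by (auto intro!: hull_inc)
  have diff: "(f has_derivative fd q) (at q)" if "q \<in> C" for q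
    unfolding fd_def using that C(3) by (intro hdo_has_derivative[OF f]) auto
  obtain L where L: "L > 0" "\<And>p. p \<in> ?K \<Longrightarrow> norm (Y p) \<le> L"
    using compact_imp_bounded[OF compact_continuous_image[OF Y(1) compact_cbox]]
    unfolding bounded_pos by auto
  have "\<exists>\<delta>>0. \<forall>y'\<in>{-e..e}. \<bar>y' - y\<bar> < \<delta> \<longrightarrow> norm (u (t, y') - u (t, y) - (y' - y) *\<^sub>R Y (t, y)) \<le> \<epsilon> * \<bar>y' - y\<bar>"
    if eps: "\<epsilon> > 0" for \<epsilon>
  proof -
    \<comment> \<open>The bound \<open>M\<close> allows the error term
      \<open>\<eta> * norm (D s)\<close> to be absorbed into the linear part, which becomes
      \<open>2 * M\<close>; this is why \<open>4 * d * M \<le> 1\<close> is assumed where the short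
      interval estimate asks for \<open>2 * d * M \<le> 1\<close>. The other bound keeps the
      accumulated error below \<open>\<epsilon> / 2\<close>.\<close>
    define \<eta> where "\<eta> = min M (\<epsilon> / (4 * (1 + d * (1 + L))))"
    have pos: "1 + d * (1 + L) > 0" using de L by (auto intro!: add_pos_pos mult_pos_pos)
    have \<eta>: "\<eta> > 0" "\<eta> \<le> M" "2 * \<eta> * (1 + d * (1 + L)) \<le> \<epsilon> / 2"
    proof -
      have "\<eta> \<le> \<epsilon> / (4 * (1 + d * (1 + L)))" by (simp add: \<eta>_def)
      then show "2 * \<eta> * (1 + d * (1 + L)) \<le> \<epsilon> / 2" using pos by (simp add: field_simps)
    qed (use M eps pos in \<open>auto simp: \<eta>_def\<close>)
    obtain \<delta>1 where \<delta>1: "\<delta>1 > 0" "\<And>q q0. q \<in> C \<Longrightarrow> q0 \<in> C \<Longrightarrow> dist q q0 < \<delta>1 \<Longrightarrow>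
        norm (f q - f q0 - fd q0 (q - q0)) \<le> \<eta> * norm (q - q0)"
      using uniform_first_order[OF C f \<eta>(1)] unfolding fd_def by blast
    have "uniformly_continuous_on ?K u" by (rule compact_uniformly_continuous[OF u(1)]) simp
    then obtain \<delta>2 where \<delta>2: "\<delta>2 > 0" "\<And>p q. p \<in> ?K \<Longrightarrow> q \<in> ?K \<Longrightarrow> dist p q < \<delta>2 \<Longrightarrow> dist (u p) (u q) < \<delta>1 / 2"
      unfolding uniformly_continuous_on_def using \<delta>1(1) half_gt_zero by metis
    obtain \<delta>3 where \<delta>3: "\<delta>3 > 0" "\<And>y'. y' \<in> {-e..e} \<Longrightarrow> \<bar>y' - y\<bar> < \<delta>3 \<Longrightarrow>
        norm (u (0, y') - u (0, y) - (y' - y) *\<^sub>R Y (0, y)) \<le> \<eta> * \<bar>y' - y\<bar>"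
      using init[OF y] \<eta>(1) unfolding has_vector_derivative_def has_derivative_within_alt by (metis real_norm_def)
    \<comment> \<open>\<open>\<delta>1 / 2\<close> and \<open>\<delta>2\<close> bound the parameter
      and the solution part of \<open>q - q0\<close>, so their sum stays below
      \<open>\<delta>1\<close>; \<open>\<delta>3\<close> controls the error at time 0.\<close>
    define \<delta> where "\<delta> = Min {\<delta>1 / 2, \<delta>2, \<delta>3}"
    have \<delta>: "\<delta> > 0" "\<delta> \<le> \<delta>1 / 2" "\<delta> \<le> \<delta>2" "\<delta> \<le> \<delta>3" unfolding \<delta>_def using \<delta>1 \<delta>2 \<delta>3 by auto
    have "norm (u (t, y') - u (t, y) - (y' - y) *\<^sub>R Y (t, y)) \<le> \<epsilon> * \<bar>y' - y\<bar>"
      if y': "y' \<in> {-e..e}" "\<bar>y' - y\<bar> < \<delta>" for y'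
    proof -
      define h where "h = y' - y"
      define D where "D s = u (s, y') - u (s, y) - h *\<^sub>R Y (s, y)" for s
      define D' where "D' s = f ((s, y'), u (s, y')) - f ((s, y), u (s, y)) - h *\<^sub>R fd ((s, y), u (s, y)) ((0, 1), Y (s, y))" for s
      have DD: "(D has_vector_derivative D' s) (at s within {-d..d})" if "s \<in> {-d..d}" for s
        unfolding D_def D'_def fd_def
        using u(3)[OF that y] u(3)[OF that y'(1)] Y(2)[OF that y] by (auto intro!: derivative_eq_intros)
      have "norm (D' s) \<le> (2 * M) * norm (D s) + \<eta> * (1 + L) * \<bar>h\<bar>" if s: "s \<in> {-d..d}" for s
      proof -
        define q q0 where "q = ((s, y'), u (s, y'))" and "q0 = ((s, y), u (s, y))"
        have qC: "q \<in> C" "q0 \<in> C" unfolding q_def q0_def using inC s y y' by auto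
        have lin: "linear (fd q0)" using has_derivative_linear[OF diff[OF qC(2)]] .
        have dp: "dist (s, y') (s, y) = \<bar>h\<bar>" by (simp add: dist_Pair_Pair h_def dist_real_def)
        have du: "dist (u (s, y')) (u (s, y)) < \<delta>1 / 2"
          using \<delta>2(2)[of "(s, y')" "(s, y)"] dp y' y s \<delta>(3) by (auto simp: h_def)
        have "dist q q0 \<le> \<bar>h\<bar> + dist (u (s, y')) (u (s, y))"
          unfolding q_def q0_def dist_Pair_Pair[of "(s,y')"] dp[symmetric] by (rule sqrt_sum_squares_le_sum) auto
        then have dq: "dist q q0 < \<delta>1" "norm (q - q0) \<le> \<bar>h\<bar> + norm (u (s, y') - u (s, y))"
          using du y'(2) \<delta>(2) by (auto simp: h_def dist_norm)
        have qd: "q - q0 = ((0, h), D s + h *\<^sub>R Y (s, y))" by (simp add: q_def q0_def D_def h_def)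
        \<comment> \<open>The first summand is the Taylor error of \<open>f\<close> at
          \<open>q0\<close>, small by \<open>\<delta>1\<close>; the second is linear in the
          remainder \<open>D s\<close>. The parts of \<open>fd q0 (q - q0)\<close> along
          \<open>h\<close> cancel because \<open>Y\<close> solves the variational equation.\<close>
        have Deq: "D' s = (f q - f q0 - fd q0 (q - q0)) + fd q0 (0, D s)"
        proof -
          have "q - q0 = (0, D s) + h *\<^sub>R ((0, 1), Y (s, y))" unfolding qd by (simp add: zero_prod_def)
          then have "fd q0 (q - q0) = fd q0 (0, D s) + h *\<^sub>R fd q0 ((0, 1), Y (s, y))"
            by (simp only: linear_add[OF lin] linear_scale[OF lin])
          then show ?thesis unfolding D'_def q_def[symmetric] q0_def[symmetric] by simp
        qed
        have "norm (D' s) \<le> \<eta> * norm (q - q0) + M * norm (D s)"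
        proof -
          have "(s, y) \<in> ?K" using s y by simp
          then have "norm (fd q0 (0, D s)) \<le> M * norm (D s)"
            using fM[of "(s, y)" "u (s, y)" "D s"] u(2) unfolding fd_def q0_def by blast
          then show ?thesis
            unfolding Deq using \<delta>1(2)[OF qC dq(1)] by (intro norm_triangle_mono)
        qed
        also have "\<eta> * norm (q - q0) \<le> \<eta> * (\<bar>h\<bar> + (norm (D s) + \<bar>h\<bar> * L))"
        proof (rule mult_left_mono)
          have "u (s, y') - u (s, y) = D s + h *\<^sub>R Y (s, y)" by (simp add: D_def)
          then have "norm (u (s, y') - u (s, y)) \<le> norm (D s) + \<bar>h\<bar> * norm (Y (s, y))"
            by (metis norm_triangle_ineq norm_scaleR)
          also have "\<dots> \<le> norm (D s) + \<bar>h\<bar> * L"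
            using L(2)[of "(s, y)"] s y by (intro add_left_mono mult_left_mono) auto
          finally show "norm (q - q0) \<le> \<bar>h\<bar> + (norm (D s) + \<bar>h\<bar> * L)" using dq(2) by simp
        qed (use \<eta> in simp)
        also have "\<eta> * (\<bar>h\<bar> + (norm (D s) + \<bar>h\<bar> * L)) \<le> M * norm (D s) + \<eta> * (1 + L) * \<bar>h\<bar>"
          using mult_right_mono[OF \<eta>(2), of "norm (D s)"] by (simp add: algebra_simps)
        finally show ?thesis by simp
      qed
      from gronwall_small_interval[OF _ _ DD this _ t]
      have "norm (D t) \<le> 2 * (norm (D 0) + d * (\<eta> * (1 + L) * \<bar>h\<bar>))" using de M by simp
      also have "\<dots> \<le> 2 * (\<eta> * \<bar>h\<bar> + d * (\<eta> * (1 + L) * \<bar>h\<bar>))"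
        using \<delta>3(2)[OF y'(1)] y'(2) \<delta>(4) by (simp add: D_def h_def)
      also have "\<dots> = (2 * \<eta> * (1 + d * (1 + L))) * \<bar>h\<bar>" by (simp add: algebra_simps)
      also have "\<dots> \<le> \<epsilon> * \<bar>h\<bar>"
        using \<eta>(3) eps by (intro mult_right_mono) auto
      finally show ?thesis by (simp add: D_def h_def)
    qed
    then show ?thesis using \<delta>(1) by blast
  qed
  then show ?thesis
    unfolding has_vector_derivative_def has_derivative_within_alt by (auto intro!: bounded_linear_scaleR_left)
qed

lemma hdo_local:
  assumes "\<And>x. x \<in> S \<Longrightarrow> \<exists>T. open T \<and> x \<in> T \<and> hdo T f k"
  shows "hdo S f k"
  using assms
proof (induction k arbitrary: f)
  case 0
  then show ?case
    by (intro continuous_at_imp_continuous_on ballI higher_differentiable_on.simps(1)[THEN iffD2])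
      (metis continuous_on_eq_continuous_at higher_differentiable_on.simps(1))
next
  case (Suc k)
  have "f differentiable at x" if "x \<in> S" for x using Suc.prems[OF that] by auto
  moreover have "hdo S (\<lambda>x. frechet f (at x) w) k" for w
  proof (rule Suc.IH)
    fix x assume "x \<in> S"
    then obtain T where "open T" "x \<in> T" "hdo T f (Suc k)" using Suc.prems by blast
    then show "\<exists>T. open T \<and> x \<in> T \<and> hdo T (\<lambda>x. frechet f (at x) w) k"
      using hdo_derivative by blast
  qed
  ultimately show ?case by simp
qed

abbreviation obox2 :: "real \<Rightarrow> real \<Rightarrow> (real \<times> real) set" where
  "obox2 d e \<equiv> {-d<..<d} \<times> {-e<..<e}"

lemma open_obox2: "open (obox2 d e)" by (intro open_Times) auto

lemma hdo_SucI_partials: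
  fixes u :: "real \<times> real \<Rightarrow> 'a::euclidean_space"
  assumes ut: "\<And>t y. (t, y) \<in> obox2 d e \<Longrightarrow> ((\<lambda>t. u (t, y)) has_vector_derivative a (t, y)) (at t)"
    and uy: "\<And>t y. (t, y) \<in> obox2 d e \<Longrightarrow> ((\<lambda>y. u (t, y)) has_vector_derivative b (t, y)) (at y)"
    and ab: "hdo (obox2 d e) a k" "hdo (obox2 d e) b k"
  shows "hdo (obox2 d e) u (Suc k)"
proof (rule hdo_SucI[OF open_obox2])
  show "hdo (obox2 d e) (\<lambda>x. fst w *\<^sub>R a x + snd w *\<^sub>R b x) k" for w
    by (intro hdo_add hdo_scaleR hdo_const open_obox2 ab)
  fix p assume p: "p \<in> obox2 d e"
  obtain t y where ty: "p = (t, y)" by force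
  \<comment> \<open>The total derivative results from the \<open>t\<close>-derivative at the point
    together with the continuity of the \<open>y\<close>-derivative.\<close>
  have "((\<lambda>(t, y). u (t, y)) has_derivative (\<lambda>(tx, ty). (tx *\<^sub>R a (t, y)) + blinfun_apply (blinfun_scaleR_left (b (t, y))) ty))
      (at (t, y) within {-d<..<d} \<times> {-e<..<e})"
  proof (rule has_derivative_partialsI)
    show "((\<lambda>t. u (t, y)) has_derivative (\<lambda>x. x *\<^sub>R a (t, y))) (at t within {-d<..<d})"
      using ut[OF p[unfolded ty]] by (auto simp: has_vector_derivative_def intro: has_derivative_at_withinI)
    show "((\<lambda>y. u (t, y)) has_derivative blinfun_apply (blinfun_scaleR_left (b (t, y)))) (at y within {-e<..<e})"
      if "t \<in> {-d<..<d}" "y \<in> {-e<..<e}" for t y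
      using uy[of t y] that by (auto simp: has_vector_derivative_def intro: has_derivative_at_withinI)
    have "continuous_on (obox2 d e) (\<lambda>p. blinfun_scaleR_left (b p))"
      using hdo_continuous_on[OF ab(2)] by (rule bounded_linear.continuous_on[OF bounded_linear_blinfun_scaleR_left])
    then show "continuous (at (t, y) within obox2 d e) (\<lambda>(x, y). blinfun_scaleR_left (b (x, y)))"
      using p ty by (simp add: continuous_on_eq_continuous_within case_prod_unfold)
  qed (use p ty in auto)
  then show "(u has_derivative (\<lambda>w. fst w *\<^sub>R a p + snd w *\<^sub>R b p)) (at p)"
    using p unfolding ty by (simp add: at_within_open[OF _ open_obox2] case_prod_unfold)
qed

section \<open>Linear equations with parameters\<close>

lemma linear_ode_exists:
  fixes A :: "real \<times> real \<Rightarrow> 'a::euclidean_space \<Rightarrow> 'a"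
  assumes de: "d > 0" "e > 0" and M: "M > 0" "4 * d * M \<le> 1"
    and lin: "\<And>p. p \<in> box2 d e \<Longrightarrow> linear (A p)"
    and AM: "\<And>p v. p \<in> box2 d e \<Longrightarrow> norm (A p v) \<le> M * norm v"
    and cont: "\<And>v. continuous_on (box2 d e) (\<lambda>p. A p v)" "continuous_on (box2 d e) b" "continuous_on {-e..e} g0"
  obtains u where "continuous_on (box2 d e) u" "\<And>y. y \<in> {-e..e} \<Longrightarrow> u (0, y) = g0 y"
    "\<And>t y. t \<in> {-d..d} \<Longrightarrow> y \<in> {-e..e} \<Longrightarrow>
       ((\<lambda>t. u (t, y)) has_vector_derivative A (t, y) (u (t, y)) + b (t, y)) (at t within {-d..d})"
proof -
  note ext_sol = that
  \<comment> \<open>Continuity of \<open>A p v\<close> is given for each fixed \<open>v\<close>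
    only; the expansion of \<open>v\<close> in \<open>Basis\<close> makes it joint in
    \<open>p\<close> and \<open>v\<close>.\<close>
  have "continuous_on (box2 d e \<times> UNIV) (\<lambda>q. \<Sum>c\<in>Basis. (snd q \<bullet> c) *\<^sub>R A (fst q) c)"
    by (intro continuous_intros continuous_on_compose2[OF cont(1)]) auto
  then have "continuous_on (box2 d e \<times> UNIV) (\<lambda>q. A (fst q) (snd q))"
    by (rule continuous_on_eq) (auto simp: linear_euclidean_expand[OF lin, symmetric])
  then have cf: "continuous_on (box2 d e \<times> UNIV) (\<lambda>(p, v). A p v + b p)"
    unfolding case_prod_unfold by (intro continuous_intros continuous_on_compose2[OF cont(2)]) auto
  have lf: "norm ((A p v + b p) - (A p w + b p)) \<le> M * norm (v - w)" if "p \<in> box2 d e" for p v w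
    using AM[OF that, of "v - w"] linear_diff[OF lin[OF that]] by simp
  have dM: "d * M < 1" using M by linarith
  show ?thesis
  proof (rule picard_existence[OF _ _ _ dM cf lf cont(3)])
    show "thesis" if "continuous_on (box2 d e) u" "\<And>y. y \<in> {-e..e} \<Longrightarrow> u (0, y) = g0 y"
      "\<And>t y. t \<in> {-d..d} \<Longrightarrow> y \<in> {-e..e} \<Longrightarrow>
       ((\<lambda>t. u (t, y)) has_vector_derivative A (t, y) (u (t, y)) + b (t, y)) (at t within {-d..d})" for u
      using that by (rule ext_sol)
  qed (use de M in simp_all)
qed

lemma shrink_bound:
  assumes "4 * d * M \<le> 1" "d' < d" "M > 0"
  shows "4 * d' * M \<le> (1::real)"
proof -
  have "d' * M \<le> d * M" using assms(2,3) by (intro mult_right_mono) auto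
  then show ?thesis using assms(1) by linarith
qed

text \<open>Data are controlled on an open rectangle, while existence is proved on closed ones. A
  smaller closed rectangle around each point mediates, and \<open>hdo_local\<close> collects the
  local results.\<close>

lemma shrink_box:
  assumes "p \<in> obox2 d e"
  obtains d' e' where "0 < d'" "d' < d" "0 < e'" "e' < e" "p \<in> obox2 d' e'" "box2 d' e' \<subseteq> obox2 d e"
proof -
  obtain t y where p: "p = (t, y)" by force
  have "\<bar>t\<bar> < d" "\<bar>y\<bar> < e" using assms p by auto
  then obtain d' e' where "\<bar>t\<bar> < d'" "d' < d" "\<bar>y\<bar> < e'" "e' < e" using dense by meson
  then show ?thesis by (intro that[of d' e']) (auto simp: p)
qed

text \<open>The derivative of \<open>G\<close> in the parameter solves a linear equation with the same \<open>A\<close>, so the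
  induction on \<open>k\<close> stays within one type and one time interval.\<close>
lemma linear_ode_smooth:
  fixes A :: "real \<times> real \<Rightarrow> 'a::euclidean_space \<Rightarrow> 'a"
  assumes "d > 0" "e > 0" and M: "M > 0" and "4 * d * M \<le> 1"
    and "\<And>p. p \<in> obox2 d e \<Longrightarrow> linear (A p)"
    and "\<And>p v. p \<in> obox2 d e \<Longrightarrow> norm (A p v) \<le> M * norm v"
    and "\<And>v. hdo (obox2 d e) (\<lambda>p. A p v) k" "hdo (obox2 d e) b k" "hdo {-e<..<e} g0 k"
    and "\<And>t y. (t, y) \<in> obox2 d e \<Longrightarrow> ((\<lambda>t. G (t, y)) has_vector_derivative A (t, y) (G (t, y)) + b (t, y)) (at t)"
    and "\<And>y. y \<in> {-e<..<e} \<Longrightarrow> G (0, y) = g0 y"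
  shows "hdo (obox2 d e) G k"
  using assms(1,2,4-)
proof (induction k arbitrary: b g0 G d e)
  case 0
  show ?case
  proof (rule hdo_local)
    fix p assume "p \<in> obox2 d e"
    then obtain d' e' where de': "0 < d'" "d' < d" "0 < e'" "e' < e" and p: "p \<in> obox2 d' e'"
      and sub: "box2 d' e' \<subseteq> obox2 d e" by (rule shrink_box)
    have sub0: "{-e'..e'} \<subseteq> {-e<..<e}" using de' by auto
    have M': "4 * d' * M \<le> 1" by (rule shrink_bound[OF 0(3) de'(2) M])
    have lin: "linear (A p)" "norm (A p v) \<le> M * norm v" if "p \<in> box2 d' e'" for p v
      using 0(4,5) sub that by auto
    obtain u where u: "continuous_on (box2 d' e') u" "\<And>y. y \<in> {-e'..e'} \<Longrightarrow> u (0, y) = g0 y"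
      "\<And>t y. t \<in> {-d'..d'} \<Longrightarrow> y \<in> {-e'..e'} \<Longrightarrow>
         ((\<lambda>t. u (t, y)) has_vector_derivative A (t, y) (u (t, y)) + b (t, y)) (at t within {-d'..d'})"
    proof (rule linear_ode_exists[of d' e' M A b g0])
      show "continuous_on (box2 d' e') (\<lambda>p. A p v)" for v
        using 0(6)[of v] sub by (auto intro: continuous_on_subset)
      show "continuous_on (box2 d' e') b" using 0(7) sub by (auto intro: continuous_on_subset)
      show "continuous_on {-e'..e'} g0" using 0(8) sub0 by (auto intro: continuous_on_subset)
    qed (use de' M M' lin in auto)
    \<comment> \<open>\<open>G\<close> is given as a solution for each \<open>y\<close> separately.
      Uniqueness identifies it with the Picard solution, and joint continuity is inherited.\<close>
    have "u (t, y) = G (t, y)" if t: "t \<in> {-d'..d'}" and y: "y \<in> {-e'..e'}" for t y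
    proof -
      have D: "((\<lambda>t. u (t, y) - G (t, y)) has_vector_derivative A (s, y) (u (s, y) - G (s, y))) (at s within {-d'..d'})"
        if s: "s \<in> {-d'..d'}" for s
      proof -
        have in1: "(s, y) \<in> box2 d' e'" using s y by simp
        note in2 = subsetD[OF sub in1]
        have "((\<lambda>t. u (t, y) - G (t, y)) has_vector_derivative
            (A (s, y) (u (s, y)) + b (s, y)) - (A (s, y) (G (s, y)) + b (s, y))) (at s within {-d'..d'})"
          by (intro has_vector_derivative_diff u(3)[OF s y] has_vector_derivative_at_within[OF 0(9)[OF in2]])
        then show ?thesis using linear_diff[OF lin(1)[OF in1]] by simp
      qed
      have "norm (u (t, y) - G (t, y)) \<le> 2 * (norm (u (0, y) - G (0, y)) + d' * 0)"
      proof (rule gronwall_small_interval[OF _ _ D _ _ t])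
        show "norm (A (s, y) (u (s, y) - G (s, y))) \<le> M * norm (u (s, y) - G (s, y)) + 0" if "s \<in> {-d'..d'}" for s
          using lin(2)[of "(s, y)"] that y by simp
      qed (use de' M M' in auto)
      moreover have "u (0, y) = G (0, y)" using u(2)[OF y] 0(10) sub0 y by auto
      ultimately show ?thesis by simp
    qed
    then have "continuous_on (box2 d' e') G"
      by (intro continuous_on_eq[OF u(1)]) auto
    then have "hdo (obox2 d' e') G 0"
      by (auto intro: continuous_on_subset)
    then show "\<exists>T. open T \<and> p \<in> T \<and> hdo T G 0" using p open_obox2 by blast
  qed
next
  case (Suc k)
  let ?N = "obox2 d e"
  have Gk: "hdo ?N G k"
    by (rule Suc.IH[OF Suc.prems(1-3)])
      (rule Suc.prems hdo_SucD[OF Suc.prems(6)] hdo_SucD[OF Suc.prems(7)] hdo_SucD[OF Suc.prems(8)] | assumption)+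
  define f where "f q = A (fst q) (snd q) + b (fst q)" for q
  define fd where "fd q = frechet f (at q)" for q
  have oNU: "open (?N \<times> (UNIV :: 'a set))" by (intro open_Times open_obox2 open_UNIV)
  have hfst: "hdo (?N \<times> (UNIV :: 'a set)) (\<lambda>q. h (fst q)) m" if "hdo ?N h m" for h :: "real \<times> real \<Rightarrow> 'a" and m
    by (rule hdo_compose[OF oNU open_obox2 _ hdo_bounded_linear[OF bounded_linear_fst oNU] that]) auto
  have fS: "hdo (?N \<times> UNIV) f (Suc k)"
  proof -
    have "hdo (?N \<times> UNIV) (\<lambda>q. (\<Sum>c\<in>Basis. (snd q \<bullet> c) *\<^sub>R A (fst q) c) + b (fst q)) (Suc k)"
      by (intro hdo_add hdo_sum hdo_scaleR oNU hfst Suc.prems(6,7)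
          hdo_linear_compose[OF bounded_linear_inner_left] hdo_bounded_linear[OF bounded_linear_snd])
    then show ?thesis
      by (rule hdo_cong[OF oNU]) (auto simp: f_def linear_euclidean_expand[OF Suc.prems(4), symmetric])
  qed
  have fdq: "(f has_derivative fd (p, v)) (at (p, v))" if "p \<in> ?N" for p v
    unfolding fd_def using that by (intro hdo_has_derivative[OF fS]) auto
  have fdA: "fd (p, v) (0, w) = A p w" if "p \<in> ?N" for p v w
  proof -
    have "((\<lambda>w. f (p, w)) has_derivative (\<lambda>w. fd (p, v) (0, w))) (at v)"
      by (rule has_derivative_compose[where f = "\<lambda>w. (p, w)" and g = f and x = v, OF _ fdq[OF that]])
        (auto intro!: derivative_eq_intros)
    moreover have "((\<lambda>w. f (p, w)) has_derivative A p) (at v)"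
      unfolding f_def using Suc.prems(4)[OF that]
      by (auto intro!: has_derivative_add_const bounded_linear_imp_has_derivative simp: linear_conv_bounded_linear)
    ultimately have "(\<lambda>w. fd (p, v) (0, w)) = A p" by (rule has_derivative_unique)
    then show ?thesis by metis
  qed
  have graph: "hdo ?N (\<lambda>p. h (p, G p)) k" if "hdo (?N \<times> UNIV) h k" for h :: "(real \<times> real) \<times> 'a \<Rightarrow> 'a"
    by (rule hdo_compose[OF open_obox2 oNU _ hdo_Pair[OF open_obox2 hdo_bounded_linear[OF bounded_linear_ident open_obox2] Gk] that]) auto
  \<comment> \<open>The inhomogeneity in the equation of the parameter derivative: the right-hand
    side is differentiated in \<open>y\<close> with the value \<open>G p\<close> held fixed. It has
    order \<open>k\<close> because \<open>G\<close> has, by \<open>Gk\<close>.\<close>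
  define b1 where "b1 p = fd (p, G p) ((0, 1), 0)" for p
  have b1: "hdo ?N b1 k"
    unfolding b1_def fd_def by (rule graph[OF hdo_derivative[OF fS]])
  have fdY: "fd (p, G p) ((0, 1), w) = A p w + b1 p" if "p \<in> ?N" for p w
  proof -
    have "((0 :: real, 1 :: real), w) = ((0, 1), 0) + (0, w)" by (simp add: prod_eq_iff)
    then have "fd (p, G p) ((0, 1), w) = b1 p + fd (p, G p) (0, w)"
      unfolding b1_def using linear_add[OF has_derivative_linear[OF fdq[OF that]]] by metis
    then show ?thesis using fdA[OF that] by simp
  qed
  define g1 where "g1 y = frechet g0 (at y) 1" for y
  have g1: "hdo {-e<..<e} g1 k" unfolding g1_def by (rule hdo_derivative[OF Suc.prems(8)])
  show ?case
  proof (rule hdo_local)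
    fix p assume "p \<in> ?N"
    then obtain d' e' where de': "0 < d'" "d' < d" "0 < e'" "e' < e" and p: "p \<in> obox2 d' e'"
      and sub: "box2 d' e' \<subseteq> obox2 d e" by (rule shrink_box)
    have sub': "obox2 d' e' \<subseteq> ?N" "{-e'<..<e'} \<subseteq> {-e<..<e}" using de' by auto
    have sub0: "{-e'..e'} \<subseteq> {-e<..<e}" using de' by auto
    have M': "4 * d' * M \<le> 1" by (rule shrink_bound[OF Suc.prems(3) de'(2) M])
    have lin: "linear (A p)" "norm (A p v) \<le> M * norm v" if "p \<in> box2 d' e'" for p v
      using Suc.prems(4,5) sub that by auto
    obtain Y where Y: "continuous_on (box2 d' e') Y" "\<And>y. y \<in> {-e'..e'} \<Longrightarrow> Y (0, y) = g1 y"
      "\<And>t y. t \<in> {-d'..d'} \<Longrightarrow> y \<in> {-e'..e'} \<Longrightarrow>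
         ((\<lambda>t. Y (t, y)) has_vector_derivative A (t, y) (Y (t, y)) + b1 (t, y)) (at t within {-d'..d'})"
    proof (rule linear_ode_exists[of d' e' M A b1 g1])
      show "continuous_on (box2 d' e') (\<lambda>p. A p v)" for v
        using hdo_continuous_on[OF Suc.prems(6)[of v]] sub by (auto intro: continuous_on_subset)
      show "continuous_on (box2 d' e') b1" using hdo_continuous_on[OF b1] sub by (auto intro: continuous_on_subset)
      show "continuous_on {-e'..e'} g1" using hdo_continuous_on[OF g1] sub0 by (auto intro: continuous_on_subset)
    qed (use de' M M' lin in auto)
    have fS0: "hdo (?N \<times> UNIV) f (Suc 0)"
      by (rule hdo_mono[OF fS]) simp
    have Gy: "((\<lambda>y. G (t, y)) has_vector_derivative Y (t, y)) (at y within {-e'..e'})"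
      if ty: "t \<in> {-d'..d'}" "y \<in> {-e'..e'}" for t y
    proof (rule parameter_derivative[OF de'(1,3) M M' sub convex_UNIV fS0 _ _ _ _ Y(1) _ _ ty])
      show "norm (frechet f (at (p, v)) (0, w)) \<le> M * norm w" if "p \<in> box2 d' e'" for p v w
        using fdA[of p v w] lin(2)[OF that] sub that unfolding fd_def by auto
      show "continuous_on (box2 d' e') G"
        using hdo_continuous_on[OF Gk] sub by (rule continuous_on_subset)
      show "((\<lambda>t. G (t, y)) has_vector_derivative f ((t, y), G (t, y))) (at t within {- d'..d'})"
        if "t \<in> {-d'..d'}" "y \<in> {-e'..e'}" for t y
        unfolding f_def fst_conv snd_conv
        by (rule has_vector_derivative_at_within[OF Suc.prems(9)]) (use that de' in auto)
      show "((\<lambda>t. Y (t, y)) has_vector_derivative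
          frechet f (at ((t, y), G (t, y))) ((0, 1), Y (t, y))) (at t within {- d'..d'})"
        if "t \<in> {-d'..d'}" "y \<in> {-e'..e'}" for t y
      proof -
        have "(t, y) \<in> ?N" using that de' by auto
        then show ?thesis using Y(3)[OF that] fdY[of "(t, y)" "Y (t, y)"] unfolding fd_def by simp
      qed
      show "((\<lambda>y. G (0, y)) has_vector_derivative Y (0, y)) (at y within {- e'..e'})" if y: "y \<in> {-e'..e'}" for y
      proof -
        have "y \<in> {-e<..<e}" using y sub0 by auto
        from hdo_has_derivative[OF Suc.prems(8) this]
        have "(g0 has_vector_derivative g1 y) (at y within {-e'..e'})"
          unfolding g1_def using has_vector_derivative_chain[OF has_vector_derivative_id] by blast
        then show ?thesis unfolding Y(2)[OF y]
          by (rule has_vector_derivative_transform[rotated 2]) (use y sub0 Suc.prems(10) in auto)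
      qed
    qed auto
    \<comment> \<open>The induction hypothesis is used a second time, now for \<open>Y\<close> with
      inhomogeneity \<open>b1\<close> and initial value \<open>g1\<close>.\<close>
    have Yk: "hdo (obox2 d' e') Y k"
    proof (rule Suc.IH[of d' e' b1 g1 Y])
      show "hdo (obox2 d' e') (\<lambda>p. A p v) k" for v
        by (rule hdo_subset[OF hdo_SucD[OF Suc.prems(6)] sub'(1)])
      show "hdo (obox2 d' e') b1 k" by (rule hdo_subset[OF b1 sub'(1)])
      show "hdo {-e'<..<e'} g1 k" by (rule hdo_subset[OF g1 sub'(2)])
      show "((\<lambda>t. Y (t, y)) has_vector_derivative A (t, y) (Y (t, y)) + b1 (t, y)) (at t)"
        if "(t, y) \<in> obox2 d' e'" for t y
        using Y(3)[of t y] that by (simp add: at_within_Icc_at)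
      show "Y (0, y) = g1 y" if "y \<in> {-e'<..<e'}" for y using Y(2)[of y] that by auto
    qed (use de' M' lin in auto)
    have fk: "hdo (obox2 d' e') (\<lambda>p. f (p, G p)) k"
      by (rule hdo_subset[OF graph[OF hdo_SucD[OF fS]] sub'(1)])
    have "hdo (obox2 d' e') G (Suc k)"
    proof (rule hdo_SucI_partials[OF _ _ fk Yk])
      show "((\<lambda>t. G (t, y)) has_vector_derivative f ((t, y), G (t, y))) (at t)" if "(t, y) \<in> obox2 d' e'" for t y
        using Suc.prems(9)[of t y] that de' by (auto simp: f_def)
      show "((\<lambda>y. G (t, y)) has_vector_derivative Y (t, y)) (at y)" if "(t, y) \<in> obox2 d' e'" for t y
        using Gy[of t y] that by (simp add: at_within_Icc_at)
    qed
    then show "\<exists>T. open T \<and> p \<in> T \<and> hdo T G (Suc k)" using p open_obox2 by blast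
  qed
qed

section \<open>The local flow of a smooth vector field\<close>

lemma derivative_bound_on_compact:
  fixes f :: "'a::euclidean_space \<Rightarrow> 'b::euclidean_space"
  assumes C: "compact C" and f: "smooth_on U f" "C \<subseteq> U"
  obtains M where "M > 0" "\<And>x v. x \<in> C \<Longrightarrow> norm (frechet f (at x) v) \<le> M * norm v"
proof -
  define fd where "fd q = frechet f (at q)" for q
  have "\<exists>m>0. \<forall>x\<in>C. norm (fd x b) \<le> m" for b
    using compact_imp_bounded[OF compact_continuous_image[OF
        continuous_on_subset[OF smooth_on_continuous_on[OF smooth_on_derivative[OF f(1)]] f(2)] C]]
    unfolding bounded_pos fd_def by fast
  then obtain m where m: "\<And>b. m b > 0" "\<And>b x. x \<in> C \<Longrightarrow> norm (fd x b) \<le> m b" by metis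
  have "norm (fd x v) \<le> (1 + (\<Sum>b\<in>Basis. m b)) * norm v" if "x \<in> C" for x v
  proof -
    have lin: "linear (fd x)"
      unfolding fd_def using that f(2) by (intro linear_frechet_derivative smooth_on_differentiable[OF f(1)]) auto
    have "norm (fd x v) \<le> (\<Sum>b\<in>Basis. norm ((v \<bullet> b) *\<^sub>R fd x b))"
      by (subst linear_euclidean_expand[OF lin]) (rule norm_sum)
    also have "\<dots> \<le> (\<Sum>b\<in>Basis. norm v * m b)"
      unfolding norm_scaleR using m(2)[OF that] by (intro sum_mono mult_mono Basis_le_norm) auto
    also have "\<dots> \<le> (1 + (\<Sum>b\<in>Basis. m b)) * norm v"
      by (simp add: sum_distrib_left[symmetric] algebra_simps)
    finally show ?thesis .
  qed
  moreover have "1 + (\<Sum>b\<in>(Basis :: 'a set). m b) > 0"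
    using m(1) by (intro add_pos_nonneg sum_nonneg) (auto intro: less_imp_le)
  ultimately show ?thesis using that unfolding fd_def by blast
qed

text \<open>The time interval and the curve \<open>\<gamma>\<close> do not depend on the direction \<open>w\<close>: all families below
  include the same trajectory.\<close>
lemma smooth_local_flow:
  fixes f :: "'a::euclidean_space \<Rightarrow> 'a"
  assumes U: "open U" "z0 \<in> U" and f: "smooth_on U f"
  obtains d \<gamma> where "d > 0"
    "\<And>w. \<exists>e>0. \<exists>F. smooth_on (obox2 d e) F \<and> F ` obox2 d e \<subseteq> U \<and>
      (\<forall>t y. (t, y) \<in> obox2 d e \<longrightarrow> ((\<lambda>t. F (t, y)) has_vector_derivative f (F (t, y))) (at t)) \<and>
      (\<forall>y\<in>{-e<..<e}. F (0, y) = z0 + y *\<^sub>R w) \<and> (\<forall>t\<in>{-d<..<d}. F (t, 0) = \<gamma> t)"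
proof -
  obtain r where r: "r > 0" "cball z0 r \<subseteq> U" using U open_contains_cball by blast
  define C where "C = cball z0 r"
  have C: "compact C" "convex C" "closed C" "C \<noteq> {}" unfolding C_def using r by auto
  define fd where "fd q = frechet f (at q)" for q
  have diff: "(f has_derivative fd q) (at q)" if "q \<in> C" for q
    unfolding fd_def using that r(2) by (intro smooth_on_has_derivative[OF f]) (auto simp: C_def)
  obtain M where M: "M > 0" "\<And>x v. x \<in> C \<Longrightarrow> norm (fd x v) \<le> M * norm v"
    using derivative_bound_on_compact[OF C(1) f] r(2) unfolding C_def fd_def by blast
  have fc: "continuous_on C f"
    using smooth_on_continuous_on[OF f] r(2) unfolding C_def by (rule continuous_on_subset)
  obtain K where K: "K > 0" "\<And>x. x \<in> C \<Longrightarrow> norm (f x) \<le> K"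
    using compact_imp_bounded[OF compact_continuous_image[OF fc C(1)]] unfolding bounded_pos by auto
  have lip: "norm (f v - f w) \<le> M * norm (v - w)" if "v \<in> C" "w \<in> C" for v w
    using that M by (intro differentiable_bound[OF C(2) has_derivative_at_withinI[OF diff] onorm_bound]) auto
  \<comment> \<open>The first bound is what the contraction and the short interval estimate require;
    the second limits the displacement \<open>K * d\<close> to \<open>r / 4\<close>.\<close>
  define d where "d = min (1 / (4 * M)) (r / (4 * K))"
  have d: "d > 0" "4 * d * M \<le> 1" "K * d \<le> r / 4"
  proof -
    show "d > 0" unfolding d_def using M K r by simp
    have "d \<le> 1 / (4 * M)" by (simp add: d_def)
    then show "4 * d * M \<le> 1" using M(1) by (simp add: field_simps)
    have "d \<le> r / (4 * K)" by (simp add: d_def)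
    then show "K * d \<le> r / 4" using K(1) by (simp add: field_simps)
  qed
  have flow: "\<exists>e>0. \<exists>F. smooth_on (obox2 d e) F \<and> F ` box2 d e \<subseteq> C \<and>
      (\<forall>t\<in>{-d..d}. \<forall>y\<in>{-e..e}. ((\<lambda>t. F (t, y)) has_vector_derivative f (F (t, y))) (at t within {-d..d})) \<and>
      (\<forall>y\<in>{-e..e}. F (0, y) = z0 + y *\<^sub>R w)" for w
  proof -
    \<comment> \<open>Initial points stay within \<open>r / 4\<close> of \<open>z0\<close>. Together
      with the displacement bound, solutions remain in the open ball of radius \<open>r\<close>. The
      summand 1 covers \<open>w = 0\<close>.\<close>
    define e where "e = r / (4 * (norm w + 1))"
    have e: "e > 0" "e * norm w \<le> r / 4"
    proof -
      have w: "norm w + 1 > 0" by (simp add: add_nonneg_pos)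
      then show "e > 0" using r by (simp add: e_def)
      have "e * norm w \<le> e * (norm w + 1)" using \<open>e > 0\<close> by (intro mult_left_mono) auto
      also have "\<dots> = r / 4" using w by (simp add: e_def field_simps)
      finally show "e * norm w \<le> r / 4" .
    qed
    \<comment> \<open>The projection onto the ball \<open>C\<close> makes the right-hand side
      globally Lipschitz. Solutions do not leave \<open>C\<close>, so they also solve the original
      equation.\<close>
    define ff where "ff p v = f (closest_point C v)" for p :: "real \<times> real" and v
    have cp: "closest_point C v \<in> C" for v using C by (intro closest_point_in_set) auto
    have ffc: "continuous_on (box2 d e \<times> UNIV) (\<lambda>(p, v). ff p v)"
      unfolding ff_def case_prod_unfold using C cp
      by (intro continuous_on_compose2[OF fc] continuous_on_compose2[OF continuous_on_closest_point[of C UNIV]] continuous_intros) auto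
    have ffl: "norm (ff p v - ff p w) \<le> M * norm (v - w)" for p v w
    proof -
      have "norm (ff p v - ff p w) \<le> M * norm (closest_point C v - closest_point C w)"
        unfolding ff_def by (intro lip cp)
      also have "\<dots> \<le> M * norm (v - w)"
        using closest_point_lipschitz[OF C(2-4), of v w] M(1) by (intro mult_left_mono) (auto simp: dist_norm)
      finally show ?thesis .
    qed
    have g0c: "continuous_on {-e..e} (\<lambda>y. z0 + y *\<^sub>R w)" by (intro continuous_intros)
    have dM: "d * M < 1" using d by linarith
    obtain u where u: "continuous_on (box2 d e) u" "\<And>y. y \<in> {-e..e} \<Longrightarrow> u (0, y) = z0 + y *\<^sub>R w"
      "\<And>t y. t \<in> {-d..d} \<Longrightarrow> y \<in> {-e..e} \<Longrightarrow>
         ((\<lambda>t. u (t, y)) has_vector_derivative ff (t, y) (u (t, y))) (at t within {-d..d})"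
      using picard_existence[OF less_imp_le[OF d(1)] less_imp_le[OF e(1)] less_imp_le[OF M(1)] dM ffc ffl g0c] by blast
    have uC: "u (t, y) \<in> ball z0 r" if ty: "t \<in> {-d..d}" "y \<in> {-e..e}" for t y
    proof -
      have "norm (u (t, y) - u (0, y)) \<le> K * d"
        by (rule interval_bound[OF less_imp_le[OF d(1)] u(3)[OF _ ty(2)] _ ty(1)]) (simp_all add: ff_def K(2)[OF cp])
      moreover have "norm (u (0, y) - z0) \<le> e * norm w"
        using ty(2) unfolding u(2)[OF ty(2)] by (auto intro!: mult_right_mono)
      ultimately show ?thesis
        using d(3) e(2) r(1) norm_triangle_ineq[of "u (t, y) - u (0, y)" "u (0, y) - z0"]
        by (simp add: dist_norm norm_minus_commute)
    qed
    have uC': "u p \<in> C" if "p \<in> box2 d e" for p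
    proof -
      obtain t y where p: "p = (t, y)" by force
      then show ?thesis using uC[of t y] that by (simp add: C_def)
    qed
    have ut: "((\<lambda>t. u (t, y)) has_vector_derivative f (u (t, y))) (at t within {-d..d})"
      if "t \<in> {-d..d}" "y \<in> {-e..e}" for t y
      using u(3)[OF that] closest_point_self[OF uC'[of "(t, y)"]] that by (simp add: ff_def)
    define A where "A p v = fd (u p) v" for p v
    have A: "linear (A p)" "norm (A p v) \<le> M * norm v" if "p \<in> box2 d e" for p v
      unfolding A_def using M(2)[OF uC'[OF that]] has_derivative_linear[OF diff[OF uC'[OF that]]] by auto
    have Ac: "continuous_on (box2 d e) (\<lambda>p. A p v)" for v
      unfolding A_def fd_def using uC' r(2)
      by (intro continuous_on_compose2[OF smooth_on_continuous_on[OF smooth_on_derivative[OF f]] u(1)]) (auto simp: C_def)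
    obtain Y where Y: "continuous_on (box2 d e) Y" "\<And>y. y \<in> {-e..e} \<Longrightarrow> Y (0, y) = w"
      "\<And>t y. t \<in> {-d..d} \<Longrightarrow> y \<in> {-e..e} \<Longrightarrow>
         ((\<lambda>t. Y (t, y)) has_vector_derivative A (t, y) (Y (t, y)) + 0) (at t within {-d..d})"
      using linear_ode_exists[OF d(1) e(1) M(1) d(2) A Ac, of "\<lambda>_. 0" "\<lambda>_. w"] by auto
    have oB: "open (UNIV \<times> ball z0 r :: ((real \<times> real) \<times> 'a) set)" by (intro open_Times) auto
    have BU: "ball z0 r \<subseteq> U" using r(2) by auto
    define f2 where "f2 q = f (snd q)" for q :: "(real \<times> real) \<times> 'a"
    have f2S: "hdo (UNIV \<times> ball z0 r) f2 k" for k
      unfolding f2_def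
      by (rule hdo_compose[OF oB U(1) _ hdo_bounded_linear[OF bounded_linear_snd oB] smooth_onD[OF f]]) (use BU in auto)
    have f2d: "frechet f2 (at (p, v)) w = fd v (snd w)" if "v \<in> C" for p v w
    proof -
      have "(f2 has_derivative (\<lambda>w. fd v (snd w))) (at (p, v))"
        unfolding f2_def by (rule has_derivative_compose[where f = snd and g = f and x = "(p, v)"])
         (use diff[OF that] in \<open>auto intro!: derivative_eq_intros\<close>)
      from frechet_derivative_at[OF this] show ?thesis by metis
    qed
    have uy: "((\<lambda>y. u (t, y)) has_vector_derivative Y (t, y)) (at y within {-e..e})"
      if ty: "t \<in> {-d..d}" "y \<in> {-e..e}" for t y
    proof (rule parameter_derivative[OF d(1) e(1) M(1) d(2) subset_UNIV convex_ball f2S _ u(1) _ _ Y(1) _ _ ty])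
      show "norm (frechet f2 (at (p, v)) (0, w)) \<le> M * norm w" if "v \<in> ball z0 r" for p v w
        using that M(2)[of v w] f2d[of v p] by (simp add: C_def)
      show "u ` box2 d e \<subseteq> ball z0 r" using uC by auto
      show "((\<lambda>t. u (t, y)) has_vector_derivative f2 ((t, y), u (t, y))) (at t within {-d..d})"
        if "t \<in> {-d..d}" "y \<in> {-e..e}" for t y using ut[OF that] by (simp add: f2_def)
      show "((\<lambda>t. Y (t, y)) has_vector_derivative frechet f2 (at ((t, y), u (t, y))) ((0, 1), Y (t, y))) (at t within {-d..d})"
        if "t \<in> {-d..d}" "y \<in> {-e..e}" for t y
        using Y(3)[OF that] uC'[of "(t, y)"] that by (simp add: f2d A_def)
      show "((\<lambda>y. u (0, y)) has_vector_derivative Y (0, y)) (at y within {-e..e})" if "y \<in> {-e..e}" for y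
      proof -
        have "((\<lambda>y. z0 + y *\<^sub>R w) has_vector_derivative w) (at y within {-e..e})"
          by (auto intro!: derivative_eq_intros)
        then show ?thesis unfolding Y(2)[OF that]
          by (rule has_vector_derivative_transform[rotated 2]) (use that u(2) in auto)
      qed
    qed
    have sub: "obox2 d e \<subseteq> box2 d e" by auto
    \<comment> \<open>Bootstrap: if \<open>u\<close> has order \<open>k\<close>, so does the
      coefficient \<open>A\<close> along \<open>u\<close>, hence the parameter derivative
      \<open>Y\<close>; both partial derivatives of \<open>u\<close> then have order
      \<open>k\<close>, and \<open>u\<close> has order \<open>Suc k\<close>.\<close>
    have "hdo (obox2 d e) u k" for k
    proof (induction k)
      case 0
      show ?case using continuous_on_subset[OF u(1) sub] by simp
    next
      case (Suc k)
      have uU: "u ` obox2 d e \<subseteq> U" using uC' sub r(2) unfolding C_def by blast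
      have Ak: "hdo (obox2 d e) (\<lambda>p. A p v) k" for v
        unfolding A_def fd_def
        by (rule hdo_compose[OF open_obox2 U(1) uU Suc smooth_onD[OF smooth_on_derivative[OF f]]])
      have Yk: "hdo (obox2 d e) Y k"
      proof (rule linear_ode_smooth[OF d(1) e(1) M(1) d(2) _ _ Ak hdo_const hdo_const])
        show "linear (A p)" "norm (A p v) \<le> M * norm v" if "p \<in> obox2 d e" for p v
          using A subsetD[OF sub that] by auto
        show "((\<lambda>t. Y (t, y)) has_vector_derivative A (t, y) (Y (t, y)) + 0) (at t)" if "(t, y) \<in> obox2 d e" for t y
          using Y(3)[of t y] that by (simp add: at_within_Icc_at)
        show "Y (0, y) = w" if "y \<in> {-e<..<e}" for y using Y(2) that by auto
      qed
      have fk: "hdo (obox2 d e) (\<lambda>p. f (u p)) k"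
        by (rule hdo_compose[OF open_obox2 U(1) uU Suc smooth_onD[OF f]])
      show ?case
      proof (rule hdo_SucI_partials[OF _ _ fk Yk])
        show "((\<lambda>t. u (t, y)) has_vector_derivative f (u (t, y))) (at t)" if "(t, y) \<in> obox2 d e" for t y
          using ut[of t y] that by (simp add: at_within_Icc_at)
        show "((\<lambda>y. u (t, y)) has_vector_derivative Y (t, y)) (at y)" if "(t, y) \<in> obox2 d e" for t y
          using uy[of t y] that by (simp add: at_within_Icc_at)
      qed
    qed
    then have "smooth_on (obox2 d e) u" by (rule smooth_onI)
    moreover have "u ` box2 d e \<subseteq> C" using uC' by blast
    ultimately show ?thesis using e(1) ut u(2) by blast
  qed
  obtain e F where eF: "\<And>w. e w > 0" "\<And>w. smooth_on (obox2 d (e w)) (F w)" "\<And>w. F w ` box2 d (e w) \<subseteq> C"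
      "\<And>w t y. t \<in> {-d..d} \<Longrightarrow> y \<in> {-e w..e w} \<Longrightarrow> ((\<lambda>t. F w (t, y)) has_vector_derivative f (F w (t, y))) (at t within {-d..d})"
      "\<And>w y. y \<in> {-e w..e w} \<Longrightarrow> F w (0, y) = z0 + y *\<^sub>R w"
    using flow by metis
  \<comment> \<open>All curves at \<open>y = 0\<close> start at \<open>z0\<close> and therefore
    coincide; the one for \<open>w = 0\<close> is the common trajectory.\<close>
  have unique: "F w (t, 0) = F 0 (t, 0)" if t: "t \<in> {-d..d}" for w t
  proof -
    have z: "0 \<in> {-e w..e w}" for w using eF(1)[of w] by simp
    have "norm (F w (t, 0) - F 0 (t, 0)) \<le> 2 * (norm (F w (0, 0) - F 0 (0, 0)) + d * 0)"
    proof (rule gronwall_small_interval[OF _ _ _ _ _ t])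
      show "((\<lambda>t. F w (t, 0) - F 0 (t, 0)) has_vector_derivative f (F w (s, 0)) - f (F 0 (s, 0))) (at s within {-d..d})"
        if "s \<in> {-d..d}" for s by (intro has_vector_derivative_diff eF(4) that z)
      show "norm (f (F w (s, 0)) - f (F 0 (s, 0))) \<le> M * norm (F w (s, 0) - F 0 (s, 0)) + 0" if "s \<in> {-d..d}" for s
      proof -
        have "F w (s, 0) \<in> C" for w using eF(3)[of w] z[of w] that by auto
        then show ?thesis using lip by simp
      qed
    qed (use d M in auto)
    then show ?thesis using eF(5)[OF z] by simp
  qed
  show ?thesis
  proof (rule that[OF d(1), of "\<lambda>t. F 0 (t, 0)"], rule exI[of _ "e _"], intro conjI exI[of _ "F _"] allI impI ballI)
    fix w
    show "e w > 0" "smooth_on (obox2 d (e w)) (F w)" by (rule eF)+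
    have "obox2 d (e w) \<subseteq> box2 d (e w)" by auto
    then show "F w ` obox2 d (e w) \<subseteq> U" using eF(3)[of w] r(2) unfolding C_def by blast
    show "((\<lambda>t. F w (t, y)) has_vector_derivative f (F w (t, y))) (at t)" if "(t, y) \<in> obox2 d (e w)" for t y
      using eF(4)[of t y w] that by (simp add: at_within_Icc_at)
    show "F w (0, y) = z0 + y *\<^sub>R w" if "y \<in> {-e w<..<e w}" for y using eF(5)[of y w] that by auto
    show "F w (t, 0) = F 0 (t, 0)" if "t \<in> {-d<..<d}" for t using unique[of t w] that by auto
  qed
qed

section \<open>Deviation functions in a chart\<close>

definition fibre_grad :: "((real^'n) \<times> (real^'n) \<Rightarrow> real) \<Rightarrow> (real^'n) \<times> (real^'n) \<Rightarrow> real^'n" where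
  "fibre_grad h z = (\<chi> i. frechet h (at z) (0, axis i 1))"

definition base_grad :: "((real^'n) \<times> (real^'n) \<Rightarrow> real) \<Rightarrow> (real^'n) \<times> (real^'n) \<Rightarrow> real^'n" where
  "base_grad h z = (\<chi> i. frechet h (at z) (axis i 1, 0))"

lemma linear_vec_expand:
  fixes l :: "real^'n \<Rightarrow> real"
  assumes "linear l"
  shows "l a = (\<chi> i. l (axis i 1)) \<bullet> a"
proof -
  have "l a = l (\<Sum>i\<in>UNIV. a $ i *\<^sub>R axis i 1)"
    using basis_expansion[of a] by (simp add: scalar_mult_eq_scaleR)
  then show ?thesis
    by (simp add: linear_sum[OF assms] linear_scale[OF assms] inner_vec_def mult.commute)
qed

lemma frechet_derivative_grads:
  assumes "h differentiable at z"
  shows "frechet h (at z) (a, b) = base_grad h z \<bullet> a + fibre_grad h z \<bullet> b"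
proof -
  let ?D = "frechet h (at z)"
  have lin: "linear ?D" using assms by (rule linear_frechet_derivative)
  have "linear (\<lambda>a. (a, 0 :: real^'n))" "linear (\<lambda>b. (0 :: real^'n, b))"
    by (auto intro!: linearI)
  then have l: "linear (\<lambda>a. ?D (a, 0))" "linear (\<lambda>b. ?D (0, b))"
    using linear_compose[OF _ lin] by (auto simp: o_def)
  have "?D (a, b) = ?D (a, 0) + ?D (0, b)"
    using linear_add[OF lin, of "(a, 0)" "(0, b)"] by simp
  then show ?thesis
    using linear_vec_expand[OF l(1), of a] linear_vec_expand[OF l(2), of b] by (simp add: base_grad_def fibre_grad_def)
qed

definition dynamics ::
  "((real^'n) \<times> (real^'n) \<Rightarrow> real) \<Rightarrow> ((real^'n) \<times> (real^'n) \<Rightarrow> real) \<Rightarrow> ((real^'n) \<times> (real^'n) \<Rightarrow> real^'n)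
    \<Rightarrow> (real^'n) \<times> (real^'n) \<Rightarrow> (real^'n) \<times> (real^'n)" where
  "dynamics h om q z = ((1 / om z) *\<^sub>R fibre_grad h z, - (1 / om z) *\<^sub>R base_grad h z + q z)"

text \<open>\<open>dev_rate\<close> and \<open>dev_accel\<close> are the first and second derivative of the deviation function
  as functionals of the variation \<open>w = (\<tau>, \<xi>)\<close>.\<close>
definition dev_rate where
  "dev_rate h om q z w = q z \<bullet> fst w - frechet h (at z) w / om z"

definition dev_accel where
  "dev_accel h om q z w =
     frechet om (at z) (dynamics h om q z) / (om z)\<^sup>2 * frechet h (at z) w
     - fibre_grad h z \<bullet> frechet q (at z) w / om z
     - frechet om (at z) w / (om z)\<^sup>2 * (fibre_grad h z \<bullet> q z)
     + frechet q (at z) (dynamics h om q z) \<bullet> fst w"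

lemma smooth_on_grads:
  assumes "open U" "smooth_on U h"
  shows "smooth_on U (fibre_grad h)" "smooth_on U (base_grad h)"
  unfolding fibre_grad_def[abs_def] base_grad_def[abs_def]
  by (rule smooth_onI, rule hdo_vec[OF assms(1)], rule smooth_onD, rule smooth_on_derivative, rule assms(2))+

lemma smooth_on_dynamics:
  assumes U: "open U" and s: "smooth_on U h" "smooth_on U om" "smooth_on U q" and nz: "\<And>z. z \<in> U \<Longrightarrow> om z \<noteq> 0"
  shows "smooth_on U (dynamics h om q)"
proof (rule smooth_onI)
  have i: "hdo U (\<lambda>z. inverse (om z)) k" for k
    by (rule hdo_inverse[OF U smooth_onD[OF s(2)] nz])
  show "hdo U (dynamics h om q) k" for k
    unfolding dynamics_def[abs_def] divide_inverse mult_1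
    by (intro hdo_Pair hdo_add hdo_scaleR hdo_minus U i smooth_onD smooth_on_grads s)
qed

text \<open>The Hamiltonian part of the field conserves \<open>h\<close>: its two gradient terms
  cancel, and only the work of the force remains.\<close>

lemma dynamics_energy:
  assumes "h differentiable at z"
  shows "frechet h (at z) (dynamics h om q z) = fibre_grad h z \<bullet> q z"
  unfolding dynamics_def frechet_derivative_grads[OF assms]
  by (simp add: inner_add_right inner_diff_right inner_commute)

lemma frechet_derivative_chain:
  assumes "g differentiable at (f z)" "f differentiable at z"
  shows "frechet (\<lambda>x. g (f x)) (at z) w = frechet g (at (f z)) (frechet f (at z) w)"
  using frechet_derivative_at[OF has_derivative_compose[OF has_frechet_derivative[OF assms(2)] has_frechet_derivative[OF assms(1)]]]
  by metis

lemma real_vector_derivativeD: "(f has_vector_derivative d) (at t) \<Longrightarrow> deriv f t = d" for f :: "real \<Rightarrow> real"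
  by (rule DERIV_imp_deriv) (simp add: has_real_derivative_iff_has_vector_derivative)

text \<open>The parameter set \<open>N\<close> is an arbitrary open set rather than a rectangle,
  because a family on the manifold may leave the chart.\<close>

lemma deviation_derivatives:
  fixes h om :: "(real^'n) \<times> (real^'n) \<Rightarrow> real" and q :: "(real^'n) \<times> (real^'n) \<Rightarrow> real^'n"
  assumes U: "open U" and s: "smooth_on U h" "smooth_on U om" "smooth_on U q"
    and nz: "\<And>z. z \<in> U \<Longrightarrow> om z \<noteq> 0" and om: "\<And>z. z \<in> U \<Longrightarrow> snd z \<bullet> fibre_grad h z = om z"
    and N: "open (N :: (real \<times> real) set)" and F: "smooth_on N F" "F ` N \<subseteq> U"
    and ode: "\<And>t y. (t, y) \<in> N \<Longrightarrow> ((\<lambda>t. F (t, y)) has_vector_derivative dynamics h om q (F (t, y))) (at t)"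
    and phi: "\<And>t. (t, 0) \<in> N \<Longrightarrow> \<phi> t = snd (F (t, 0)) \<bullet> fst (frechet F (at (t, 0)) (0, 1))"
    and t: "(t, 0) \<in> N"
  shows "deriv \<phi> t = dev_rate h om q (F (t, 0)) (frechet F (at (t, 0)) (0, 1))"
    and "deriv (deriv \<phi>) t = dev_accel h om q (F (t, 0)) (frechet F (at (t, 0)) (0, 1))"
proof -
  define f where "f = dynamics h om q"
  define W where "W t = frechet F (at (t, 0)) (0, 1)" for t
  define T where "T = {t. (t, 0) \<in> N}"
  have oT: "open T"
  proof -
    have "open ((\<lambda>t. (t, 0 :: real)) -` N)" by (intro open_vimage N continuous_intros)
    then show ?thesis by (simp add: T_def vimage_def)
  qed
  have FU: "F z \<in> U" if "z \<in> N" for z using F(2) that by auto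
  have fs: "smooth_on U f" unfolding f_def by (rule smooth_on_dynamics[OF U s nz])
  have dF: "F differentiable at z" if "z \<in> N" for z by (rule smooth_on_differentiable[OF F(1) that])
  have Ft: "frechet F (at z) (1, 0) = f (F z)" if "z \<in> N" for z
  proof -
    obtain a b where z: "z = (a, b)" by force
    have "((\<lambda>t. F (t, b)) has_vector_derivative frechet F (at (a, b)) (1, 0)) (at a)"
      by (rule has_vector_derivative_chain[OF has_vector_derivative_fst_const has_frechet_derivative[OF dF[OF that[unfolded z]]]])
    moreover have "((\<lambda>t. F (t, b)) has_vector_derivative f (F (a, b))) (at a)"
      unfolding f_def using ode that z by simp
    ultimately show ?thesis unfolding z by (rule vector_derivative_unique_at)
  qed
  have along: "((\<lambda>t. G (F (t, 0))) has_vector_derivative frechet G (at (F (t, 0))) (f (F (t, 0)))) (at t)"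
    if "smooth_on U G" "t \<in> T" for G :: "_ \<Rightarrow> 'z::euclidean_space" and t
  proof -
    have tN: "(t, 0) \<in> N" using that by (simp add: T_def)
    show ?thesis
      by (rule has_vector_derivative_chain[where c = "\<lambda>t. F (t, 0)"])
        (use ode[OF tN] smooth_on_has_derivative[OF that(1) FU[OF tN]] in \<open>simp_all add: f_def\<close>)
  qed
  \<comment> \<open>Exchange of the \<open>t\<close>- and \<open>y\<close>-derivatives of
    \<open>G (F z)\<close>. For the identity this is the variational equation; for
    \<open>G = h\<close> it expresses the rate of \<open>dh (W)\<close> through the derivative of
    \<open>h\<close> along the field.\<close>
  have variation: "((\<lambda>t. frechet G (at (F (t, 0))) (W t)) has_vector_derivative
        frechet (\<lambda>z. frechet G (at z) (f z)) (at (F (t, 0))) (W t)) (at t)"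
    if G: "smooth_on U G" and tT: "t \<in> T" for G :: "_ \<Rightarrow> 'z::euclidean_space" and t
  proof -
    have tN: "(t, 0) \<in> N" using tT by (simp add: T_def)
    define K where "K z = frechet G (at z) (f z)" for z
    have Ks: "smooth_on U K" unfolding K_def by (rule smooth_on_derivative_dir[OF U G fs])
    have GF: "smooth_on N (\<lambda>z. G (F z))" by (rule smooth_on_compose[OF F(1) G N U F(2)])
    have chain: "frechet (\<lambda>z. G (F z)) (at z) w = frechet G (at (F z)) (frechet F (at z) w)"
      if "z \<in> N" for z w
      by (rule frechet_derivative_chain[OF smooth_on_differentiable[OF G FU[OF that]] dF[OF that]])
    have "frechet (\<lambda>z. frechet (\<lambda>z. G (F z)) (at z) (1, 0)) (at (t, 0)) (0, 1)
        = frechet (\<lambda>z. K (F z)) (at (t, 0)) (0, 1)"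
      using frechet_derivative_cong_open[OF N tN, of "\<lambda>z. frechet (\<lambda>z. G (F z)) (at z) (1, 0)" "\<lambda>z. K (F z)"]
      by (simp add: chain Ft K_def)
    also have "\<dots> = frechet K (at (F (t, 0))) (W t)"
      unfolding W_def by (rule frechet_derivative_chain[OF smooth_on_differentiable[OF Ks FU[OF tN]] dF[OF tN]])
    finally have "((\<lambda>t. frechet (\<lambda>z. G (F z)) (at (t, 0)) (0, 1)) has_vector_derivative
        frechet K (at (F (t, 0))) (W t)) (at t)"
      using mixed_partials[OF N tN GF] by simp
    then show ?thesis unfolding K_def[symmetric, abs_def]
    proof (rule has_vector_derivative_transform_within_open[OF _ oT tT])
      show "frechet (\<lambda>z. G (F z)) (at (t, 0)) (0, 1) = frechet G (at (F (t, 0))) (W t)"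
        if "t \<in> T" for t using chain[of "(t, 0)"] that by (simp add: T_def W_def)
    qed
  qed
  have Wder: "(W has_vector_derivative frechet f (at (F (t, 0))) (W t)) (at t)" if "t \<in> T" for t
  proof -
    have id: "smooth_on U (\<lambda>z. z)"
      by (intro smooth_onI hdo_bounded_linear bounded_linear_ident U)
    have "frechet (\<lambda>z. z) (at (x :: (real^'n) \<times> (real^'n))) v = v" for x v
      using frechet_derivative_at[OF has_derivative_ident, of x] by metis
    then show ?thesis using variation[OF id that] by simp
  qed
  have fst_f: "fst (f z) = (1 / om z) *\<^sub>R fibre_grad h z" for z by (simp add: f_def dynamics_def)
  have snd_f: "snd (f z) = q z - (1 / om z) *\<^sub>R base_grad h z" for z by (simp add: f_def dynamics_def)
  \<comment> \<open>The derivative of the constant function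
    \<open>p . (v / \<Omega>) = 1\<close>.\<close>
  have unit: "snd z \<bullet> fst (frechet f (at z) w) = - (snd w \<bullet> fst (f z))" if "z \<in> U" for z w
  proof -
    note fd = smooth_on_has_derivative[OF fs that]
    have "((\<lambda>z. snd z \<bullet> fst (f z)) has_derivative
        (\<lambda>w. snd z \<bullet> fst (frechet f (at z) w) + snd w \<bullet> fst (f z))) (at z)"
      by (rule has_derivative_inner[OF has_derivative_snd[OF has_derivative_ident] has_derivative_fst[OF fd]])
    moreover have "((\<lambda>z. snd z \<bullet> fst (f z)) has_derivative (\<lambda>w. 0)) (at z)"
      by (rule has_derivative_transform_within_open[OF has_derivative_const[of "1::real"] U that])
        (use nz om in \<open>simp add: fst_f\<close>)
    ultimately have "(\<lambda>w. snd z \<bullet> fst (frechet f (at z) w) + snd w \<bullet> fst (f z)) = (\<lambda>w. 0)"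
      by (rule has_derivative_unique)
    from fun_cong[OF this, of w] show ?thesis by simp
  qed
  have phi1: "(\<phi> has_vector_derivative dev_rate h om q (F (t, 0)) (W t)) (at t)" if tT: "t \<in> T" for t
  proof -
    let ?z = "F (t, 0)"
    have tN: "(t, 0) \<in> N" using tT by (simp add: T_def)
    have "((\<lambda>t. F (t, 0)) has_vector_derivative f ?z) (at t)"
      using ode[OF tN] by (simp add: f_def)
    then have "((\<lambda>t. snd (F (t, 0)) \<bullet> fst (W t)) has_vector_derivative
        snd ?z \<bullet> fst (frechet f (at ?z) (W t)) + snd (f ?z) \<bullet> fst (W t)) (at t)"
      using Wder[OF tT]
      by (intro bounded_bilinear.has_vector_derivative[OF bounded_bilinear_inner]
          bounded_linear.has_vector_derivative[OF bounded_linear_fst] bounded_linear.has_vector_derivative[OF bounded_linear_snd])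
    moreover have "snd ?z \<bullet> fst (frechet f (at ?z) (W t)) + snd (f ?z) \<bullet> fst (W t) = dev_rate h om q ?z (W t)"
      unfolding unit[OF FU[OF tN]] dev_rate_def fst_f snd_f
      by (subst surjective_pairing[of "W t"], subst frechet_derivative_grads[OF smooth_on_differentiable[OF s(1) FU[OF tN]]])
        (simp add: inner_diff_right add_divide_distrib inner_commute)
    ultimately have "((\<lambda>t. snd (F (t, 0)) \<bullet> fst (W t)) has_vector_derivative dev_rate h om q ?z (W t)) (at t)" by simp
    then show ?thesis
      by (rule has_vector_derivative_transform_within_open[OF _ oT tT]) (simp add: phi T_def W_def)
  qed
  \<comment> \<open>On \<open>U\<close> the derivative of \<open>h\<close> along the field equals
    \<open>om z * (fst (f z) . q z)\<close> by \<open>dynamics_energy\<close>; this product is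
    differentiated in place of the left side, which contains second derivatives of
    \<open>h\<close>.\<close>
  have energy_var: "frechet (\<lambda>z. frechet h (at z) (f z)) (at z) w =
      frechet om (at z) w * (fibre_grad h z \<bullet> q z) / om z + om z * (fst (frechet f (at z) w) \<bullet> q z)
       + fibre_grad h z \<bullet> frechet q (at z) w" if z: "z \<in> U" for z w
  proof -
    have "((\<lambda>z. om z * (fst (f z) \<bullet> q z)) has_derivative
       (\<lambda>w. om z * (fst (f z) \<bullet> frechet q (at z) w + fst (frechet f (at z) w) \<bullet> q z)
         + frechet om (at z) w * (fst (f z) \<bullet> q z))) (at z)"
      by (intro has_derivative_mult has_derivative_inner has_derivative_fst smooth_on_has_derivative[OF fs z]
        smooth_on_has_derivative[OF s(2) z] smooth_on_has_derivative[OF s(3) z])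
    then have "((\<lambda>z. frechet h (at z) (f z)) has_derivative
       (\<lambda>w. om z * (fst (f z) \<bullet> frechet q (at z) w + fst (frechet f (at z) w) \<bullet> q z)
         + frechet om (at z) w * (fst (f z) \<bullet> q z))) (at z)"
    proof (rule has_derivative_transform_within_open[OF _ U z])
      show "om z * (fst (f z) \<bullet> q z) = frechet h (at z) (f z)" if "z \<in> U" for z
        using dynamics_energy[OF smooth_on_differentiable[OF s(1) that], of om q] nz[OF that]
        by (simp add: fst_f) (simp add: f_def)
    qed
    from fun_cong[OF frechet_derivative_at[OF this], of w] nz[OF z]
    show ?thesis by (simp add: fst_f algebra_simps)
  qed
  have phi2: "((\<lambda>t. dev_rate h om q (F (t, 0)) (W t)) has_vector_derivative dev_accel h om q (F (t, 0)) (W t)) (at t)" if tT: "t \<in> T" for t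
  proof -
    let ?z = "F (t, 0)"
    have z: "?z \<in> U" using tT FU by (simp add: T_def)
    have q: "((\<lambda>t. q (F (t, 0)) \<bullet> fst (W t)) has_vector_derivative
        q ?z \<bullet> fst (frechet f (at ?z) (W t)) + frechet q (at ?z) (f ?z) \<bullet> fst (W t)) (at t)"
      by (intro bounded_bilinear.has_vector_derivative[OF bounded_bilinear_inner]
          bounded_linear.has_vector_derivative[OF bounded_linear_fst] Wder[OF tT] along[OF s(3) tT])
    have "((\<lambda>t. frechet h (at (F (t, 0))) (W t) / om (F (t, 0))) has_vector_derivative
      (frechet (\<lambda>z. frechet h (at z) (f z)) (at ?z) (W t) * om ?z
        - frechet h (at ?z) (W t) * frechet om (at ?z) (f ?z)) / (om ?z * om ?z)) (at t)"
      using DERIV_divide[of "\<lambda>t. frechet h (at (F (t, 0))) (W t)" _ t UNIV "\<lambda>t. om (F (t, 0))"]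
        variation[OF s(1) tT] along[OF s(2) tT] nz[OF z]
      by (simp add: has_real_derivative_iff_has_vector_derivative)
    from has_vector_derivative_diff[OF q this]
    have "((\<lambda>t. dev_rate h om q (F (t, 0)) (W t)) has_vector_derivative
       q ?z \<bullet> fst (frechet f (at ?z) (W t)) + frechet q (at ?z) (f ?z) \<bullet> fst (W t) -
       (frechet (\<lambda>z. frechet h (at z) (f z)) (at ?z) (W t) * om ?z
        - frechet h (at ?z) (W t) * frechet om (at ?z) (f ?z)) / (om ?z * om ?z)) (at t)"
      by (simp add: dev_rate_def)
    \<comment> \<open>The two terms with the derivative of \<open>fst (f z)\<close> cancel: one
      comes from the variational equation for \<open>fst (W t)\<close>, the other from
      \<open>energy_var\<close>.\<close>
    moreover have "q ?z \<bullet> fst (frechet f (at ?z) (W t)) + frechet q (at ?z) (f ?z) \<bullet> fst (W t) -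
       (frechet (\<lambda>z. frechet h (at z) (f z)) (at ?z) (W t) * om ?z
        - frechet h (at ?z) (W t) * frechet om (at ?z) (f ?z)) / (om ?z * om ?z)
      = dev_accel h om q ?z (W t)"
      using nz[OF z] unfolding energy_var[OF z] dev_accel_def f_def[symmetric]
      by (simp add: field_simps power2_eq_square inner_commute)
    ultimately show ?thesis by simp
  qed
  have tT: "t \<in> T" using t by (simp add: T_def)
  show "deriv \<phi> t = dev_rate h om q (F (t, 0)) (frechet F (at (t, 0)) (0, 1))"
    using real_vector_derivativeD[OF phi1[OF tT]] by (simp add: W_def)
  have "(deriv \<phi> has_vector_derivative dev_accel h om q (F (t, 0)) (W t)) (at t)"
    by (rule has_vector_derivative_transform_within_open[OF phi2[OF tT] oT tT])
      (simp add: real_vector_derivativeD[OF phi1])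
  from real_vector_derivativeD[OF this]
  show "deriv (deriv \<phi>) t = dev_accel h om q (F (t, 0)) (frechet F (at (t, 0)) (0, 1))"
    by (simp add: W_def)
qed

section \<open>Algebra of the normality equations\<close>

lemma all_linear_forms_zero_iff:
  fixes T Z :: "'n::finite \<Rightarrow> real"
  shows "(\<forall>\<tau> \<xi>. (\<Sum>r\<in>UNIV. \<tau> r * T r) + (\<Sum>r\<in>UNIV. \<xi> r * Z r) = 0) \<longleftrightarrow> (\<forall>r. T r = 0) \<and> (\<forall>r. Z r = 0)"
proof (intro iffI conjI allI)
  fix r
  assume all: "\<forall>\<tau> \<xi>. (\<Sum>r\<in>UNIV. \<tau> r * T r) + (\<Sum>r\<in>UNIV. \<xi> r * Z r) = 0"
  show "T r = 0" using all[rule_format, of "\<lambda>i. if i = r then 1 else 0" "\<lambda>i. 0"]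
    by (simp add: if_distrib[of "\<lambda>x. x * _"] cong: if_cong)
  show "Z r = 0" using all[rule_format, of "\<lambda>i. 0" "\<lambda>i. if i = r then 1 else 0"]
    by (simp add: if_distrib[of "\<lambda>x. x * _"] cong: if_cong)
qed simp

text \<open>Here \<open>v\<close>, \<open>ofb\<close>, \<open>Qf\<close> are fibre derivatives and
  \<open>hb\<close>, \<open>obs\<close>, \<open>Qb\<close> base derivatives of H, \<Omega> and Q;
  \<open>c\<close> is \<Omega>, and \<open>m\<close> is the rate of \<Omega> along the trajectory.
  Comparison of the coefficients of \<open>\<xi>\<close> says that \<open>B\<close> is a multiple of
  \<open>v\<close>. Pairing with \<open>p\<close> gives the multiplier \<open>\<kappa> / c\<close>
  and thus \<open>a = \<kappa> - m / c\<close>. For this \<open>a\<close> the coefficients of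
  \<open>\<tau>\<close> are \<open>E r - b * p r\<close>, so \<open>E\<close> is a multiple of
  \<open>p\<close>, and pairing with \<open>v / c\<close> gives \<open>b\<close>.\<close>

lemma normality_algebra:
  fixes v p hb ofb obs Q :: "'n::finite \<Rightarrow> real" and Qf Qb :: "'n \<Rightarrow> 'n \<Rightarrow> real" and c :: real
  assumes c: "(\<Sum>i\<in>UNIV. p i * v i) = c" "c \<noteq> 0"
  defines "B \<equiv> \<lambda>r. \<Sum>s\<in>UNIV. v s / c * (Qf r s + ofb r / c * Q s)"
    and "C \<equiv> \<lambda>r. \<Sum>s\<in>UNIV. v s / c * (Qb r s + obs r / c * Q s)"
  defines "\<kappa> \<equiv> \<Sum>r\<in>UNIV. B r * p r"
  defines "E \<equiv> \<lambda>r. (\<Sum>s\<in>UNIV. (Qb s r + obs s / c * Q r) * (v s / c) - (hb s / c - Q s) * (Qf s r + ofb s / c * Q r))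
      - C r + \<kappa> * (hb r / c - Q r)"
    and "m \<equiv> \<Sum>r\<in>UNIV. obs r * (v r / c) + ofb r * (Q r - hb r / c)"
  shows "(\<exists>a b. \<forall>\<tau> \<xi>. m / c\<^sup>2 * (\<Sum>i\<in>UNIV. hb i * \<tau> i + v i * \<xi> i)
        - (\<Sum>s\<in>UNIV. v s * (\<Sum>r\<in>UNIV. Qb r s * \<tau> r + Qf r s * \<xi> r)) / c
        - (\<Sum>i\<in>UNIV. obs i * \<tau> i + ofb i * \<xi> i) / c\<^sup>2 * (\<Sum>s\<in>UNIV. v s * Q s)
        + (\<Sum>s\<in>UNIV. (\<Sum>r\<in>UNIV. Qb r s * (v r / c) + Qf r s * (Q r - hb r / c)) * \<tau> s)
      = a * ((\<Sum>s\<in>UNIV. Q s * \<tau> s) - (\<Sum>i\<in>UNIV. hb i * \<tau> i + v i * \<xi> i) / c) + b * (\<Sum>s\<in>UNIV. p s * \<tau> s))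
    \<longleftrightarrow> (\<forall>q. B q = \<kappa> * v q / c) \<and> (\<forall>q. E q = (\<Sum>r\<in>UNIV. E r * v r / c) * p q)"
proof -
  define X where "X s = (\<Sum>r\<in>UNIV. Qb r s * (v r / c) + Qf r s * (Q r - hb r / c))" for s
  define T where "T a b r = m / c\<^sup>2 * hb r - C r + X r - a * (Q r - hb r / c) - b * p r" for a b r
  define Z where "Z a r = m / c\<^sup>2 * v r - B r + a * v r / c" for a r
  have CB: "(\<Sum>s\<in>UNIV. v s * (\<Sum>r\<in>UNIV. Qb r s * \<tau> r + Qf r s * \<xi> r)) / c
        + (\<Sum>i\<in>UNIV. obs i * \<tau> i + ofb i * \<xi> i) / c\<^sup>2 * (\<Sum>s\<in>UNIV. v s * Q s)
     = (\<Sum>r\<in>UNIV. \<tau> r * C r) + (\<Sum>r\<in>UNIV. \<xi> r * B r)" for \<tau> \<xi>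
  proof -
    have 1: "(\<Sum>s\<in>UNIV. v s * (\<Sum>r\<in>UNIV. Qb r s * \<tau> r + Qf r s * \<xi> r)) / c
      = (\<Sum>r\<in>UNIV. \<Sum>s\<in>UNIV. v s / c * (Qb r s * \<tau> r + Qf r s * \<xi> r))"
      by (subst sum.swap) (simp add: sum_divide_distrib sum_distrib_left)
    have 2: "(\<Sum>i\<in>UNIV. obs i * \<tau> i + ofb i * \<xi> i) / c\<^sup>2 * (\<Sum>s\<in>UNIV. v s * Q s)
      = (\<Sum>r\<in>UNIV. \<Sum>s\<in>UNIV. (obs r * \<tau> r + ofb r * \<xi> r) / c\<^sup>2 * (v s * Q s))"
      by (simp add: sum_divide_distrib sum_product)
    show ?thesis
      unfolding 1 2
      unfolding B_def C_def sum_distrib_left sum.distrib[symmetric]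
      by (intro sum.cong refl) (simp add: algebra_simps add_divide_distrib power2_eq_square)
  qed
  have form: "(m / c\<^sup>2 * (\<Sum>i\<in>UNIV. hb i * \<tau> i + v i * \<xi> i)
        - (\<Sum>s\<in>UNIV. v s * (\<Sum>r\<in>UNIV. Qb r s * \<tau> r + Qf r s * \<xi> r)) / c
        - (\<Sum>i\<in>UNIV. obs i * \<tau> i + ofb i * \<xi> i) / c\<^sup>2 * (\<Sum>s\<in>UNIV. v s * Q s)
        + (\<Sum>s\<in>UNIV. X s * \<tau> s)
      = a * ((\<Sum>s\<in>UNIV. Q s * \<tau> s) - (\<Sum>i\<in>UNIV. hb i * \<tau> i + v i * \<xi> i) / c) + b * (\<Sum>s\<in>UNIV. p s * \<tau> s))
     \<longleftrightarrow> (\<Sum>r\<in>UNIV. \<tau> r * T a b r) + (\<Sum>r\<in>UNIV. \<xi> r * Z a r) = 0" for a b \<tau> \<xi>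
  proof -
    have "(\<Sum>r\<in>UNIV. \<tau> r * T a b r) + (\<Sum>r\<in>UNIV. \<xi> r * Z a r)
      = m / c\<^sup>2 * (\<Sum>i\<in>UNIV. hb i * \<tau> i + v i * \<xi> i) - ((\<Sum>r\<in>UNIV. \<tau> r * C r) + (\<Sum>r\<in>UNIV. \<xi> r * B r))
        + (\<Sum>s\<in>UNIV. X s * \<tau> s)
        - (a * ((\<Sum>s\<in>UNIV. Q s * \<tau> s) - (\<Sum>i\<in>UNIV. hb i * \<tau> i + v i * \<xi> i) / c) + b * (\<Sum>s\<in>UNIV. p s * \<tau> s))"
      unfolding T_def Z_def sum_distrib_left sum_divide_distrib sum.distrib[symmetric] sum_subtractf[symmetric]
      by (intro sum.cong refl) (simp add: algebra_simps add_divide_distrib)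
    then show ?thesis unfolding CB[of \<tau> \<xi>, symmetric] by (simp only: diff_diff_eq) linarith
  qed
  have pv: "(\<Sum>r\<in>UNIV. (k * v r / c) * p r) = k" for k
  proof -
    have "(\<Sum>r\<in>UNIV. (k * v r / c) * p r) = (k / c) * (\<Sum>i\<in>UNIV. p i * v i)"
      unfolding sum_distrib_left by (intro sum.cong refl) simp
    then show ?thesis using c by simp
  qed
  have Zk: "(\<forall>r. Z a r = 0) \<longleftrightarrow> (\<forall>q. B q = \<kappa> * v q / c) \<and> a = \<kappa> - m / c" if "\<exists>q. v q \<noteq> 0" for a
  proof -
    have Zr: "Z a r = 0 \<longleftrightarrow> B r = (m / c + a) * v r / c" for r
      using c(2) by (auto simp: Z_def field_simps power2_eq_square)
    have "\<kappa> = m / c + a" if "\<forall>r. B r = (m / c + a) * v r / c"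
      unfolding \<kappa>_def using that pv[of "m / c + a"] by simp
    then show ?thesis unfolding Zr by auto
  qed
  have vnz: "\<exists>q. v q \<noteq> 0"
  proof (rule ccontr)
    assume "\<not> ?thesis" then show False using c by simp
  qed
  have Tk: "T (\<kappa> - m / c) b r = E r - b * p r" for b r
  proof -
    have "X r + m / c * Q r = (\<Sum>s\<in>UNIV. (Qb s r + obs s / c * Q r) * (v s / c) - (hb s / c - Q s) * (Qf s r + ofb s / c * Q r))"
      unfolding X_def m_def sum_divide_distrib sum_distrib_right sum.distrib[symmetric]
      by (intro sum.cong refl) (simp add: algebra_simps add_divide_distrib diff_divide_distrib)
    then have Er: "E r = X r + m / c * Q r - C r + \<kappa> * (hb r / c - Q r)" unfolding E_def by simp
    show ?thesis unfolding T_def Er by (simp add: algebra_simps power2_eq_square)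
  qed
  have Eb: "(\<exists>b. \<forall>r. E r = b * p r) \<longleftrightarrow> (\<forall>q. E q = (\<Sum>r\<in>UNIV. E r * v r / c) * p q)"
  proof
    assume "\<exists>b. \<forall>r. E r = b * p r"
    then obtain b where b: "\<And>r. E r = b * p r" by blast
    have "(\<Sum>r\<in>UNIV. E r * v r / c) = (\<Sum>r\<in>UNIV. (b * v r / c) * p r)"
      by (intro sum.cong refl) (simp add: b)
    then show "\<forall>q. E q = (\<Sum>r\<in>UNIV. E r * v r / c) * p q" unfolding pv using b by simp
  qed blast
  show ?thesis
    unfolding X_def[symmetric] form all_linear_forms_zero_iff Zk[OF vnz] Eb[symmetric]
    using Tk by auto
qed

text \<open>Symmetry removes the terms where \<open>G\<close> multiplies \<open>Q\<close> directly,
  and also makes \<open>N\<close> symmetric, so that the connection part of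
  \<open>\<nabla>\<^sub>s\<close> applied to Q and \<Omega> cancels that of
  \<open>\<nabla>\<^sub>s H\<close>. What is left of the connection is contracted with
  \<open>B b - \<kappa> * v b / c\<close>, the expression that the first normality equation sets to
  zero.\<close>

lemma connection_terms:
  fixes v p hb ofb obs Q :: "'n::finite \<Rightarrow> real" and Qf Qb :: "'n \<Rightarrow> 'n \<Rightarrow> real" and c :: real
    and G :: "'n \<Rightarrow> 'n \<Rightarrow> 'n \<Rightarrow> real"
  assumes sym: "\<And>k i j. G k i j = G k j i"
  defines "B \<equiv> \<lambda>r. \<Sum>s\<in>UNIV. v s / c * (Qf r s + ofb r / c * Q s)"
    and "C \<equiv> \<lambda>r. \<Sum>s\<in>UNIV. v s / c * (Qb r s + obs r / c * Q s)"
  defines "\<kappa> \<equiv> \<Sum>r\<in>UNIV. B r * p r"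
  defines "E \<equiv> \<lambda>r. (\<Sum>s\<in>UNIV. (Qb s r + obs s / c * Q r) * (v s / c) - (hb s / c - Q s) * (Qf s r + ofb s / c * Q r))
      - C r + \<kappa> * (hb r / c - Q r)"
  shows "(\<Sum>s\<in>UNIV.
         (((Qb s r + (\<Sum>a\<in>UNIV. \<Sum>b\<in>UNIV. p a * G a s b * Qf b r) - (\<Sum>b\<in>UNIV. G b s r * Q b))
           + (obs s + (\<Sum>a\<in>UNIV. \<Sum>b\<in>UNIV. p a * G a s b * ofb b)) / c * Q r
           - (Qb r s + (\<Sum>a\<in>UNIV. \<Sum>b\<in>UNIV. p a * G a r b * Qf b s) - (\<Sum>b\<in>UNIV. G b r s * Q b))
           - (obs r + (\<Sum>a\<in>UNIV. \<Sum>b\<in>UNIV. p a * G a r b * ofb b)) / c * Q s) * (v s / c)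
          + (\<Sum>m\<in>UNIV.
               ((hb r + (\<Sum>a\<in>UNIV. \<Sum>b\<in>UNIV. p a * G a r b * v b)) / c - Q r) *
               (Qf m s + ofb m / c * Q s) * (v s / c) * p m)
          - ((hb s + (\<Sum>a\<in>UNIV. \<Sum>b\<in>UNIV. p a * G a s b * v b)) / c - Q s) * (Qf s r + ofb s / c * Q r)))
     = E r - (\<Sum>b\<in>UNIV. (\<Sum>a\<in>UNIV. p a * G a r b) * (B b - \<kappa> * v b / c))" (is "?L = _")
proof -
  define N where "N r b = (\<Sum>a\<in>UNIV. p a * G a r b)" for r b
  define R where "R r s = Qf r s + ofb r / c * Q s" for r s
  define Rb where "Rb r s = Qb r s + obs r / c * Q s" for r s
  have Nsym: "N r b = N b r" for r b unfolding N_def by (simp add: sym[of _ r b])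
  have N: "(\<Sum>a\<in>UNIV. \<Sum>b\<in>UNIV. p a * G a s b * x b) = (\<Sum>b\<in>UNIV. N s b * x b)" for s x
    unfolding N_def sum_distrib_right by (rule sum.swap)
  have NR: "(\<Sum>b\<in>UNIV. N s b * Qf b r) + (\<Sum>b\<in>UNIV. N s b * ofb b) / c * Q r = (\<Sum>b\<in>UNIV. N s b * R b r)" for s r
    unfolding R_def sum_divide_distrib sum_distrib_right sum.distrib[symmetric]
    by (intro sum.cong refl) (simp add: algebra_simps)
  have summand: "((Qb s r + (\<Sum>b\<in>UNIV. N s b * Qf b r) - (\<Sum>b\<in>UNIV. G b s r * Q b))
           + (obs s + (\<Sum>b\<in>UNIV. N s b * ofb b)) / c * Q r
           - (Qb r s + (\<Sum>b\<in>UNIV. N r b * Qf b s) - (\<Sum>b\<in>UNIV. G b r s * Q b))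
           - (obs r + (\<Sum>b\<in>UNIV. N r b * ofb b)) / c * Q s)
     = Rb s r + (\<Sum>b\<in>UNIV. N s b * R b r) - Rb r s - (\<Sum>b\<in>UNIV. N r b * R b s)" for s
    unfolding NR[symmetric] Rb_def sym[of _ s r] by (simp add: algebra_simps add_divide_distrib)
  have B: "B b = (\<Sum>s\<in>UNIV. v s / c * R b s)" for b unfolding B_def R_def ..
  have t4: "(\<Sum>s\<in>UNIV. (\<Sum>b\<in>UNIV. N r b * R b s) * (v s / c)) = (\<Sum>b\<in>UNIV. N r b * B b)"
    unfolding B sum_distrib_left sum_distrib_right by (subst sum.swap) (simp add: mult_ac)
  \<comment> \<open>The indices \<open>s\<close> and \<open>b\<close> are exchanged by symmetry of
    \<open>N\<close>. The right side is the connection part of the last summand, which enters with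
    the opposite sign.\<close>
  have t2: "(\<Sum>s\<in>UNIV. (\<Sum>b\<in>UNIV. N s b * R b r) * (v s / c)) = (\<Sum>s\<in>UNIV. (\<Sum>b\<in>UNIV. N s b * v b) / c * R s r)"
    unfolding sum_distrib_right sum_divide_distrib
    by (subst sum.swap) (simp add: Nsym[symmetric] mult_ac Nsym)
  have t5: "(\<Sum>s\<in>UNIV. \<Sum>m\<in>UNIV. k * R m s * (v s / c) * p m) = k * \<kappa>" for k
    unfolding \<kappa>_def B sum_distrib_left sum_distrib_right by (subst sum.swap) (simp add: mult_ac)
  have nv: "(\<Sum>b\<in>UNIV. N r b * (B b - \<kappa> * v b / c)) = (\<Sum>b\<in>UNIV. N r b * B b) - (\<Sum>b\<in>UNIV. N r b * v b) / c * \<kappa>"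
    unfolding sum_divide_distrib sum_distrib_right sum_subtractf[symmetric]
    by (intro sum.cong refl) (simp add: algebra_simps)
  have "?L = (\<Sum>s\<in>UNIV. (Rb s r + (\<Sum>b\<in>UNIV. N s b * R b r) - Rb r s - (\<Sum>b\<in>UNIV. N r b * R b s)) * (v s / c)
     + (\<Sum>m\<in>UNIV. ((hb r + (\<Sum>b\<in>UNIV. N r b * v b)) / c - Q r) * R m s * (v s / c) * p m)
     - ((hb s + (\<Sum>b\<in>UNIV. N s b * v b)) / c - Q s) * R s r)"
    unfolding N summand R_def ..
  also have "\<dots> = (\<Sum>s\<in>UNIV. Rb s r * (v s / c) - (hb s / c - Q s) * R s r)
      - (\<Sum>s\<in>UNIV. v s / c * Rb r s)
      + (\<Sum>s\<in>UNIV. (\<Sum>b\<in>UNIV. N s b * R b r) * (v s / c)) - (\<Sum>s\<in>UNIV. (\<Sum>b\<in>UNIV. N s b * v b) / c * R s r)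
      - (\<Sum>s\<in>UNIV. (\<Sum>b\<in>UNIV. N r b * R b s) * (v s / c))
      + (\<Sum>s\<in>UNIV. \<Sum>m\<in>UNIV. ((hb r + (\<Sum>b\<in>UNIV. N r b * v b)) / c - Q r) * R m s * (v s / c) * p m)"
    unfolding sum.distrib[symmetric] sum_subtractf[symmetric]
    by (intro sum.cong refl) (simp add: algebra_simps add_divide_distrib)
  also have "\<dots> = E r - (\<Sum>b\<in>UNIV. N r b * (B b - \<kappa> * v b / c))"
    unfolding t2 t4 t5 nv E_def C_def R_def[symmetric] Rb_def[symmetric] by (simp add: algebra_simps add_divide_distrib)
  finally show ?thesis unfolding N_def .
qed

section \<open>Charts of the cotangent bundle\<close>

lemma open_image_fst_euclid:
  fixes S :: "('a::topological_space \<times> 'b::topological_space) set"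
  assumes "open S"
  shows "open (fst ` S)"
  using open_map_fst[of "euclidean :: 'a topology" "euclidean :: 'b topology"] assms
  unfolding open_map_def euclidean_product_topology by simp

text \<open>The map \<open>l\<close> parametrizes the plane through \<open>x\<close> spanned by
  \<open>a\<close> and \<open>u\<close>; composition with it reduces the claim to
  \<open>mixed_partials\<close> in two real variables.\<close>

lemma symmetric_second_derivative:
  fixes T :: "'a::euclidean_space \<Rightarrow> 'b::euclidean_space"
  assumes S: "open S" "x \<in> S" and T: "smooth_on S T"
  shows "frechet (\<lambda>y. frechet T (at y) u) (at x) a
       = frechet (\<lambda>y. frechet T (at y) a) (at x) u"
proof -
  define l where "l z = x + fst z *\<^sub>R a + snd z *\<^sub>R u" for z :: "real \<times> real"
  define N where "N = l -` S"
  have lc: "continuous_on UNIV l" unfolding l_def by (intro continuous_intros)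
  have N: "open N" "(0, 0) \<in> N" unfolding N_def using S lc by (auto intro: open_vimage simp: l_def)
  have dl: "(l has_derivative (\<lambda>w. fst w *\<^sub>R a + snd w *\<^sub>R u)) (at z)" for z
    unfolding l_def by (auto intro!: derivative_eq_intros)
  have fdl: "frechet l (at z) w = fst w *\<^sub>R a + snd w *\<^sub>R u" for z w
    using fun_cong[OF frechet_derivative_at[OF dl[of z]], of w] by simp
  have ls: "smooth_on N l"
  proof (rule smooth_onI)
    show "hdo N l k" for k
      unfolding l_def
      by (intro hdo_add hdo_scaleR hdo_const N(1) hdo_bounded_linear[OF bounded_linear_fst] hdo_bounded_linear[OF bounded_linear_snd])
  qed
  have lN: "l ` N \<subseteq> S" by (auto simp: N_def)
  define g where "g z = T (l z)" for z
  have gs: "smooth_on N g" unfolding g_def by (rule smooth_on_compose[OF ls T N(1) S(1) lN])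
  have dlz: "l differentiable at z" for z using dl by (rule differentiableI)
  have fg: "frechet g (at z) w = frechet T (at (l z)) (fst w *\<^sub>R a + snd w *\<^sub>R u)" if "z \<in> N" for z w
    unfolding g_def using frechet_derivative_chain[OF smooth_on_differentiable[OF T] dlz] lN that by (simp add: fdl image_subset_iff)
  have Tu: "frechet (\<lambda>y. frechet T (at y) b) (at x) c
      = frechet (\<lambda>z. frechet T (at (l z)) b) (at (0, 0)) w"
    if "c = fst w *\<^sub>R a + snd w *\<^sub>R u" for b c w
    using frechet_derivative_chain[of "\<lambda>y. frechet T (at y) b" l "(0, 0)" w]
      smooth_on_differentiable[OF smooth_on_derivative[OF T] S(2)] dlz that by (simp add: fdl) (simp add: l_def)
  have "((\<lambda>t. frechet g (at (t, 0)) (0, 1)) has_vector_derivative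
           frechet (\<lambda>z. frechet g (at z) (1, 0)) (at (0, 0)) (0, 1)) (at 0)"
    by (rule mixed_partials[OF N gs])
  moreover have "((\<lambda>t. frechet g (at (t, 0)) (0, 1)) has_vector_derivative
           frechet (\<lambda>z. frechet g (at z) (0, 1)) (at (0, 0)) (1, 0)) (at 0)"
    by (rule has_vector_derivative_chain[OF has_vector_derivative_fst_const])
      (rule smooth_on_has_derivative[OF smooth_on_derivative[OF gs] N(2)])
  ultimately have "frechet (\<lambda>z. frechet g (at z) (1, 0)) (at (0, 0)) (0, 1)
      = frechet (\<lambda>z. frechet g (at z) (0, 1)) (at (0, 0)) (1, 0)"
    by (rule vector_derivative_unique_at)
  then show ?thesis
    using frechet_derivative_cong_open[OF N, of "\<lambda>z. frechet g (at z) (1, 0)" "\<lambda>z. frechet T (at (l z)) a"]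
      frechet_derivative_cong_open[OF N, of "\<lambda>z. frechet g (at z) (0, 1)" "\<lambda>z. frechet T (at (l z)) u"]
    by (simp add: fg Tu[of a "(1, 0)"] Tu[of u "(0, 1)"])
qed

lemma smooth_betweenD:
  assumes "smooth_between A S B T f" "c \<in> A" "d \<in> B"
  shows "open (snd c ` (fst c \<inter> S \<inter> f -` fst d))"
    and "smooth_on (snd c ` (fst c \<inter> S \<inter> f -` fst d)) (snd d \<circ> f \<circ> inv_into (fst c) (snd c))"
  using assms by (auto simp: smooth_between_def)

lemma inner_vec_axis: "v \<bullet> axis i 1 = v $ i" for v :: "real^'n"
  by (simp add: inner_axis)

section \<open>Points and coordinates of the tangent and cotangent bundle\<close>

locale regular_system =
  fixes X :: "'a topology"
    and A :: "('a, real^'n) chart set"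
    and L :: "('a, real^'n) bundle_pt \<Rightarrow> real"
  assumes manifold: "smooth_manifold X A"
    and regular: "regular_lagrangian A L"
begin

abbreviation "TM \<equiv> tangent_bundle A"
abbreviation "CM \<equiv> cotangent_bundle A"
abbreviation "Ham \<equiv> hamiltonian A L"
abbreviation "Om \<equiv> Omega_cot A L"
abbreviation "coord c \<equiv> snd (bundle_chart CM c)"
abbreviation "point c \<equiv> inv_into (fst (bundle_chart CM c)) (snd (bundle_chart CM c))"
abbreviation "tpoint c \<equiv> inv_into (fst (bundle_chart TM c)) (snd (bundle_chart TM c))"

definition "U c = coord c ` fst (bundle_chart CM c)"
definition "UT c = snd (bundle_chart TM c) ` fst (bundle_chart TM c)"

abbreviation "ileg \<equiv> inv_into TM (legendre A L)"

lemma coord_eq: "snd (bundle_chart E c) z = (snd c (fst z), snd z c)"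
  by (simp add: bundle_chart_def)

lemma fst_bundle_chart: "z \<in> fst (bundle_chart E c) \<longleftrightarrow> z \<in> E \<and> fst z \<in> fst c"
  by (simp add: bundle_chart_def)

lemma bundle_chart_in_atlas: "c \<in> A \<Longrightarrow> bundle_chart E c \<in> bundle_atlas A E"
  by (simp add: bundle_atlas_def)

lemma inj_chart: "c \<in> A \<Longrightarrow> inj_on (snd c) (fst c)"
proof -
  assume c: "c \<in> A"
  have "homeomorphic_map (subtopology X (fst c)) (top_of_set (snd c ` fst c)) (snd c)" "openin X (fst c)"
    using manifold c by (auto simp: smooth_manifold_def)
  then show ?thesis
    using homeomorphic_imp_injective_map openin_subset by (metis topspace_subtopology_subset)
qed

lemma transition_smooth:
  "c \<in> A \<Longrightarrow> c' \<in> A \<Longrightarrow> smooth_on (snd c ` (fst c \<inter> fst c')) (transition c c')"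
  using manifold by (auto simp: smooth_manifold_def)

lemma cotangent_space_component:
  "p \<in> cotangent_space A x \<Longrightarrow> c \<in> A \<Longrightarrow> c' \<in> A \<Longrightarrow> x \<in> fst c \<Longrightarrow> x \<in> fst c' \<Longrightarrow>
     p c $ i = (\<Sum>j\<in>UNIV. jac c c' x j i * p c' $ j)"
  unfolding cotangent_space_def by blast

lemma cotangent_space_outside:
  "p \<in> cotangent_space A x \<Longrightarrow> \<not> (c \<in> A \<and> x \<in> fst c) \<Longrightarrow> p c = 0"
  unfolding cotangent_space_def by blast

lemma tangent_space_component:
  "v \<in> tangent_space A x \<Longrightarrow> c \<in> A \<Longrightarrow> c' \<in> A \<Longrightarrow> x \<in> fst c \<Longrightarrow> x \<in> fst c' \<Longrightarrow>
     v c' $ j = (\<Sum>i\<in>UNIV. jac c c' x j i * v c $ i)"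
  unfolding tangent_space_def by blast

lemma tangent_space_outside:
  "v \<in> tangent_space A x \<Longrightarrow> \<not> (c \<in> A \<and> x \<in> fst c) \<Longrightarrow> v c = 0"
  unfolding tangent_space_def by blast

text \<open>Pairing with an arbitrary vector replaces the Jacobian matrix by the derivative of the
  transition map as a linear map. In this form the law can later be differentiated as a
  whole.\<close>

lemma cotangent_transform:
  assumes "p \<in> cotangent_space A x" "c \<in> A" "c' \<in> A" "x \<in> fst c" "x \<in> fst c'"
  shows "p c \<bullet> u = p c' \<bullet> frechet (transition c c') (at (snd c x)) u"
proof -
  have "transition c c' differentiable at (snd c x)"
    using assms by (intro smooth_on_differentiable[OF transition_smooth]) auto
  then have lin: "linear (\<lambda>u. p c' \<bullet> frechet (transition c c') (at (snd c x)) u)"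
    by (intro linear_compose[OF linear_frechet_derivative, unfolded o_def] bounded_linear.linear[OF bounded_linear_inner_right])
  have "p c $ i = p c' \<bullet> frechet (transition c c') (at (snd c x)) (axis i 1)" for i
    unfolding cotangent_space_component[OF assms] by (simp add: jac_def inner_vec_def mult.commute)
  then have "p c = (\<chi> i. p c' \<bullet> frechet (transition c c') (at (snd c x)) (axis i 1))"
    by (simp add: vec_eq_iff)
  then show ?thesis using linear_vec_expand[OF lin, of u] by simp
qed

lemma tangent_transform:
  assumes "v \<in> tangent_space A x" "c \<in> A" "c' \<in> A" "x \<in> fst c" "x \<in> fst c'"
  shows "v c' = frechet (transition c c') (at (snd c x)) (v c)"
proof -
  let ?D = "frechet (transition c c') (at (snd c x))"
  have lin: "linear ?D"
    using assms by (intro linear_frechet_derivative smooth_on_differentiable[OF transition_smooth]) auto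
  have "?D (v c) = ?D (\<Sum>i\<in>UNIV. v c $ i *\<^sub>R axis i 1)"
    using basis_expansion[of "v c"] by (simp add: scalar_mult_eq_scaleR)
  also have "\<dots> = (\<Sum>i\<in>UNIV. v c $ i *\<^sub>R ?D (axis i 1))"
    by (simp add: linear_sum[OF lin] linear_scale[OF lin])
  finally have "?D (v c) $ j = v c' $ j" for j
    unfolding tangent_space_component[OF assms] by (simp add: jac_def mult.commute)
  then show ?thesis by (simp add: vec_eq_iff)
qed

lemma pairing_invariant:
  assumes "v \<in> tangent_space A x" "p \<in> cotangent_space A x" "c \<in> A" "c' \<in> A" "x \<in> fst c" "x \<in> fst c'"
  shows "p c \<bullet> v c = p c' \<bullet> v c'"
  using cotangent_transform[OF assms(2-)] tangent_transform[OF assms(1,3-)] by simp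

text \<open>The transformation law recovers every component from the one in \<open>c\<close>, and
  outside the charts around \<open>x\<close> all covectors have the entry 0.\<close>

lemma cotangent_eqI:
  assumes "p \<in> cotangent_space A x" "p' \<in> cotangent_space A x" "c \<in> A" "x \<in> fst c" "p c = p' c"
  shows "p = p'"
proof
  fix d
  show "p d = p' d"
  proof (cases "d \<in> A \<and> x \<in> fst d")
    case True
    then have "p d $ i = p' d $ i" for i
      using cotangent_space_component[OF assms(1) _ assms(3) _ assms(4), of d i]
        cotangent_space_component[OF assms(2) _ assms(3) _ assms(4), of d i] assms(5) by simp
    then show ?thesis by (simp add: vec_eq_iff)
  next
    case False
    then show ?thesis using cotangent_space_outside assms(1,2) by metis
  qed
qed

lemma zero_vec_cotangent: "zero_vec \<in> cotangent_space A x"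
  by (simp add: cotangent_space_def zero_vec_def)

lemma CM_D: "z \<in> CM \<Longrightarrow> snd z \<in> cotangent_space A (fst z)" "z \<in> CM \<Longrightarrow> \<exists>c\<in>A. fst z \<in> fst c"
  by (cases z; simp add: cotangent_bundle_def)+

lemma TM_D: "z \<in> TM \<Longrightarrow> snd z \<in> tangent_space A (fst z)" "z \<in> TM \<Longrightarrow> \<exists>c\<in>A. fst z \<in> fst c"
  by (cases z; simp add: tangent_bundle_def)+

lemma CM_zero_iff:
  assumes "z \<in> CM" "c \<in> A" "fst z \<in> fst c"
  shows "snd z = zero_vec \<longleftrightarrow> snd z c = 0"
proof
  assume "snd z c = 0"
  then show "snd z = zero_vec"
    by (intro cotangent_eqI[OF CM_D(1)[OF assms(1)] zero_vec_cotangent assms(2,3)]) (simp add: zero_vec_def)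
qed (simp add: zero_vec_def)

lemma inj_coord: "c \<in> A \<Longrightarrow> inj_on (coord c) (fst (bundle_chart CM c))"
proof (rule inj_onI)
  fix z z' assume c: "c \<in> A" and z: "z \<in> fst (bundle_chart CM c)" "z' \<in> fst (bundle_chart CM c)" "coord c z = coord c z'"
  then have 1: "z \<in> CM" "z' \<in> CM" "fst z \<in> fst c" "fst z' \<in> fst c" "snd c (fst z) = snd c (fst z')" "snd z c = snd z' c"
    by (simp_all add: coord_eq fst_bundle_chart)
  have "fst z = fst z'" using inj_onD[OF inj_chart[OF c] 1(5,3,4)] .
  moreover have "snd z = snd z'"
    using cotangent_eqI[of "snd z" "fst z" "snd z'" c] CM_D(1)[OF 1(1)] CM_D(1)[OF 1(2)] c 1(3,6) calculation by simp
  ultimately show "z = z'" by (simp add: prod_eq_iff)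
qed

lemma point_coord: "c \<in> A \<Longrightarrow> z \<in> CM \<Longrightarrow> fst z \<in> fst c \<Longrightarrow> point c (coord c z) = z"
  using inv_into_f_f[OF inj_coord] by (simp add: fst_bundle_chart)

lemma coord_in_U: "z \<in> CM \<Longrightarrow> fst z \<in> fst c \<Longrightarrow> coord c z \<in> U c"
  unfolding U_def by (rule imageI) (simp add: fst_bundle_chart)

lemma point:
  assumes "\<zeta> \<in> U c"
  shows "point c \<zeta> \<in> CM" "fst (point c \<zeta>) \<in> fst c" "coord c (point c \<zeta>) = \<zeta>"
    "snd c (fst (point c \<zeta>)) = fst \<zeta>" "snd (point c \<zeta>) c = snd \<zeta>"
proof -
  have "point c \<zeta> \<in> fst (bundle_chart CM c)" using assms unfolding U_def by (rule inv_into_into)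
  then show 1: "point c \<zeta> \<in> CM" "fst (point c \<zeta>) \<in> fst c" by (auto simp: fst_bundle_chart)
  show "coord c (point c \<zeta>) = \<zeta>" using assms unfolding U_def by (rule f_inv_into_f)
  then show "snd c (fst (point c \<zeta>)) = fst \<zeta>" "snd (point c \<zeta>) c = snd \<zeta>" by (simp_all add: coord_eq prod_eq_iff)
qed

lemma tpoint:
  assumes "\<zeta> \<in> UT c"
  shows "tpoint c \<zeta> \<in> TM" "fst (tpoint c \<zeta>) \<in> fst c" "snd (bundle_chart TM c) (tpoint c \<zeta>) = \<zeta>"
    "snd c (fst (tpoint c \<zeta>)) = fst \<zeta>" "snd (tpoint c \<zeta>) c = snd \<zeta>"
proof -
  have "tpoint c \<zeta> \<in> fst (bundle_chart TM c)" using assms unfolding UT_def by (rule inv_into_into)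
  then show 1: "tpoint c \<zeta> \<in> TM" "fst (tpoint c \<zeta>) \<in> fst c" by (auto simp: fst_bundle_chart)
  show "snd (bundle_chart TM c) (tpoint c \<zeta>) = \<zeta>" using assms unfolding UT_def by (rule f_inv_into_f)
  then show "snd c (fst (tpoint c \<zeta>)) = fst \<zeta>" "snd (tpoint c \<zeta>) c = snd \<zeta>" by (simp_all add: coord_eq prod_eq_iff)
qed

lemma tpoint_coord:
  assumes c: "c \<in> A" and z: "z \<in> TM" "fst z \<in> fst c"
  shows "tpoint c (snd c (fst z), snd z c) = z" "(snd c (fst z), snd z c) \<in> UT c"
proof -
  have "inj_on (snd (bundle_chart TM c)) (fst (bundle_chart TM c))"
  proof (rule inj_onI)
    fix z z' assume z: "z \<in> fst (bundle_chart TM c)" "z' \<in> fst (bundle_chart TM c)"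
      "snd (bundle_chart TM c) z = snd (bundle_chart TM c) z'"
    then have 1: "z \<in> TM" "z' \<in> TM" "fst z \<in> fst c" "fst z' \<in> fst c" "snd c (fst z) = snd c (fst z')" and e: "snd z c = snd z' c" "fst z \<in> fst c"
      by (simp_all add: coord_eq fst_bundle_chart)
    have f: "fst z = fst z'" using inj_onD[OF inj_chart[OF c] 1(5,3,4)] .
    have t: "snd z \<in> tangent_space A (fst z)" "snd z' \<in> tangent_space A (fst z)"
      using TM_D(1)[OF 1(1)] TM_D(1)[OF 1(2)] f by simp_all
    have "snd z d = snd z' d" for d
    proof (cases "d \<in> A \<and> fst z \<in> fst d")
      case True
      then show ?thesis using tangent_transform[OF t(1) c, of d] tangent_transform[OF t(2) c, of d] e by simp
    next
      case False
      then show ?thesis using tangent_space_outside t by metis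
    qed
    then show "z = z'" using f by (simp add: prod_eq_iff ext)
  qed
  from inv_into_f_f[OF this, of z] show "tpoint c (snd c (fst z), snd z c) = z"
    using z by (simp add: fst_bundle_chart) (simp add: coord_eq)
  have "snd (bundle_chart TM c) z \<in> UT c" unfolding UT_def using z by (intro imageI) (simp add: fst_bundle_chart)
  then show "(snd c (fst z), snd z c) \<in> UT c" by (simp add: coord_eq)
qed

section \<open>The Legendre map in charts\<close>

lemma regularD:
  "smooth_between (bundle_atlas A TM) TM std_atlas UNIV L"
  "bij_betw (legendre A L) TM CM"
  "smooth_between (bundle_atlas A TM) TM (bundle_atlas A CM) CM (legendre A L)"
  "smooth_between (bundle_atlas A CM) CM (bundle_atlas A TM) TM ileg"
  "z \<in> TM \<Longrightarrow> snd z \<noteq> zero_vec \<Longrightarrow> Omega A L z > 0"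
  using regular unfolding regular_lagrangian_def diffeo_between_def nonzero_part_def Let_def by blast+

lemma fst_legendre [simp]: "fst (legendre A L z) = fst z"
  by (simp add: legendre_def)

lemma ileg:
  assumes "z \<in> CM"
  shows "ileg z \<in> TM" "legendre A L (ileg z) = z" "fst (ileg z) = fst z"
proof -
  have im: "z \<in> legendre A L ` TM" using regularD(2) assms by (simp add: bij_betw_def)
  show "ileg z \<in> TM" "legendre A L (ileg z) = z"
    using inv_into_into[OF im] f_inv_into_f[OF im] by auto
  then show "fst (ileg z) = fst z" using fst_legendre by metis
qed

lemma legendre_CM: "z \<in> TM \<Longrightarrow> legendre A L z \<in> CM"
  using regularD(2) by (auto simp: bij_betw_def)

lemma UT_smooth:
  assumes "c \<in> A"
  shows "open (UT c)" "smooth_on (UT c) (local_rep TM c L)"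
proof -
  have e: "fst (bundle_chart TM c) \<inter> TM \<inter> L -` fst (UNIV, id) = fst (bundle_chart TM c)"
    by (auto simp: bundle_chart_def)
  have "(UNIV, id) \<in> std_atlas" by (simp add: std_atlas_def)
  from smooth_betweenD[OF regularD(1) bundle_chart_in_atlas[OF assms] this]
  show "open (UT c)" "smooth_on (UT c) (local_rep TM c L)"
    unfolding e UT_def local_rep_def by (simp_all add: o_def)
qed

definition "legendre_inv_chart c = snd (bundle_chart TM c) \<circ> ileg \<circ> point c"

text \<open>\<open>smooth_between\<close> carries the openness of coordinate images. The inverse
  Legendre map keeps the base point, so with the same base chart on both sides its coordinate domain
  is all of \<open>U c\<close>.\<close>

lemma U_smooth:
  assumes "c \<in> A"
  shows "open (U c)" "smooth_on (U c) (legendre_inv_chart c)"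
proof -
  have e: "fst (bundle_chart CM c) \<inter> CM \<inter> ileg -` fst (bundle_chart TM c) = fst (bundle_chart CM c)"
    using ileg by (auto simp: bundle_chart_def)
  from smooth_betweenD[OF regularD(4) bundle_chart_in_atlas[OF assms] bundle_chart_in_atlas[OF assms]]
  show "open (U c)" "smooth_on (U c) (legendre_inv_chart c)"
    unfolding e U_def legendre_inv_chart_def .
qed

lemma legendre_inv_chart:
  assumes c: "c \<in> A" and \<zeta>: "\<zeta> \<in> U c"
  shows "legendre_inv_chart c \<zeta> \<in> UT c" "fst (legendre_inv_chart c \<zeta>) = fst \<zeta>" "tpoint c (legendre_inv_chart c \<zeta>) = ileg (point c \<zeta>)"
    "snd (legendre_inv_chart c \<zeta>) = snd (ileg (point c \<zeta>)) c"
proof -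
  note p = point[OF \<zeta>] and i = ileg[OF point(1)[OF \<zeta>]]
  have e: "legendre_inv_chart c \<zeta> = (snd c (fst (ileg (point c \<zeta>))), snd (ileg (point c \<zeta>)) c)"
    by (simp add: legendre_inv_chart_def coord_eq)
  show "legendre_inv_chart c \<zeta> \<in> UT c" "tpoint c (legendre_inv_chart c \<zeta>) = ileg (point c \<zeta>)"
    unfolding e using tpoint_coord[OF c i(1)] i(3) p(2) by simp_all
  show "fst (legendre_inv_chart c \<zeta>) = fst \<zeta>" "snd (legendre_inv_chart c \<zeta>) = snd (ileg (point c \<zeta>)) c"
    unfolding e using i(3) p(4) by simp_all
qed

definition "legendre_chart c c' = coord c' \<circ> legendre A L \<circ> tpoint c"

lemma legendre_chart_smooth:
  assumes "c \<in> A" "c' \<in> A"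
  shows "open {\<zeta> \<in> UT c. fst (tpoint c \<zeta>) \<in> fst c'}" "smooth_on {\<zeta> \<in> UT c. fst (tpoint c \<zeta>) \<in> fst c'} (legendre_chart c c')"
proof -
  have e: "snd (bundle_chart TM c) ` (fst (bundle_chart TM c) \<inter> TM \<inter> legendre A L -` fst (bundle_chart CM c'))
      = {\<zeta> \<in> UT c. fst (tpoint c \<zeta>) \<in> fst c'}" (is "?l = ?r")
  proof (intro set_eqI iffI)
    fix \<zeta> assume "\<zeta> \<in> ?l"
    then obtain z where "\<zeta> = snd (bundle_chart TM c) z" "z \<in> fst (bundle_chart TM c)"
        "legendre A L z \<in> fst (bundle_chart CM c')" by blast
    then have z: "\<zeta> = (snd c (fst z), snd z c)" "z \<in> TM" "fst z \<in> fst c" "fst z \<in> fst c'"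
      by (simp_all add: fst_bundle_chart coord_eq)
    then show "\<zeta> \<in> ?r" using tpoint_coord[OF assms(1) z(2,3)] by simp
  next
    fix \<zeta> assume "\<zeta> \<in> ?r"
    then have z: "\<zeta> \<in> UT c" "fst (tpoint c \<zeta>) \<in> fst c'" by auto
    show "\<zeta> \<in> ?l"
      using tpoint[OF z(1)] z(2) legendre_CM by (intro image_eqI[of _ _ "tpoint c \<zeta>"]) (auto simp: fst_bundle_chart)
  qed
  from smooth_betweenD[OF regularD(3) bundle_chart_in_atlas[OF assms(1)] bundle_chart_in_atlas[OF assms(2)]]
  show "open {\<zeta> \<in> UT c. fst (tpoint c \<zeta>) \<in> fst c'}" "smooth_on {\<zeta> \<in> UT c. fst (tpoint c \<zeta>) \<in> fst c'} (legendre_chart c c')"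
    unfolding e legendre_chart_def by simp_all
qed

section \<open>Coordinate changes on the cotangent bundle\<close>

definition "overlap c c' = {\<zeta> \<in> U c. fst (point c \<zeta>) \<in> fst c'}"
definition "change c c' \<zeta> = coord c' (point c \<zeta>)"

text \<open>The identity of the cotangent bundle is the Legendre map after its inverse. This gives the
  smoothness of coordinate changes without a computation of Jacobians.\<close>
lemma change_smooth:
  assumes c: "c \<in> A" and c': "c' \<in> A"
  shows "open (overlap c c')" "smooth_on (overlap c c') (change c c')"
proof -
  let ?S = "{\<zeta> \<in> UT c. fst (tpoint c \<zeta>) \<in> fst c'}"
  have o: "overlap c c' = U c \<inter> legendre_inv_chart c -` ?S"
  proof (intro set_eqI)
    fix \<zeta>
    show "\<zeta> \<in> overlap c c' \<longleftrightarrow> \<zeta> \<in> U c \<inter> legendre_inv_chart c -` ?S"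
      by (cases "\<zeta> \<in> U c") (simp_all add: overlap_def legendre_inv_chart[OF c] ileg(3) point(1))
  qed
  show op: "open (overlap c c')"
    unfolding o by (rule continuous_open_preimage[OF smooth_on_continuous_on[OF U_smooth(2)[OF c]] U_smooth(1)[OF c] legendre_chart_smooth(1)[OF c c']])
  have "smooth_on (overlap c c') (\<lambda>\<zeta>. legendre_chart c c' (legendre_inv_chart c \<zeta>))"
    by (rule smooth_on_compose[OF smooth_on_subset[OF U_smooth(2)[OF c]] legendre_chart_smooth(2)[OF c c'] op legendre_chart_smooth(1)[OF c c']])
      (auto simp: o)
  then show "smooth_on (overlap c c') (change c c')"
  proof (rule smooth_on_cong[OF op])
    fix \<zeta> assume "\<zeta> \<in> overlap c c'"
    then have \<zeta>: "\<zeta> \<in> U c" by (simp add: overlap_def)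
    show "change c c' \<zeta> = legendre_chart c c' (legendre_inv_chart c \<zeta>)"
      unfolding change_def legendre_chart_def o_apply legendre_inv_chart(3)[OF c \<zeta>] ileg(2)[OF point(1)[OF \<zeta>]] ..
  qed
qed

lemma change:
  assumes c: "c \<in> A" "c' \<in> A" and \<zeta>: "\<zeta> \<in> overlap c c'"
  shows "change c c' \<zeta> \<in> U c'" "point c' (change c c' \<zeta>) = point c \<zeta>"
    "fst (change c c' \<zeta>) = transition c c' (fst \<zeta>)"
    "snd \<zeta> \<bullet> u = snd (change c c' \<zeta>) \<bullet> frechet (transition c c') (at (fst \<zeta>)) u"
proof -
  have z: "\<zeta> \<in> U c" "fst (point c \<zeta>) \<in> fst c'" using \<zeta> by (auto simp: overlap_def)
  note p = point[OF z(1)]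
  show "change c c' \<zeta> \<in> U c'" unfolding change_def by (rule coord_in_U[OF p(1) z(2)])
  show "point c' (change c c' \<zeta>) = point c \<zeta>" unfolding change_def by (rule point_coord[OF c(2) p(1) z(2)])
  have "inv_into (fst c) (snd c) (fst \<zeta>) = fst (point c \<zeta>)"
    using inv_into_f_f[OF inj_chart[OF c(1)] p(2)] p(4) by simp
  then show "fst (change c c' \<zeta>) = transition c c' (fst \<zeta>)"
    by (simp add: change_def coord_eq transition_def)
  show "snd \<zeta> \<bullet> u = snd (change c c' \<zeta>) \<bullet> frechet (transition c c') (at (fst \<zeta>)) u"
    using cotangent_transform[OF CM_D(1)[OF p(1)] c p(2) z(2), of u] p(4,5) by (simp add: change_def coord_eq)
qed

end

section \<open>The Hamiltonian system in a chart\<close>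

lemma has_derivative_imp_frechet: "(f has_derivative D) (at x) \<Longrightarrow> frechet f (at x) w = D w"
  using frechet_derivative_at by metis

context regular_system
begin

definition "velocity c \<zeta> = snd (legendre_inv_chart c \<zeta>)"
definition "hloc c = local_rep CM c Ham"
definition "omloc c = local_rep CM c Om"

text \<open>\<open>Omega\<close> is computed in the chart picked by \<open>chart_at\<close>. It is
  the pairing of a covector with a vector, hence the same number in every chart.\<close>

lemma Omega_chart:
  assumes z: "z \<in> TM" and c: "c \<in> A" "fst z \<in> fst c"
  shows "Omega A L z = snd (legendre A L z) c \<bullet> snd z c"
proof -
  define k where "k = chart_at A (fst z)"
  have k: "k \<in> A \<and> fst z \<in> fst k"
    unfolding k_def chart_at_def by (rule someI[of _ c]) (simp add: c)
  then have "Omega A L z = snd (legendre A L z) k \<bullet> snd z k"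
    by (simp add: Omega_def Let_def k_def[symmetric] legendre_def inner_vec_def mult.commute)
  also have "\<dots> = snd (legendre A L z) c \<bullet> snd z c"
    using pairing_invariant[OF TM_D(1)[OF z], of "snd (legendre A L z)" k c] CM_D(1)[OF legendre_CM[OF z]] k c by simp
  finally show ?thesis .
qed

lemma omloc:
  assumes c: "c \<in> A" and \<zeta>: "\<zeta> \<in> U c"
  shows "omloc c \<zeta> = snd \<zeta> \<bullet> velocity c \<zeta>"
    and "hloc c \<zeta> = snd \<zeta> \<bullet> velocity c \<zeta> - local_rep TM c L (legendre_inv_chart c \<zeta>)"
proof -
  note p = point[OF \<zeta>]
  have 1: "Omega A L (ileg (point c \<zeta>)) = snd \<zeta> \<bullet> velocity c \<zeta>"
    using Omega_chart[OF ileg(1)[OF p(1)] c] ileg[OF p(1)] p(2,5) legendre_inv_chart(4)[OF c \<zeta>] by (simp add: velocity_def)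
  then show "omloc c \<zeta> = snd \<zeta> \<bullet> velocity c \<zeta>" by (simp add: omloc_def local_rep_def Omega_cot_def)
  show "hloc c \<zeta> = snd \<zeta> \<bullet> velocity c \<zeta> - local_rep TM c L (legendre_inv_chart c \<zeta>)"
    using 1 legendre_inv_chart(3)[OF c \<zeta>] by (simp add: hloc_def local_rep_def hamiltonian_def)
qed

lemma velocity_smooth: "c \<in> A \<Longrightarrow> smooth_on (U c) (velocity c)"
  unfolding velocity_def
  by (rule smooth_onI, rule hdo_linear_compose[OF bounded_linear_snd]) (auto intro: U_smooth smooth_onD)

lemma hloc_smooth:
  assumes c: "c \<in> A"
  shows "smooth_on (U c) (omloc c)" "smooth_on (U c) (hloc c)"
proof -
  note o = U_smooth(1)[OF c]
  have pv: "hdo (U c) (\<lambda>\<zeta>. snd \<zeta> \<bullet> velocity c \<zeta>) k" for k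
    by (intro hdo_inner o hdo_bounded_linear bounded_linear_snd smooth_onD velocity_smooth c)
  have "hdo (U c) (\<lambda>\<zeta>. local_rep TM c L (legendre_inv_chart c \<zeta>)) k" for k
    by (rule hdo_compose[OF o UT_smooth(1)[OF c] _ smooth_onD[OF U_smooth(2)[OF c]] smooth_onD[OF UT_smooth(2)[OF c]]])
      (use legendre_inv_chart(1)[OF c] in blast)
  note hd = hdo_diff[OF o pv this]
  show "smooth_on (U c) (omloc c)"
    by (rule smooth_onI[OF hdo_cong[OF o pv]]) (rule omloc(1)[OF c])
  show "smooth_on (U c) (hloc c)"
    by (rule smooth_onI[OF hdo_cong[OF o hd]]) (rule omloc(2)[OF c])
qed

text \<open>Legendre duality. In the derivative of \<open>p . v - L\<close> the terms with
  \<open>dv\<close> cancel because the fibre gradient of L at the corresponding point is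
  \<open>p\<close>, and in a fibre direction the base coordinates do not move. Only
  \<open>v . dp\<close> remains.\<close>

lemma fibre_grad_hloc:
  assumes c: "c \<in> A" and \<zeta>: "\<zeta> \<in> U c"
  shows "fibre_grad (hloc c) \<zeta> = velocity c \<zeta>"
proof -
  define \<eta> where "\<eta> = legendre_inv_chart c \<zeta>"
  define Di where "Di = frechet (legendre_inv_chart c) (at \<zeta>)"
  note o = U_smooth(1)[OF c] and p = point[OF \<zeta>]
  have dL: "local_rep TM c L differentiable at \<eta>"
    unfolding \<eta>_def by (rule smooth_on_differentiable[OF UT_smooth(2)[OF c] legendre_inv_chart(1)[OF c \<zeta>]])
  have di: "(legendre_inv_chart c has_derivative Di) (at \<zeta>)"
    unfolding Di_def by (rule smooth_on_has_derivative[OF U_smooth(2)[OF c] \<zeta>])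
  have fstDi: "fst (Di w) = fst w" for w
  proof -
    have "((\<lambda>\<zeta>. fst (legendre_inv_chart c \<zeta>)) has_derivative fst) (at \<zeta>)"
      by (rule has_derivative_transform_within_open[OF bounded_linear_imp_has_derivative[OF bounded_linear_fst] o \<zeta>])
        (simp add: legendre_inv_chart(2)[OF c])
    from has_derivative_unique[OF this has_derivative_fst[OF di]] show ?thesis by metis
  qed
  have fibL: "fibre_grad (local_rep TM c L) \<eta> = snd \<zeta>"
  proof -
    let ?w = "ileg (point c \<zeta>)"
    have "snd (bundle_chart TM c) ?w = \<eta>" by (simp add: \<eta>_def legendre_inv_chart_def)
    then have "snd (legendre A L ?w) c = fibre_grad (local_rep TM c L) \<eta>"
      using c ileg(3)[OF p(1)] p(2) by (simp add: legendre_def partial_fibre_def fibre_grad_def)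
    then show ?thesis using ileg(2)[OF p(1)] p(5) by simp
  qed
  have "(hloc c has_derivative (\<lambda>w. snd \<zeta> \<bullet> snd (Di w) + snd w \<bullet> velocity c \<zeta> - frechet (local_rep TM c L) (at \<eta>) (Di w))) (at \<zeta>)"
  proof (rule has_derivative_transform_within_open[OF _ o \<zeta>])
    show "((\<lambda>\<zeta>. snd \<zeta> \<bullet> velocity c \<zeta> - local_rep TM c L (legendre_inv_chart c \<zeta>)) has_derivative
      (\<lambda>w. snd \<zeta> \<bullet> snd (Di w) + snd w \<bullet> velocity c \<zeta> - frechet (local_rep TM c L) (at \<eta>) (Di w))) (at \<zeta>)"
      unfolding velocity_def \<eta>_def
      by (intro has_derivative_diff has_derivative_inner has_derivative_snd has_derivative_ident di
          has_derivative_compose[OF di] has_frechet_derivative dL[unfolded \<eta>_def])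
  qed (simp add: omloc[OF c])
  then have D: "frechet (hloc c) (at \<zeta>) w =
      snd \<zeta> \<bullet> snd (Di w) + snd w \<bullet> velocity c \<zeta> - frechet (local_rep TM c L) (at \<eta>) (fst (Di w), snd (Di w))" for w
    by (simp add: has_derivative_imp_frechet)
  have "frechet (hloc c) (at \<zeta>) (0, b) = velocity c \<zeta> \<bullet> b" for b
    unfolding D frechet_derivative_grads[OF dL] fstDi fibL by (simp add: inner_commute)
  then show ?thesis by (simp add: fibre_grad_def vec_eq_iff inner_vec_axis)
qed

lemma omega_fibre_grad: "c \<in> A \<Longrightarrow> \<zeta> \<in> U c \<Longrightarrow> snd \<zeta> \<bullet> fibre_grad (hloc c) \<zeta> = omloc c \<zeta>"
  by (simp add: omloc fibre_grad_hloc)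

text \<open>By positivity of \<open>\<Omega>\<close> off the zero section, the Legendre image \<open>P\<close> of a zero vector satisfies
  \<open>v \<bullet> P \<ge> 0\<close> for all \<open>v\<close>, so it is zero.\<close>
lemma Omega_cot_pos:
  assumes z: "z \<in> CM" and nz: "snd z \<noteq> zero_vec"
  shows "Om z > 0"
proof -
  define w where "w = ileg z"
  have w: "w \<in> TM" "legendre A L w = z" "fst w = fst z" using ileg[OF z] by (auto simp: w_def)
  obtain c where c: "c \<in> A" "fst w \<in> fst c" using TM_D(2)[OF w(1)] by blast
  have "snd w \<noteq> zero_vec"
  proof
    assume w0: "snd w = zero_vec"
    define x where "x = snd c (fst w)"
    have x0: "(x, 0) \<in> UT c" "tpoint c (x, 0) = w"
      using tpoint_coord[OF c(1) w(1) c(2)] by (simp_all add: w0 zero_vec_def x_def)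
    define P where "P \<zeta> = snd (legendre_chart c c \<zeta>)" for \<zeta>
    have Pc: "continuous_on (UT c) P"
    proof -
      have "{\<zeta> \<in> UT c. fst (tpoint c \<zeta>) \<in> fst c} = UT c" using tpoint(2)[of _ c] by blast
      then have "continuous_on (UT c) (legendre_chart c c)"
        using smooth_on_continuous_on[OF legendre_chart_smooth(2)[OF c(1) c(1)]] by simp
      then show ?thesis unfolding P_def by (intro continuous_intros)
    qed
    have Pz: "P (x, 0) = snd z c" by (simp add: P_def legendre_chart_def x0 w(2) coord_eq)
    \<comment> \<open>At the vector \<open>s *\<^sub>R v\<close> the value of \<Omega> is
      \<open>s\<close> times this pairing, so positivity survives division by
      \<open>s\<close>.\<close>
    have pos: "v \<bullet> P (x, s *\<^sub>R v) > 0" if "s > 0" "v \<noteq> 0" "(x, s *\<^sub>R v) \<in> UT c" for s v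
    proof -
      note t = tpoint[OF that(3)]
      have "snd (tpoint c (x, s *\<^sub>R v)) \<noteq> zero_vec" using t(5) that by (auto simp: zero_vec_def)
      from regularD(5)[OF t(1) this] have "snd (legendre A L (tpoint c (x, s *\<^sub>R v))) c \<bullet> (s *\<^sub>R v) > 0"
        using Omega_chart[OF t(1) c(1) t(2)] t(5) by simp
      then show ?thesis using that(1) by (simp add: P_def legendre_chart_def coord_eq zero_less_mult_iff inner_commute)
    qed
    have nonneg: "v \<bullet> P (x, 0) \<ge> 0" if v: "v \<noteq> 0" for v
    proof (rule tendsto_lowerbound)
      have cl: "continuous_on UNIV (\<lambda>s. (x, s *\<^sub>R v))" by (intro continuous_intros)
      define S where "S = (\<lambda>s. (x, s *\<^sub>R v)) -` UT c"
      have S: "open S" "0 \<in> S" unfolding S_def using cl UT_smooth(1)[OF c(1)] x0 by (auto intro: open_vimage)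
      have "continuous_on S (\<lambda>s. v \<bullet> P (x, s *\<^sub>R v))"
        by (intro continuous_intros continuous_on_compose2[OF Pc]) (auto simp: S_def)
      then have "isCont (\<lambda>s. v \<bullet> P (x, s *\<^sub>R v)) 0" using S continuous_on_eq_continuous_at by blast
      then have "((\<lambda>s. v \<bullet> P (x, s *\<^sub>R v)) \<longlongrightarrow> v \<bullet> P (x, 0)) (at 0)" by (simp add: isCont_def)
      then show "((\<lambda>s. v \<bullet> P (x, s *\<^sub>R v)) \<longlongrightarrow> v \<bullet> P (x, 0)) (at_right 0)"
        by (rule tendsto_within_subset[OF _ subset_UNIV])
      have "eventually (\<lambda>s. s \<in> S) (at_right 0)"
        using eventually_nhds_in_open[OF S] unfolding eventually_at_filter by (rule eventually_mono) simp
      moreover have "eventually (\<lambda>s. s > 0) (at_right (0::real))" by (rule eventually_at_right_less)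
      ultimately show "eventually (\<lambda>s. 0 \<le> v \<bullet> P (x, s *\<^sub>R v)) (at_right 0)"
        by eventually_elim (use pos v in \<open>auto simp: S_def intro: less_imp_le\<close>)
    qed simp
    \<comment> \<open>The test vector is \<open>v = - P (x, 0)\<close>, for which the pairing is
      minus the squared norm.\<close>
    have "P (x, 0) = 0"
    proof (rule ccontr)
      assume "P (x, 0) \<noteq> 0"
      then have "P (x, 0) \<bullet> P (x, 0) > 0" and nz: "- P (x, 0) \<noteq> 0" by simp_all
      moreover have "- (P (x, 0) \<bullet> P (x, 0)) \<ge> 0" using nonneg[OF nz] by (simp only: inner_minus_left)
      ultimately show False by linarith
    qed
    then show False using CM_zero_iff[OF z c(1)] c(2) w(3) nz Pz by simp
  qed
  from regularD(5)[OF w(1) this] show ?thesis by (simp add: Omega_cot_def w_def)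
qed

definition "U0 c = {\<zeta> \<in> U c. snd \<zeta> \<noteq> 0}"

lemma U0_open: "c \<in> A \<Longrightarrow> open (U0 c)"
proof -
  assume c: "c \<in> A"
  have "U0 c = U c \<inter> snd -` (- {0})" by (auto simp: U0_def)
  moreover have "open (snd -` (- {0 :: real^'n}) :: ((real^'n) \<times> (real^'n)) set)"
    by (intro open_vimage continuous_intros)
  ultimately show ?thesis using U_smooth(1)[OF c] by auto
qed

lemma U0_U: "U0 c \<subseteq> U c" by (auto simp: U0_def)

lemma U0_point:
  assumes "c \<in> A" "\<zeta> \<in> U0 c"
  shows "point c \<zeta> \<in> nonzero_part CM" "omloc c \<zeta> > 0"
proof -
  have z: "\<zeta> \<in> U c" "snd \<zeta> \<noteq> 0" using assms by (auto simp: U0_def)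
  have nz: "snd (point c \<zeta>) \<noteq> zero_vec"
    using CM_zero_iff[OF point(1)[OF z(1)] assms(1) point(2)[OF z(1)]] point(5)[OF z(1)] z(2) by simp
  then show "point c \<zeta> \<in> nonzero_part CM" using point(1)[OF z(1)] by (simp add: nonzero_part_def)
  show "omloc c \<zeta> > 0" using Omega_cot_pos[OF point(1)[OF z(1)] nz] by (simp add: omloc_def local_rep_def)
qed

lemma coord_in_U0: "c \<in> A \<Longrightarrow> z \<in> nonzero_part CM \<Longrightarrow> fst z \<in> fst c \<Longrightarrow> coord c z \<in> U0 c"
  unfolding U0_def nonzero_part_def using CM_zero_iff[of z c] coord_in_U[of z c] by (simp add: coord_eq)

section \<open>Derivatives of transition maps and invariance of the dynamics\<close>

lemma chart_derivative_onto:
  assumes c: "c \<in> A" "c' \<in> A" and x: "x \<in> fst c" "x \<in> fst c'"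
  shows "\<exists>u. frechet (transition c c') (at (snd c x)) u = w"
proof -
  \<comment> \<open>The zero covector at \<open>x\<close> lies over the overlap of the two charts,
    so the projection \<open>S\<close> is an open neighbourhood of the coordinates of
    \<open>x\<close>.\<close>
  let ?z = "(x, zero_vec) :: ('a, real^'n) bundle_pt"
  define S where "S = fst ` overlap c' c"
  have zC: "?z \<in> CM" unfolding cotangent_bundle_def using zero_vec_cotangent c(1) x by auto
  have oS: "open S" unfolding S_def by (rule open_image_fst_euclid[OF change_smooth(1)[OF c(2,1)]])
  have "coord c' ?z \<in> overlap c' c"
    using coord_in_U[OF zC] point_coord[OF c(2) zC] x by (simp add: overlap_def)
  then have xS: "snd c' x \<in> S" unfolding S_def by (rule rev_image_eqI) (simp add: coord_eq)
  have tr: "transition c c' (transition c' c y) = y" if yS: "y \<in> S" for y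
  proof -
    obtain \<zeta> where "\<zeta> \<in> overlap c' c" and y: "y = fst \<zeta>"
      using yS unfolding S_def by blast
    then have \<zeta>: "\<zeta> \<in> U c'" "fst (point c' \<zeta>) \<in> fst c" "y = fst \<zeta>"
      by (simp_all add: overlap_def)
    have "inv_into (fst c') (snd c') y = fst (point c' \<zeta>)"
      using inv_into_f_f[OF inj_chart[OF c(2)] point(2)[OF \<zeta>(1)]] point(4)[OF \<zeta>(1)] \<zeta>(3) by simp
    moreover have "inv_into (fst c) (snd c) (snd c (fst (point c' \<zeta>))) = fst (point c' \<zeta>)"
      by (rule inv_into_f_f[OF inj_chart[OF c(1)] \<zeta>(2)])
    ultimately show ?thesis using point(4)[OF \<zeta>(1)] \<zeta>(3) by (simp add: transition_def)
  qed
  have tx: "transition c' c (snd c' x) = snd c x"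
    using inv_into_f_f[OF inj_chart[OF c(2)] x(2)] by (simp add: transition_def)
  have d1: "transition c c' differentiable at (snd c x)" "transition c' c differentiable at (snd c' x)"
    using c x by (intro smooth_on_differentiable[OF transition_smooth]; blast)+
  \<comment> \<open>The two transition maps are inverse to each other near this point, so the
    derivative of one supplies preimages under the derivative of the other.\<close>
  have "((\<lambda>y. transition c c' (transition c' c y)) has_derivative (\<lambda>w. w)) (at (snd c' x))"
    by (rule has_derivative_transform_within_open[OF has_derivative_ident oS xS]) (simp add: tr)
  from has_derivative_imp_frechet[OF this, of w]
  have "frechet (transition c c') (at (snd c x)) (frechet (transition c' c) (at (snd c' x)) w) = w"
    using frechet_derivative_chain[of "transition c c'" "transition c' c" "snd c' x" w] d1 tx by simp
  then show ?thesis by blast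
qed

lemma fst_change_derivative:
  assumes c: "c \<in> A" "c' \<in> A" and \<zeta>: "\<zeta> \<in> overlap c c'"
  shows "fst (frechet (change c c') (at \<zeta>) w) = frechet (transition c c') (at (fst \<zeta>)) (fst w)"
proof -
  note o = change_smooth(1)[OF c]
  have z: "\<zeta> \<in> U c" "fst (point c \<zeta>) \<in> fst c'" using \<zeta> by (auto simp: overlap_def)
  have "fst \<zeta> \<in> snd c ` (fst c \<inter> fst c')"
    using point(2,4)[OF z(1)] z(2) by (intro image_eqI[of _ _ "fst (point c \<zeta>)"]) simp_all
  then have T: "(transition c c' has_derivative frechet (transition c c') (at (fst \<zeta>))) (at (fst \<zeta>))"
    by (rule smooth_on_has_derivative[OF transition_smooth[OF c]])
  have "((\<lambda>\<zeta>. fst (change c c' \<zeta>)) has_derivative (\<lambda>w. frechet (transition c c') (at (fst \<zeta>)) (fst w))) (at \<zeta>)"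
    by (rule has_derivative_transform_within_open[OF has_derivative_compose[OF has_derivative_fst[OF has_derivative_ident] T] o \<zeta>])
      (simp add: change(3)[OF c])
  from has_derivative_unique[OF has_derivative_fst[OF smooth_on_has_derivative[OF change_smooth(2)[OF c] \<zeta>]] this]
  show ?thesis by metis
qed

end

locale regular_system_field = regular_system X A L
  for X :: "'a topology" and A :: "('a, real^'n) chart set" and L :: "('a, real^'n) bundle_pt \<Rightarrow> real" +
  fixes Q :: "('a, real^'n) bundle_pt \<Rightarrow> ('a, real^'n) components"
  assumes field: "extended_covector_field A Q"
begin

definition "qloc c \<zeta> = Q (point c \<zeta>) c"

lemma qloc_smooth:
  assumes c: "c \<in> A"
  shows "smooth_on (U c) (qloc c)"
proof -
  have sb: "smooth_between (bundle_atlas A CM) {z \<in> CM. fst z \<in> fst c} std_atlas UNIV (\<lambda>z. Q z c)"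
    using field c by (simp add: extended_covector_field_def Let_def)
  have e: "fst (bundle_chart CM c) \<inter> {z \<in> CM. fst z \<in> fst c} \<inter> (\<lambda>z. Q z c) -` fst (UNIV, id) = fst (bundle_chart CM c)"
    by (auto simp: bundle_chart_def)
  have "(UNIV, id) \<in> std_atlas" by (simp add: std_atlas_def)
  from smooth_betweenD(2)[OF sb bundle_chart_in_atlas[OF c] this]
  show ?thesis unfolding e U_def qloc_def[abs_def] by (simp add: o_def)
qed

abbreviation "dyn c \<equiv> dynamics (hloc c) (omloc c) (qloc c)"

lemma dyn_smooth:
  assumes c: "c \<in> A"
  shows "smooth_on (U0 c) (dyn c)"
proof (rule smooth_on_dynamics[OF U0_open[OF c]])
  show "omloc c z \<noteq> 0" if "z \<in> U0 c" for z using U0_point(2)[OF c that] by simp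
qed (rule smooth_on_subset[OF _ U0_U], rule hloc_smooth[OF c] qloc_smooth[OF c])+

text \<open>Invariance of Hamilton's equations under the lifted coordinate change, by differentiating the
  transformation law of covectors; it uses the symmetry of the second derivative of the transition map.\<close>
lemma change_dynamics:
  assumes c: "c \<in> A" "c' \<in> A" and \<zeta>: "\<zeta> \<in> overlap c c'" and nz: "snd \<zeta> \<noteq> 0"
  shows "frechet (change c c') (at \<zeta>) (dyn c \<zeta>) = dyn c' (change c c' \<zeta>)"
proof -
  define T where "T = transition c c'"
  define DT where "DT x u = frechet T (at x) u" for x u
  define \<Phi> where "\<Phi> = change c c'"
  define D where "D = frechet \<Phi> (at \<zeta>)"
  define S where "S = fst ` overlap c c'"
  define x where "x = fst \<zeta>"
  define D2 where "D2 a u = frechet (\<lambda>y. DT y u) (at x) a" for a u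
  note o = change_smooth(1)[OF c] and ch = change[OF c, folded T_def, folded DT_def \<Phi>_def]
  have zU: "\<zeta> \<in> U c" and z': "fst (point c \<zeta>) \<in> fst c'" using \<zeta> by (auto simp: overlap_def)
  have xS: "x \<in> S" unfolding S_def x_def using \<zeta> by blast
  have oS: "open S" unfolding S_def by (rule open_image_fst_euclid[OF o])
  have Ssub: "S \<subseteq> snd c ` (fst c \<inter> fst c')"
  proof
    fix y assume "y \<in> S"
    then obtain \<xi> where "\<xi> \<in> overlap c c'" and y: "y = fst \<xi>" unfolding S_def by blast
    then have "\<xi> \<in> U c" "fst (point c \<xi>) \<in> fst c'" by (simp_all add: overlap_def)
    then show "y \<in> snd c ` (fst c \<inter> fst c')"
      using point(2,4)[of \<xi> c] by (intro image_eqI[of _ _ "fst (point c \<xi>)"]) (simp_all add: y)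
  qed
  have Ts: "smooth_on S T" unfolding T_def by (rule smooth_on_subset[OF transition_smooth[OF c] Ssub])
  have DTlin: "linear (DT x)"
    unfolding DT_def by (rule linear_frechet_derivative[OF smooth_on_differentiable[OF Ts xS]])
  have D2: "((\<lambda>y. DT y u) has_derivative (\<lambda>a. D2 a u)) (at x)" for u
    unfolding D2_def DT_def by (rule smooth_on_has_derivative[OF smooth_on_derivative[OF Ts] xS])
  have D2sym: "D2 a u = D2 u a" for a u
    unfolding D2_def DT_def by (rule symmetric_second_derivative[OF oS xS Ts])
  have onto: "\<exists>u. DT x u = w" for w
    using chart_derivative_onto[OF c point(2)[OF zU] z', of w] point(4)[OF zU] by (simp add: DT_def T_def x_def)
  have dPhi: "(\<Phi> has_derivative D) (at \<zeta>)"
    unfolding D_def \<Phi>_def by (rule smooth_on_has_derivative[OF change_smooth(2)[OF c] \<zeta>])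
  have fstD: "fst (D w) = DT x (fst w)" for w
    using fst_change_derivative[OF c \<zeta>] by (simp add: D_def \<Phi>_def DT_def T_def x_def)
  \<comment> \<open>The covector law \<open>p . u = p' . DT x u\<close>, valid on the whole open
    overlap, is differentiated in direction \<open>w\<close> with \<open>u\<close> fixed;
    \<open>D2\<close> records the dependence of \<open>DT\<close> on the base point.\<close>
  have law: "snd w \<bullet> u = snd (D w) \<bullet> DT x u + snd (\<Phi> \<zeta>) \<bullet> D2 (fst w) u" for w u
  proof -
    have "((\<lambda>\<zeta>. snd (\<Phi> \<zeta>) \<bullet> DT (fst \<zeta>) u) has_derivative
        (\<lambda>w. snd (\<Phi> \<zeta>) \<bullet> D2 (fst w) u + snd (D w) \<bullet> DT (fst \<zeta>) u)) (at \<zeta>)"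
      by (rule has_derivative_inner[OF has_derivative_snd[OF dPhi]
          has_derivative_compose[OF has_derivative_fst[OF has_derivative_ident] D2[unfolded x_def]]])
    moreover have "((\<lambda>\<zeta>. snd (\<Phi> \<zeta>) \<bullet> DT (fst \<zeta>) u) has_derivative (\<lambda>w. snd w \<bullet> u)) (at \<zeta>)"
      by (rule has_derivative_transform_within_open[OF has_derivative_inner_left[OF has_derivative_snd[OF has_derivative_ident]] o \<zeta>])
        (simp add: ch(4))
    ultimately have "(\<lambda>w. snd (\<Phi> \<zeta>) \<bullet> D2 (fst w) u + snd (D w) \<bullet> DT (fst \<zeta>) u) = (\<lambda>w. snd w \<bullet> u)"
      by (rule has_derivative_unique)
    from fun_cong[OF this, of w] show ?thesis by (simp add: x_def)
  qed
  have P': "\<Phi> \<zeta> \<in> U c'" by (rule ch(1)[OF \<zeta>])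
  have omeq: "omloc c' (\<Phi> \<zeta>) = omloc c \<zeta>" by (simp add: omloc_def local_rep_def ch(2)[OF \<zeta>])
  have dh: "frechet (hloc c) (at \<zeta>) w = frechet (hloc c') (at (\<Phi> \<zeta>)) (D w)" for w
  proof -
    have d': "(hloc c' has_derivative frechet (hloc c') (at (\<Phi> \<zeta>))) (at (\<Phi> \<zeta>))"
      by (rule smooth_on_has_derivative[OF hloc_smooth(2)[OF c(2)] P'])
    have "(hloc c has_derivative (\<lambda>w. frechet (hloc c') (at (\<Phi> \<zeta>)) (D w))) (at \<zeta>)"
      by (rule has_derivative_transform_within_open[OF has_derivative_compose[OF dPhi d'] o \<zeta>])
        (simp add: hloc_def local_rep_def ch(2))
    then show ?thesis by (rule has_derivative_imp_frechet)
  qed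
  have dh2: "base_grad (hloc c) \<zeta> \<bullet> fst w + fibre_grad (hloc c) \<zeta> \<bullet> snd w
      = base_grad (hloc c') (\<Phi> \<zeta>) \<bullet> DT x (fst w) + fibre_grad (hloc c') (\<Phi> \<zeta>) \<bullet> snd (D w)" for w
  proof -
    have "frechet (hloc c') (at (\<Phi> \<zeta>)) (D w)
        = base_grad (hloc c') (\<Phi> \<zeta>) \<bullet> DT x (fst w) + fibre_grad (hloc c') (\<Phi> \<zeta>) \<bullet> snd (D w)"
      using frechet_derivative_grads[OF smooth_on_differentiable[OF hloc_smooth(2)[OF c(2)] P'],
          of "fst (D w)" "snd (D w)", unfolded prod.collapse] by (simp only: fstD)
    then show ?thesis
      using frechet_derivative_grads[OF smooth_on_differentiable[OF hloc_smooth(2)[OF c(1)] zU],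
          of "fst w" "snd w", unfolded prod.collapse] by (simp only: dh)
  qed
  have D20: "D2 0 u = 0" for u
    using linear_0[OF has_derivative_linear[OF D2[of u]]] .
  \<comment> \<open>Fibre gradients transform as vectors, by duality with the fibre part of
    \<open>D\<close>. Since that part is onto, \<open>b\<close> can be chosen so that the difference
    \<open>?d\<close> is its image; \<open>?d\<close> is then orthogonal to itself.\<close>
  have V: "fibre_grad (hloc c') (\<Phi> \<zeta>) = DT x (fibre_grad (hloc c) \<zeta>)"
  proof -
    let ?d = "fibre_grad (hloc c') (\<Phi> \<zeta>) - DT x (fibre_grad (hloc c) \<zeta>)"
    have Dlin: "linear D" using dPhi by (rule has_derivative_linear)
    have lin: "linear (\<lambda>b. snd (D (0, b)))"
      using linear_compose[OF linear_compose[of "\<lambda>b. (0, b)" D] linear_snd] Dlin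
      by (simp add: o_def linear_iff)
    have "inj (\<lambda>b. snd (D (0, b)))"
    proof (subst linear_injective_0[OF lin], intro allI impI)
      fix b assume "snd (D (0, b)) = 0"
      then have "b \<bullet> b = 0" using law[of "(0, b)" b] by (simp add: D20)
      then show "b = 0" by simp
    qed
    then have "surj (\<lambda>b. snd (D (0, b)))" by (rule linear_injective_imp_surjective[OF lin _ refl])
    then obtain b where b: "?d = snd (D (0, b))" by (rule surjE)
    have "fibre_grad (hloc c) \<zeta> \<bullet> b = fibre_grad (hloc c') (\<Phi> \<zeta>) \<bullet> snd (D (0, b))"
      using dh2[of "(0, b)"] linear_0[OF DTlin] by simp
    moreover have "b \<bullet> fibre_grad (hloc c) \<zeta> = snd (D (0, b)) \<bullet> DT x (fibre_grad (hloc c) \<zeta>)"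
      using law[of "(0, b)" "fibre_grad (hloc c) \<zeta>"] by (simp add: D20)
    ultimately have "?d \<bullet> snd (D (0, b)) = 0" by (simp add: inner_diff_left inner_diff_right inner_commute)
    then show ?thesis using b by simp
  qed
  have q: "qloc c \<zeta> \<bullet> u = qloc c' (\<Phi> \<zeta>) \<bullet> DT x u" for u
    unfolding qloc_def ch(2)[OF \<zeta>]
    using cotangent_transform[OF _ c point(2)[OF zU] z', of "Q (point c \<zeta>)" u] field point(1)[OF zU] point(4)[OF zU]
    by (simp add: extended_covector_field_def Let_def DT_def T_def x_def)
  have D2scale: "D2 (k *\<^sub>R a) u = k *\<^sub>R D2 a u" for k a u
    using linear_scale[OF has_derivative_linear[OF D2[of u]]] .
  show ?thesis
  proof (rule prod_eqI)
    show "fst (frechet (change c c') (at \<zeta>) (dyn c \<zeta>)) = fst (dyn c' (change c c' \<zeta>))"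
      unfolding \<Phi>_def[symmetric] D_def[symmetric] fstD
      by (simp add: dynamics_def V omeq linear_scale[OF DTlin])
    \<comment> \<open>Testing on the vectors \<open>DT x u\<close> suffices, as they exhaust all
      vectors.\<close>
    have "snd (D (dyn c \<zeta>)) \<bullet> DT x u = snd (dyn c' (\<Phi> \<zeta>)) \<bullet> DT x u" for u
    proof -
      let ?V = "fibre_grad (hloc c) \<zeta>" and ?o = "omloc c \<zeta>"
      have "snd (D (dyn c \<zeta>)) \<bullet> DT x u = snd (dyn c \<zeta>) \<bullet> u - (1 / ?o) * (snd (\<Phi> \<zeta>) \<bullet> D2 ?V u)"
        using law[of "dyn c \<zeta>" u] by (simp add: dynamics_def D2scale)
      also have "snd (dyn c \<zeta>) \<bullet> u = qloc c \<zeta> \<bullet> u - (1 / ?o) * (base_grad (hloc c) \<zeta> \<bullet> u)"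
        by (simp add: dynamics_def inner_diff_left)
      also have "base_grad (hloc c) \<zeta> \<bullet> u = base_grad (hloc c') (\<Phi> \<zeta>) \<bullet> DT x u + snd (D (u, 0)) \<bullet> DT x ?V"
        using dh2[of "(u, 0)"] V by (simp add: inner_commute)
      \<comment> \<open>By symmetry of \<open>D2\<close> this cancels the second derivative term
        that \<open>law\<close> contributed for the direction \<open>dyn c \<zeta>\<close>.\<close>
      also have "snd (D (u, 0)) \<bullet> DT x ?V = - (snd (\<Phi> \<zeta>) \<bullet> D2 ?V u)"
        using law[of "(u, 0)" ?V] D2sym[of u ?V] by simp
      also have "qloc c \<zeta> \<bullet> u - (1 / ?o) * (base_grad (hloc c') (\<Phi> \<zeta>) \<bullet> DT x u + - (snd (\<Phi> \<zeta>) \<bullet> D2 ?V u))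
          - (1 / ?o) * (snd (\<Phi> \<zeta>) \<bullet> D2 ?V u) = snd (dyn c' (\<Phi> \<zeta>)) \<bullet> DT x u"
        unfolding q by (simp add: dynamics_def omeq inner_diff_left right_diff_distrib diff_divide_distrib)
      finally show ?thesis .
    qed
    then have "snd (D (dyn c \<zeta>)) \<bullet> w = snd (dyn c' (\<Phi> \<zeta>)) \<bullet> w" for w
      using onto[of w] by metis
    then show "snd (frechet (change c c') (at \<zeta>) (dyn c \<zeta>)) = snd (dyn c' (change c c' \<zeta>))"
      unfolding \<Phi>_def[symmetric] D_def[symmetric] using vector_eq_rdot by blast
  qed
qed

end

section \<open>Weak normality at a point\<close>

text \<open>Contraction over the lower index of P subtracts a multiple of \<open>v\<close>, and in
  \<open>contract_second\<close> contraction over the upper index subtracts a multiple of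
  \<open>p\<close>. The results have the shape of the two proportionality conditions in
  \<open>normality_algebra\<close>.\<close>

lemma contract_first:
  fixes f :: "'n::finite \<Rightarrow> 'n \<Rightarrow> real"
  shows "(\<Sum>r\<in>UNIV. \<Sum>s\<in>UNIV. f r s * ((if q = r then 1 else 0) - v q * p r / c))
    = (\<Sum>s\<in>UNIV. f q s) - (\<Sum>r\<in>UNIV. (\<Sum>s\<in>UNIV. f r s) * p r) * v q / c"
proof -
  have "(\<Sum>r\<in>UNIV. \<Sum>s\<in>UNIV. f r s * ((if q = r then 1 else 0) - v q * p r / c))
    = (\<Sum>r\<in>UNIV. (if q = r then \<Sum>s\<in>UNIV. f r s else 0) - (\<Sum>s\<in>UNIV. f r s) * p r * (v q / c))"
    unfolding sum_distrib_right[symmetric] by (intro sum.cong refl) (simp add: algebra_simps)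
  then show ?thesis
    by (simp add: sum_subtractf sum_distrib_right[symmetric] del: times_divide_eq_right) simp
qed

lemma contract_second:
  fixes f :: "'n::finite \<Rightarrow> 'n \<Rightarrow> real"
  shows "(\<Sum>r\<in>UNIV. \<Sum>s\<in>UNIV. f r s * ((if r = q then 1 else 0) - v r * p q / c))
    = (\<Sum>s\<in>UNIV. f q s) - (\<Sum>r\<in>UNIV. (\<Sum>s\<in>UNIV. f r s) * v r / c) * p q"
proof -
  have "(\<Sum>r\<in>UNIV. \<Sum>s\<in>UNIV. f r s * ((if r = q then 1 else 0) - v r * p q / c))
    = (\<Sum>r\<in>UNIV. (if r = q then \<Sum>s\<in>UNIV. f r s else 0) - (\<Sum>s\<in>UNIV. f r s) * v r / c * p q)"
    unfolding sum_distrib_right[symmetric] by (intro sum.cong refl) (simp add: algebra_simps)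
  then show ?thesis
    by (simp add: sum_subtractf sum_distrib_right[symmetric] del: times_divide_eq_left times_divide_eq_right)
qed

lemma normality_equations_algebra:
  fixes v p hb ofb obs Q :: "'n::finite \<Rightarrow> real" and Qf Qb :: "'n \<Rightarrow> 'n \<Rightarrow> real" and c :: real
    and G :: "'n \<Rightarrow> 'n \<Rightarrow> 'n \<Rightarrow> real"
  assumes c: "(\<Sum>i\<in>UNIV. p i * v i) = c" "c \<noteq> 0" and sym: "\<And>k i j. G k i j = G k j i"
  defines "m \<equiv> \<Sum>r\<in>UNIV. obs r * (v r / c) + ofb r * (Q r - hb r / c)"
  shows "(\<exists>a b. \<forall>\<tau> \<xi>. m / c\<^sup>2 * (\<Sum>i\<in>UNIV. hb i * \<tau> i + v i * \<xi> i)
        - (\<Sum>s\<in>UNIV. v s * (\<Sum>r\<in>UNIV. Qb r s * \<tau> r + Qf r s * \<xi> r)) / c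
        - (\<Sum>i\<in>UNIV. obs i * \<tau> i + ofb i * \<xi> i) / c\<^sup>2 * (\<Sum>s\<in>UNIV. v s * Q s)
        + (\<Sum>s\<in>UNIV. (\<Sum>r\<in>UNIV. Qb r s * (v r / c) + Qf r s * (Q r - hb r / c)) * \<tau> s)
      = a * ((\<Sum>s\<in>UNIV. Q s * \<tau> s) - (\<Sum>i\<in>UNIV. hb i * \<tau> i + v i * \<xi> i) / c) + b * (\<Sum>s\<in>UNIV. p s * \<tau> s))
    \<longleftrightarrow> (\<forall>q.
      (\<Sum>r\<in>UNIV. \<Sum>s\<in>UNIV. v s / c * (Qf r s + ofb r / c * Q s) * ((if q = r then 1 else 0) - v q * p r / c)) = 0 \<and>
      (\<Sum>r\<in>UNIV. \<Sum>s\<in>UNIV.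
         (((Qb s r + (\<Sum>a\<in>UNIV. \<Sum>b\<in>UNIV. p a * G a s b * Qf b r) - (\<Sum>b\<in>UNIV. G b s r * Q b))
           + (obs s + (\<Sum>a\<in>UNIV. \<Sum>b\<in>UNIV. p a * G a s b * ofb b)) / c * Q r
           - (Qb r s + (\<Sum>a\<in>UNIV. \<Sum>b\<in>UNIV. p a * G a r b * Qf b s) - (\<Sum>b\<in>UNIV. G b r s * Q b))
           - (obs r + (\<Sum>a\<in>UNIV. \<Sum>b\<in>UNIV. p a * G a r b * ofb b)) / c * Q s) * (v s / c)
          + (\<Sum>m\<in>UNIV.
               ((hb r + (\<Sum>a\<in>UNIV. \<Sum>b\<in>UNIV. p a * G a r b * v b)) / c - Q r) *
               (Qf m s + ofb m / c * Q s) * (v s / c) * p m)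
          - ((hb s + (\<Sum>a\<in>UNIV. \<Sum>b\<in>UNIV. p a * G a s b * v b)) / c - Q s) * (Qf s r + ofb s / c * Q r))
         * ((if r = q then 1 else 0) - v r * p q / c)) = 0)"
proof -
  define B where "B r = (\<Sum>s\<in>UNIV. v s / c * (Qf r s + ofb r / c * Q s))" for r
  define \<kappa> where "\<kappa> = (\<Sum>r\<in>UNIV. B r * p r)"
  show ?thesis
    unfolding m_def normality_algebra[OF c] contract_first[where v = v and p = p and c = c]
      contract_second[where v = v and p = p and c = c]
      connection_terms[where v = v and p = p and c = c and G = G and Q = Q and Qf = Qf and Qb = Qb and hb = hb and ofb = ofb and obs = obs, OF sym]
      all_conj_distrib right_minus_eq B_def[symmetric] \<kappa>_def[symmetric]
    \<comment> \<open>The second equations are compared under the first one, which makes every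
      factor \<open>B b - \<kappa> * v b / c\<close> vanish and with it the whole contribution of
      \<open>G\<close>.\<close>
    by (rule conj_cong[OF refl]) (simp only: diff_self mult_zero_right sum.neutral_const diff_zero)
qed

section \<open>Trajectories and deviation functions on the manifold\<close>

context regular_system_field
begin

text \<open>The image lies in one chart, and every other chart sees it through the smooth map
  \<open>change\<close>.\<close>

lemma smooth_between_from_chart:
  fixes g :: "'s::euclidean_space \<Rightarrow> (real^'n) \<times> (real^'n)"
  assumes c: "c \<in> A" and S: "open S" and g: "smooth_on S g" "\<And>s. s \<in> S \<Longrightarrow> g s \<in> U0 c"
  shows "smooth_between std_atlas S (bundle_atlas A CM) (nonzero_part CM) (\<lambda>s. point c (g s))"
  unfolding smooth_between_def
proof (intro conjI ballI)
  show "(\<lambda>s. point c (g s)) ` S \<subseteq> nonzero_part CM" using U0_point(1)[OF c g(2)] by blast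
  fix k :: "('s, 's) chart" and d
  assume "k \<in> std_atlas" "d \<in> bundle_atlas A CM"
  then obtain c' where k: "k = (UNIV, id)" and d: "d = bundle_chart CM c'" and c': "c' \<in> A"
    unfolding std_atlas_def bundle_atlas_def by blast
  have gU: "g s \<in> U c" if "s \<in> S" for s using g(2)[OF that] U0_U by blast
  let ?N = "S \<inter> g -` overlap c c'"
  have e: "snd k ` (fst k \<inter> S \<inter> (\<lambda>s. point c (g s)) -` fst d) = ?N"
    unfolding k d by (auto simp: fst_bundle_chart overlap_def gU point(1)[OF gU])
  have op: "open ?N"
    by (rule continuous_open_preimage[OF smooth_on_continuous_on[OF g(1)] S change_smooth(1)[OF c c']])
  have "smooth_on ?N (\<lambda>s. change c c' (g s))"
    by (rule smooth_on_compose[OF smooth_on_subset[OF g(1)] change_smooth(2)[OF c c'] op change_smooth(1)[OF c c']]) auto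
  moreover have "snd d \<circ> (\<lambda>s. point c (g s)) \<circ> inv_into (fst k) (snd k) = (\<lambda>s. change c c' (g s))"
    by (simp add: k d fun_eq_iff change_def)
  ultimately show "open (snd k ` (fst k \<inter> S \<inter> (\<lambda>s. point c (g s)) -` fst d))"
    "smooth_on (snd k ` (fst k \<inter> S \<inter> (\<lambda>s. point c (g s)) -` fst d))
        (snd d \<circ> (\<lambda>s. point c (g s)) \<circ> inv_into (fst k) (snd k))"
    unfolding e using op by simp_all
qed

lemma equations_of_motion:
  assumes c: "c \<in> A" and z: "z \<in> CM" "fst z \<in> fst c"
  shows "((\<chi> i. 1 / Om z * partial_fibre CM c i Ham z),
          (\<chi> i. - (1 / Om z) * partial_base CM c i Ham z + Q z c $ i)) = dyn c (coord c z)"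
  using point_coord[OF c z]
  by (simp add: dynamics_def fibre_grad_def base_grad_def hloc_def omloc_def qloc_def partial_fibre_def partial_base_def
      local_rep_def vec_eq_iff)

text \<open>The equations hold in the chart \<open>c\<close> and are required in all charts;
  \<open>change_dynamics\<close> carries the velocity over.\<close>

lemma trajectory_from_chart:
  assumes c: "c \<in> A" and I: "open I" "is_interval I" and g: "smooth_on I g" "\<And>t. t \<in> I \<Longrightarrow> g t \<in> U0 c"
    and ode: "\<And>t. t \<in> I \<Longrightarrow> (g has_vector_derivative dyn c (g t)) (at t)"
  shows "trajectory A Ham Om Q I (\<lambda>t. point c (g t))"
  unfolding trajectory_def Let_def
proof (intro conjI ballI impI I smooth_between_from_chart[OF c I(1) g])
  fix t c' assume t: "t \<in> I" and c': "c' \<in> A" and m: "fst (point c (g t)) \<in> fst c'"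
  have gU: "g t \<in> U c" "snd (g t) \<noteq> 0" using g(2)[OF t] by (auto simp: U0_def)
  have ov: "g t \<in> overlap c c'" using gU m by (simp add: overlap_def)
  have "((\<lambda>s. change c c' (g s)) has_vector_derivative
      frechet (change c c') (at (g t)) (dyn c (g t))) (at t)"
    by (rule has_vector_derivative_chain[OF ode[OF t] smooth_on_has_derivative[OF change_smooth(2)[OF c c'] ov]])
  then show "((\<lambda>s. (snd c' (fst (point c (g s))), snd (point c (g s)) c')) has_vector_derivative
          ((\<chi> i. 1 / Om (point c (g t)) * partial_fibre CM c' i Ham (point c (g t))),
           (\<chi> i. - (1 / Om (point c (g t))) * partial_base CM c' i Ham (point c (g t)) +
                  Q (point c (g t)) c' $ i))) (at t)"
    unfolding equations_of_motion[OF c' point(1)[OF gU(1)] m] change_dynamics[OF c c' ov gU(2)]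
    by (simp add: change_def coord_eq)
qed

lemma trajectory_in_chart:
  assumes tr: "trajectory A Ham Om Q I \<gamma>" and t: "t \<in> I"
    and c: "c \<in> A" "fst (\<gamma> t) \<in> fst c"
  shows "open I" "\<gamma> t \<in> nonzero_part CM"
    "((\<lambda>s. coord c (\<gamma> s)) has_vector_derivative dyn c (coord c (\<gamma> t))) (at t)"
proof -
  show "open I" and nz: "\<gamma> t \<in> nonzero_part CM"
    using tr t by (auto simp: trajectory_def Let_def smooth_between_def)
  have z: "\<gamma> t \<in> CM" using nz by (simp add: nonzero_part_def)
  have "((\<lambda>s. (snd c (fst (\<gamma> s)), snd (\<gamma> s) c)) has_vector_derivative
          ((\<chi> i. 1 / Om (\<gamma> t) * partial_fibre CM c i Ham (\<gamma> t)),
           (\<chi> i. - (1 / Om (\<gamma> t)) * partial_base CM c i Ham (\<gamma> t) + Q (\<gamma> t) c $ i))) (at t)"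
    using tr t c unfolding trajectory_def Let_def by blast
  then show "((\<lambda>s. coord c (\<gamma> s)) has_vector_derivative dyn c (coord c (\<gamma> t))) (at t)"
    unfolding equations_of_motion[OF c(1) z c(2)] by (simp add: coord_eq)
qed

lemma local_data:
  assumes c: "c \<in> A"
  shows "open (U0 c)" "smooth_on (U0 c) (hloc c)" "smooth_on (U0 c) (omloc c)" "smooth_on (U0 c) (qloc c)"
    "\<And>z. z \<in> U0 c \<Longrightarrow> omloc c z \<noteq> 0" "\<And>z. z \<in> U0 c \<Longrightarrow> snd z \<bullet> fibre_grad (hloc c) z = omloc c z"
proof -
  show "omloc c z \<noteq> 0" "snd z \<bullet> fibre_grad (hloc c) z = omloc c z" if "z \<in> U0 c" for z
    using U0_point(2)[OF c that] omega_fibre_grad[OF c subsetD[OF U0_U that]] by simp_all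
qed (rule U0_open[OF c] smooth_on_subset[OF hloc_smooth(2)[OF c] U0_U] smooth_on_subset[OF hloc_smooth(1)[OF c] U0_U]
    smooth_on_subset[OF qloc_smooth[OF c] U0_U])+

abbreviation "rate c \<equiv> dev_rate (hloc c) (omloc c) (qloc c)"
abbreviation "accel c \<equiv> dev_accel (hloc c) (omloc c) (qloc c)"

lemma deviation_in_chart:
  assumes dev: "deviation_function A Ham Om Q I \<gamma> \<phi>" and t: "t \<in> I"
    and c: "c \<in> A" "fst (\<gamma> t) \<in> fst c"
  obtains w where "\<phi> t = snd (coord c (\<gamma> t)) \<bullet> fst w" "deriv \<phi> t = rate c (coord c (\<gamma> t)) w"
    "deriv (deriv \<phi>) t = accel c (coord c (\<gamma> t)) w"
proof -
  obtain e F where e: "e > 0"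
    and F: "smooth_between std_atlas (I \<times> {-e<..<e}) (bundle_atlas A CM) (nonzero_part CM) F"
    and tr: "\<And>y. y \<in> {-e<..<e} \<Longrightarrow> trajectory A Ham Om Q I (\<lambda>t. F (t, y))"
    and F0: "\<And>t. t \<in> I \<Longrightarrow> F (t, 0) = \<gamma> t"
    and phi: "\<And>t c. t \<in> I \<Longrightarrow> c \<in> A \<Longrightarrow> fst (\<gamma> t) \<in> fst c \<Longrightarrow>
       \<phi> t = (\<Sum>s\<in>UNIV. snd (\<gamma> t) c $ s * vector_derivative (\<lambda>y. snd c (fst (F (t, y)))) (at 0) $ s)"
    using dev unfolding deviation_function_def Let_def by blast
  \<comment> \<open>The family need not stay in the chart for all times and parameters.
    \<open>N\<close> is the open set of parameters where it does, and it contains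
    \<open>(t, 0)\<close>.\<close>
  define N where "N = (I \<times> {-e<..<e}) \<inter> F -` fst (bundle_chart CM c)"
  define f where "f z = coord c (F z)" for z
  have st: "(UNIV, id) \<in> std_atlas" by (simp add: std_atlas_def)
  have Ne: "snd (UNIV, id) ` (fst (UNIV, id) \<inter> I \<times> {-e<..<e} \<inter> F -` fst (bundle_chart CM c)) = N"
    by (simp add: N_def)
  have fe: "coord c \<circ> F \<circ> inv_into (fst (UNIV, id)) (snd (UNIV, id)) = f"
    by (simp add: f_def fun_eq_iff)
  have N: "open N" and fs: "smooth_on N f"
    using smooth_betweenD[OF F st bundle_chart_in_atlas[OF c(1)]] unfolding Ne fe by blast+
  have FN: "t \<in> I" "y \<in> {-e<..<e}" "F (t, y) \<in> nonzero_part CM" "F (t, y) \<in> CM" "fst (F (t, y)) \<in> fst c" if "(t, y) \<in> N" for t y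
  proof -
    show ty: "t \<in> I" "y \<in> {-e<..<e}" using that by (auto simp: N_def)
    have "F (t, y) \<in> fst (bundle_chart CM c)" using that by (simp add: N_def)
    then show "F (t, y) \<in> CM" "fst (F (t, y)) \<in> fst c" by (simp_all add: fst_bundle_chart)
    show "F (t, y) \<in> nonzero_part CM" using F ty unfolding smooth_between_def by blast
  qed
  have fU: "f ` N \<subseteq> U0 c"
  proof
    fix \<zeta> assume "\<zeta> \<in> f ` N"
    then obtain s y where "(s, y) \<in> N" "\<zeta> = f (s, y)" by (metis imageE surj_pair)
    then show "\<zeta> \<in> U0 c" using coord_in_U0[OF c(1) FN(3,5)] by (simp add: f_def)
  qed
  have ode: "((\<lambda>t. f (t, y)) has_vector_derivative dyn c (f (t, y))) (at t)" if "(t, y) \<in> N" for t y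
    unfolding f_def by (rule trajectory_in_chart(3)[OF tr[OF FN(2)[OF that]] FN(1)[OF that] c(1) FN(5)[OF that]])
  have ph: "\<phi> t = snd (f (t, 0)) \<bullet> fst (frechet f (at (t, 0)) (0, 1))" if "(t, 0) \<in> N" for t
  proof -
    note fn = FN[OF that]
    have "((\<lambda>y. f (t, y)) has_vector_derivative frechet f (at (t, 0)) (0, 1)) (at 0)"
      by (rule has_vector_derivative_chain[OF has_vector_derivative_snd_const smooth_on_has_derivative[OF fs that]])
    from bounded_linear.has_vector_derivative[OF bounded_linear_fst this]
    have "vector_derivative (\<lambda>y. snd c (fst (F (t, y)))) (at 0) = fst (frechet f (at (t, 0)) (0, 1))"
      by (intro vector_derivative_at) (simp add: f_def coord_eq)
    then show ?thesis
      using phi[OF fn(1) c(1)] fn(5) F0[OF fn(1)] by (simp add: inner_vec_def f_def coord_eq)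
  qed
  have tN: "(t, 0) \<in> N"
  proof -
    have "F (t, 0) \<in> nonzero_part CM" using F t e unfolding smooth_between_def by auto
    then show ?thesis using t e c(2) F0[OF t] by (simp add: N_def fst_bundle_chart nonzero_part_def)
  qed
  have ft: "f (t, 0) = coord c (\<gamma> t)" by (simp add: f_def F0[OF t])
  show ?thesis
    using that[of "frechet f (at (t, 0)) (0, 1)"] ph[OF tN]
      deviation_derivatives[OF local_data[OF c(1)] N fs fU ode ph tN] unfolding ft by blast
qed

text \<open>On one trajectory every variation \<open>w\<close> at time 0 occurs. An equation shared
  by all deviation functions therefore becomes an identity of functionals in
  \<open>w\<close>.\<close>

lemma deviation_through_point:
  assumes z: "z \<in> nonzero_part CM" and c: "c \<in> A" "fst z \<in> fst c"
  obtains I \<gamma> where "trajectory A Ham Om Q I \<gamma>" "0 \<in> I"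
    "\<And>w. \<exists>\<phi>. deviation_function A Ham Om Q I \<gamma> \<phi> \<and>
       \<phi> 0 = snd (coord c z) \<bullet> fst w \<and> deriv \<phi> 0 = rate c (coord c z) w \<and> deriv (deriv \<phi>) 0 = accel c (coord c z) w"
proof -
  define \<zeta> where "\<zeta> = coord c z"
  have \<zeta>: "\<zeta> \<in> U0 c" unfolding \<zeta>_def by (rule coord_in_U0[OF c(1) z c(2)])
  obtain d \<gamma> where d: "d > 0" and flow: "\<And>w. \<exists>e>0. \<exists>F. smooth_on (obox2 d e) F \<and> F ` obox2 d e \<subseteq> U0 c \<and>
      (\<forall>t y. (t, y) \<in> obox2 d e \<longrightarrow> ((\<lambda>t. F (t, y)) has_vector_derivative dyn c (F (t, y))) (at t)) \<and>
      (\<forall>y\<in>{-e<..<e}. F (0, y) = \<zeta> + y *\<^sub>R w) \<and> (\<forall>t\<in>{-d<..<d}. F (t, 0) = \<gamma> t)"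
    using smooth_local_flow[OF U0_open[OF c(1)] \<zeta> dyn_smooth[OF c(1)]] by blast
  define I where "I = {-d<..<d}"
  have I: "open I" "is_interval I" "0 \<in> I" using d by (auto simp: I_def)
  define g where "g t = point c (\<gamma> t)" for t
  have family: "\<exists>e>0. \<exists>F. smooth_on (I \<times> {-e<..<e}) F \<and> F ` (I \<times> {-e<..<e}) \<subseteq> U0 c \<and>
      (\<forall>t\<in>I. \<forall>y\<in>{-e<..<e}. ((\<lambda>t. F (t, y)) has_vector_derivative dyn c (F (t, y))) (at t)) \<and>
      (\<forall>y\<in>{-e<..<e}. F (0, y) = \<zeta> + y *\<^sub>R w) \<and> (\<forall>t\<in>I. F (t, 0) = \<gamma> t) \<and>
      (\<forall>y\<in>{-e<..<e}. trajectory A Ham Om Q I (\<lambda>t. point c (F (t, y))))" for w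
  proof -
    obtain e F where eF: "e > 0" "smooth_on (I \<times> {-e<..<e}) F" "F ` (I \<times> {-e<..<e}) \<subseteq> U0 c"
      and od: "\<forall>t y. (t, y) \<in> I \<times> {-e<..<e} \<longrightarrow> ((\<lambda>t. F (t, y)) has_vector_derivative dyn c (F (t, y))) (at t)"
      and eF': "\<forall>y\<in>{-e<..<e}. F (0, y) = \<zeta> + y *\<^sub>R w" "\<forall>t\<in>I. F (t, 0) = \<gamma> t"
      using flow[of w] unfolding I_def[symmetric] by (elim exE conjE)
    have od': "\<forall>t\<in>I. \<forall>y\<in>{-e<..<e}. ((\<lambda>t. F (t, y)) has_vector_derivative dyn c (F (t, y))) (at t)"
      using od by blast
    note eF = eF od' eF'
    have "trajectory A Ham Om Q I (\<lambda>t. point c (F (t, y)))" if y: "y \<in> {-e<..<e}" for y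
    proof (rule trajectory_from_chart[OF c(1) I(1,2)])
      have sP: "smooth_on I (\<lambda>t. (t, y))"
        by (intro smooth_onI hdo_Pair I(1) hdo_bounded_linear bounded_linear_ident hdo_const)
      have "open (I \<times> {-e<..<e})" using I(1) by (intro open_Times) auto
      then show "smooth_on I (\<lambda>t. F (t, y))"
        by (rule smooth_on_compose[OF sP eF(2) I(1)]) (use y in auto)
      show "F (t, y) \<in> U0 c" if "t \<in> I" for t using eF(3) that y by blast
      show "((\<lambda>t. F (t, y)) has_vector_derivative dyn c (F (t, y))) (at t)" if "t \<in> I" for t using eF(4) that y by blast
    qed
    then show ?thesis by (intro exI[of _ e] exI[of _ F] conjI eF ballI)
  qed
  \<comment> \<open>The family for direction 0 supplies the trajectory; the families for all other
    directions agree with it at \<open>y = 0\<close> because each equals \<open>\<gamma>\<close>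
    there.\<close>
  obtain e F where eF: "e > 0" "smooth_on (I \<times> {-e<..<e}) F" "F ` (I \<times> {-e<..<e}) \<subseteq> U0 c"
    "\<forall>t\<in>I. \<forall>y\<in>{-e<..<e}. ((\<lambda>t. F (t, y)) has_vector_derivative dyn c (F (t, y))) (at t)"
    "\<forall>y\<in>{-e<..<e}. F (0, y) = \<zeta> + y *\<^sub>R 0" "\<forall>t\<in>I. F (t, 0) = \<gamma> t"
    "\<forall>y\<in>{-e<..<e}. trajectory A Ham Om Q I (\<lambda>t. point c (F (t, y)))"
    using family[of 0] by (elim exE conjE)
  show ?thesis
  proof (rule that[OF _ I(3)])
    have "trajectory A Ham Om Q I (\<lambda>t. point c (F (t, 0 :: real)))" using eF by simp
    then show "trajectory A Ham Om Q I (\<lambda>t. point c (F (t, 0 :: real)))" .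
    fix w
    obtain e' F' where e': "e' > 0" and Fs: "smooth_on (I \<times> {-e'<..<e'}) F'" and FU: "F' ` (I \<times> {-e'<..<e'}) \<subseteq> U0 c"
      and ode: "\<forall>t\<in>I. \<forall>y\<in>{-e'<..<e'}. ((\<lambda>t. F' (t, y)) has_vector_derivative dyn c (F' (t, y))) (at t)"
      and init: "\<forall>y\<in>{-e'<..<e'}. F' (0, y) = \<zeta> + y *\<^sub>R w" and F0: "\<forall>t\<in>I. F' (t, 0) = \<gamma> t"
      and tr: "\<forall>y\<in>{-e'<..<e'}. trajectory A Ham Om Q I (\<lambda>t. point c (F' (t, y)))"
      using family[of w] by (elim exE conjE)
    let ?N = "I \<times> {-e'<..<e'}"
    have N: "open ?N" using I(1) by (intro open_Times) auto
    define \<phi> where "\<phi> t = snd (F' (t, 0)) \<bullet> fst (frechet F' (at (t, 0)) (0, 1))" for t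
    have dy: "((\<lambda>y. F' (t, y)) has_vector_derivative frechet F' (at (t, 0)) (0, 1)) (at 0)" if "t \<in> I" for t
      by (rule has_vector_derivative_chain[OF has_vector_derivative_snd_const smooth_on_has_derivative[OF Fs]])
        (use that e' in auto)
    have "deviation_function A Ham Om Q I (\<lambda>t. point c (F (t, 0))) \<phi>"
      unfolding deviation_function_def Let_def
    proof (intro exI[of _ e'] exI[of _ "\<lambda>z. point c (F' z)"] conjI ballI impI e')
      show "smooth_between std_atlas ?N (bundle_atlas A CM) (nonzero_part CM) (\<lambda>z. point c (F' z))"
        by (rule smooth_between_from_chart[OF c(1) N Fs]) (use FU in blast)
      show "trajectory A Ham Om Q I (\<lambda>t. point c (F' (t, y)))" if "y \<in> {-e'<..<e'}" for y
        using tr that by blast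
      show "point c (F' (t, 0)) = point c (F (t, 0))" if "t \<in> I" for t using F0 eF(6) that by simp
      fix t c' assume t: "t \<in> I" and c': "c' \<in> A" and m: "fst (point c (F (t, 0))) \<in> fst c'"
      let ?\<eta> = "F' (t, 0)" and ?w = "frechet F' (at (t, 0)) (0, 1)"
      have FF: "F (t, 0) = ?\<eta>" using F0 eF(6) t by simp
      have \<eta>: "?\<eta> \<in> overlap c c'"
      proof -
        have "?\<eta> \<in> U0 c" using FU t e' by (auto simp: image_subset_iff)
        then have "?\<eta> \<in> U c" using U0_U by blast
        then show ?thesis using m FF by (simp add: overlap_def)
      qed
      have "((\<lambda>y. change c c' (F' (t, y))) has_vector_derivative frechet (change c c') (at ?\<eta>) ?w) (at 0)"
        by (rule has_vector_derivative_chain[OF dy[OF t] smooth_on_has_derivative[OF change_smooth(2)[OF c(1) c'] \<eta>]])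
      from bounded_linear.has_vector_derivative[OF bounded_linear_fst this]
      have v1: "vector_derivative (\<lambda>y. snd c' (fst (point c (F' (t, y))))) (at 0)
          = fst (frechet (change c c') (at ?\<eta>) ?w)"
        by (intro vector_derivative_at) (simp add: change_def coord_eq)
      \<comment> \<open>Chart independence of \<open>\<phi>\<close>: the covector and the variation
        of the base point transform by dual laws, so their pairing is unchanged.\<close>
      have "snd (change c c' ?\<eta>) \<bullet> fst (frechet (change c c') (at ?\<eta>) ?w) = snd ?\<eta> \<bullet> fst ?w"
        by (simp add: change(4)[OF c(1) c' \<eta>] fst_change_derivative[OF c(1) c' \<eta>])
      then show "\<phi> t = (\<Sum>s\<in>UNIV. snd (point c (F (t, 0))) c' $ s *
            vector_derivative (\<lambda>y. snd c' (fst (point c (F' (t, y))))) (at 0) $ s)"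
        unfolding v1 FF by (simp add: \<phi>_def inner_vec_def change_def coord_eq)
    qed
    moreover have t0: "(0, 0) \<in> ?N" using I(3) e' by simp
    moreover have z0: "F' (0, 0) = \<zeta>" using init e' by simp
    \<comment> \<open>The initial values form the line \<open>\<zeta> + y *\<^sub>R w\<close>, so
      the variation at time 0 is the prescribed \<open>w\<close>.\<close>
    moreover have w0: "frechet F' (at (0, 0)) (0, 1) = w"
    proof -
      have "((\<lambda>y. \<zeta> + y *\<^sub>R w) has_vector_derivative w) (at 0)" by (auto intro!: derivative_eq_intros)
      then have "((\<lambda>y. F' (0, y)) has_vector_derivative w) (at 0)"
        by (rule has_vector_derivative_transform_within_open[of _ _ _ "{-e'<..<e'}"]) (use e' init in auto)
      from vector_derivative_unique_at[OF dy[OF I(3)] this] show ?thesis .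
    qed
    moreover have ode': "((\<lambda>t. F' (t, y)) has_vector_derivative dyn c (F' (t, y))) (at t)" if "(t, y) \<in> ?N" for t y
      using ode that by blast
    ultimately show "\<exists>\<phi>. deviation_function A Ham Om Q I (\<lambda>t. point c (F (t, 0))) \<phi> \<and>
       \<phi> 0 = snd (coord c z) \<bullet> fst w \<and> deriv \<phi> 0 = rate c (coord c z) w \<and> deriv (deriv \<phi>) 0 = accel c (coord c z) w"
      using deviation_derivatives[OF local_data[OF c(1)] N Fs FU ode' \<phi>_def t0] \<phi>_def[of 0]
      unfolding \<zeta>_def[symmetric] by metis
  qed
qed

lemma weak_normality_pointwise:
  "weak_normality A Ham Om Q \<longleftrightarrow>
    (\<forall>z\<in>nonzero_part CM. \<forall>c\<in>A. fst z \<in> fst c \<longrightarrow>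
      (\<exists>a b. \<forall>w. accel c (coord c z) w = a * rate c (coord c z) w + b * (snd (coord c z) \<bullet> fst w)))" (is "?W \<longleftrightarrow> ?P")
proof
  assume W: ?W
  show ?P
  proof (intro ballI impI)
    fix z c assume z: "z \<in> nonzero_part CM" and c: "c \<in> A" "fst z \<in> fst c"
    obtain I \<gamma> where tr: "trajectory A Ham Om Q I \<gamma>" and I: "0 \<in> I"
      and dev: "\<And>w. \<exists>\<phi>. deviation_function A Ham Om Q I \<gamma> \<phi> \<and>
       \<phi> 0 = snd (coord c z) \<bullet> fst w \<and> deriv \<phi> 0 = rate c (coord c z) w \<and> deriv (deriv \<phi>) 0 = accel c (coord c z) w"
      using deviation_through_point[OF z c] by blast
    have "\<exists>a b. \<forall>\<phi>. deviation_function A Ham Om Q I \<gamma> \<phi> \<longrightarrow>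
        (\<forall>t\<in>I. deriv (deriv \<phi>) t = a t * deriv \<phi> t + b t * \<phi> t)"
      using W[unfolded weak_normality_def, rule_format, OF tr] by blast
    then obtain a b :: "real \<Rightarrow> real" where ab: "deriv (deriv \<phi>) 0 = a 0 * deriv \<phi> 0 + b 0 * \<phi> 0"
        if "deviation_function A Ham Om Q I \<gamma> \<phi>" for \<phi>
      using I by metis
    have "accel c (coord c z) w = a 0 * rate c (coord c z) w + b 0 * (snd (coord c z) \<bullet> fst w)" for w
      using dev[of w] ab by metis
    then show "\<exists>a b. \<forall>w. accel c (coord c z) w = a * rate c (coord c z) w + b * (snd (coord c z) \<bullet> fst w)" by blast
  qed
next
  assume P: ?P
  show ?W
    unfolding weak_normality_def
  proof (intro allI impI)
    fix I \<gamma> assume tr: "trajectory A Ham Om Q I \<gamma>"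
    \<comment> \<open>The coefficients are found at each time separately, in any chart around
      \<open>\<gamma> t\<close>. They serve all deviation functions because the point fixes the
      functionals; a choice over \<open>t\<close> then gives the coefficient functions.\<close>
    have "\<exists>a b. \<forall>\<phi>. deviation_function A Ham Om Q I \<gamma> \<phi> \<longrightarrow>
        deriv (deriv \<phi>) t = a * deriv \<phi> t + b * \<phi> t" if t: "t \<in> I" for t
    proof -
      have nz: "\<gamma> t \<in> nonzero_part CM"
        using tr t unfolding trajectory_def Let_def smooth_between_def by blast
      then obtain c where c: "c \<in> A" "fst (\<gamma> t) \<in> fst c" using CM_D(2)[of "\<gamma> t"] unfolding nonzero_part_def by blast
      obtain a b where ab: "\<And>w. accel c (coord c (\<gamma> t)) w = a * rate c (coord c (\<gamma> t)) w + b * (snd (coord c (\<gamma> t)) \<bullet> fst w)"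
        using P nz c by blast
      have "deriv (deriv \<phi>) t = a * deriv \<phi> t + b * \<phi> t"
        if "deviation_function A Ham Om Q I \<gamma> \<phi>" for \<phi>
        using deviation_in_chart[OF that t c] ab by metis
      then show ?thesis by blast
    qed
    then show "\<exists>a b. \<forall>\<phi>. deviation_function A Ham Om Q I \<gamma> \<phi> \<longrightarrow>
          (\<forall>t\<in>I. deriv (deriv \<phi>) t = a t * deriv \<phi> t + b t * \<phi> t)"
      by metis
  qed
qed

end

section \<open>The normality equations in components\<close>

lemma all_pair_vec: "(\<forall>w :: (real^'n) \<times> (real^'n). P w) \<longleftrightarrow> (\<forall>\<tau> \<xi>. P (vec_lambda \<tau>, vec_lambda \<xi>))"
proof (intro iffI allI)
  fix w :: "(real^'n) \<times> (real^'n)"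
  assume "\<forall>\<tau> \<xi>. P (vec_lambda \<tau>, vec_lambda \<xi>)"
  from this[rule_format, of "($) (fst w)" "($) (snd w)"] show "P w" by simp
qed blast

context regular_system_field
begin

lemma normality_equations_at_point:
  assumes z: "z \<in> nonzero_part CM" and c: "c \<in> A" "fst z \<in> fst c"
    and sym: "\<And>k i j. \<Gamma> c z k i j = \<Gamma> c z k j i"
  shows "(\<exists>a b. \<forall>w. accel c (coord c z) w = a * rate c (coord c z) w + b * (snd (coord c z) \<bullet> fst w)) \<longleftrightarrow>
    (\<forall>q.
      (\<Sum>r\<in>UNIV. \<Sum>s\<in>UNIV.
         tnabla A c s Ham z / Om z *
         (tnabla A c r (\<lambda>w. Q w c $ s) z + tnabla A c r Om z / Om z * Q z c $ s) *
         P_op A Ham Om c z q r) = 0 \<and>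
      (\<Sum>r\<in>UNIV. \<Sum>s\<in>UNIV.
         ((nabla_cov A \<Gamma> c s Q r z + nabla A \<Gamma> c s Om z / Om z * Q z c $ r
           - nabla_cov A \<Gamma> c r Q s z - nabla A \<Gamma> c r Om z / Om z * Q z c $ s)
            * (tnabla A c s Ham z / Om z)
          + (\<Sum>m\<in>UNIV.
               (nabla A \<Gamma> c r Ham z / Om z - Q z c $ r) *
               (tnabla A c m (\<lambda>w. Q w c $ s) z + tnabla A c m Om z / Om z * Q z c $ s) *
               (tnabla A c s Ham z / Om z) * snd z c $ m)
          - (nabla A \<Gamma> c s Ham z / Om z - Q z c $ s) *
            (tnabla A c s (\<lambda>w. Q w c $ r) z + tnabla A c s Om z / Om z * Q z c $ r))
         * P_op A Ham Om c z r q) = 0)"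
proof -
  define \<zeta> where "\<zeta> = coord c z"
  have zC: "z \<in> CM" using z by (simp add: nonzero_part_def)
  have \<zeta>: "\<zeta> \<in> U0 c" unfolding \<zeta>_def by (rule coord_in_U0[OF c(1) z c(2)])
  note pz = point_coord[OF c(1) zC c(2), folded \<zeta>_def]
  note ld = local_data[OF c(1)]
  have snd\<zeta>: "snd \<zeta> = snd z c" by (simp add: \<zeta>_def coord_eq)
  have om: "Om z = omloc c \<zeta>" by (simp add: omloc_def local_rep_def pz)
  have q: "Q z c = qloc c \<zeta>" by (simp add: qloc_def pz)
  define v where "v i = fibre_grad (hloc c) \<zeta> $ i" for i
  define hb where "hb i = base_grad (hloc c) \<zeta> $ i" for i
  define ofb where "ofb i = fibre_grad (omloc c) \<zeta> $ i" for i
  define obs where "obs i = base_grad (omloc c) \<zeta> $ i" for i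
  \<comment> \<open>In \<open>Qf\<close> and \<open>Qb\<close> the first index is that of the
    derivative, the second that of the covector component.\<close>
  define Qf where "Qf r s = fibre_grad (\<lambda>\<zeta>. qloc c \<zeta> $ s) \<zeta> $ r" for r s
  define Qb where "Qb r s = base_grad (\<lambda>\<zeta>. qloc c \<zeta> $ s) \<zeta> $ r" for r s
  have lrQ: "local_rep CM c (\<lambda>w. Q w c $ s) = (\<lambda>\<zeta>. qloc c \<zeta> $ s)" for s
    by (simp add: local_rep_def qloc_def fun_eq_iff)
  have partials: "partial_fibre CM c i Ham z = v i" "partial_base CM c i Ham z = hb i"
    "partial_fibre CM c i Om z = ofb i" "partial_base CM c i Om z = obs i"
    "partial_fibre CM c i (\<lambda>w. Q w c $ s) z = Qf i s" "partial_base CM c i (\<lambda>w. Q w c $ s) z = Qb i s" for i s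
    by (simp_all add: partial_fibre_def partial_base_def lrQ v_def hb_def ofb_def obs_def Qf_def Qb_def
        fibre_grad_def base_grad_def hloc_def omloc_def \<zeta>_def)
  have pv: "(\<Sum>i\<in>UNIV. snd z c $ i * v i) = omloc c \<zeta>"
    using ld(6)[OF \<zeta>] by (simp add: inner_vec_def v_def snd\<zeta>)
  have dq: "qloc c differentiable at \<zeta>" by (rule smooth_on_differentiable[OF ld(4) \<zeta>])
  have dQ: "frechet (qloc c) (at \<zeta>) (\<tau>, \<xi>) $ s = (\<Sum>r\<in>UNIV. Qb r s * \<tau> $ r + Qf r s * \<xi> $ r)" for \<tau> \<xi> s
  proof -
    have d: "((\<lambda>\<zeta>. qloc c \<zeta> $ s) has_derivative (\<lambda>w. frechet (qloc c) (at \<zeta>) w $ s)) (at \<zeta>)"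
      by (rule bounded_linear.has_derivative[OF bounded_linear_vec_nth has_frechet_derivative[OF dq]])
    have "frechet (\<lambda>\<zeta>. qloc c \<zeta> $ s) (at \<zeta>) (\<tau>, \<xi>) = (\<Sum>r\<in>UNIV. Qb r s * \<tau> $ r + Qf r s * \<xi> $ r)"
      unfolding frechet_derivative_grads[OF differentiableI[OF d]] by (simp add: inner_vec_def Qb_def Qf_def sum.distrib)
    then show ?thesis using has_derivative_imp_frechet[OF d] by simp
  qed
  have dH: "frechet (hloc c) (at \<zeta>) (\<tau>, \<xi>) = (\<Sum>i\<in>UNIV. hb i * \<tau> $ i + v i * \<xi> $ i)" for \<tau> \<xi>
    unfolding frechet_derivative_grads[OF smooth_on_differentiable[OF ld(2) \<zeta>]]
    by (simp add: inner_vec_def hb_def v_def sum.distrib)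
  have dO: "frechet (omloc c) (at \<zeta>) (\<tau>, \<xi>) = (\<Sum>i\<in>UNIV. obs i * \<tau> $ i + ofb i * \<xi> $ i)" for \<tau> \<xi>
    unfolding frechet_derivative_grads[OF smooth_on_differentiable[OF ld(3) \<zeta>]]
    by (simp add: inner_vec_def obs_def ofb_def sum.distrib)
  have dyn: "dyn c \<zeta> = ((\<chi> r. v r / omloc c \<zeta>), (\<chi> r. qloc c \<zeta> $ r - hb r / omloc c \<zeta>))"
    by (simp add: dynamics_def vec_eq_iff v_def hb_def)
  have D1: "rate c \<zeta> (vec_lambda \<tau>, vec_lambda \<xi>) =
      (\<Sum>s\<in>UNIV. qloc c \<zeta> $ s * \<tau> s) - (\<Sum>i\<in>UNIV. hb i * \<tau> i + v i * \<xi> i) / omloc c \<zeta>" for \<tau> \<xi>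
    by (simp add: dev_rate_def dH inner_vec_def)
  have D2: "accel c \<zeta> (vec_lambda \<tau>, vec_lambda \<xi>) =
       (\<Sum>r\<in>UNIV. obs r * (v r / omloc c \<zeta>) + ofb r * (qloc c \<zeta> $ r - hb r / omloc c \<zeta>)) / (omloc c \<zeta>)\<^sup>2
          * (\<Sum>i\<in>UNIV. hb i * \<tau> i + v i * \<xi> i)
        - (\<Sum>s\<in>UNIV. v s * (\<Sum>r\<in>UNIV. Qb r s * \<tau> r + Qf r s * \<xi> r)) / omloc c \<zeta>
        - (\<Sum>i\<in>UNIV. obs i * \<tau> i + ofb i * \<xi> i) / (omloc c \<zeta>)\<^sup>2 * (\<Sum>s\<in>UNIV. v s * qloc c \<zeta> $ s)
        + (\<Sum>s\<in>UNIV. (\<Sum>r\<in>UNIV. Qb r s * (v r / omloc c \<zeta>) + Qf r s * (qloc c \<zeta> $ r - hb r / omloc c \<zeta>)) * \<tau> s)" for \<tau> \<xi>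
    unfolding dev_accel_def dyn dO dH inner_vec_def dQ by (simp add: v_def)
  have ps: "snd \<zeta> \<bullet> fst (vec_lambda \<tau>, vec_lambda \<xi>) = (\<Sum>s\<in>UNIV. snd z c $ s * \<tau> s)" for \<tau> \<xi> :: "'n \<Rightarrow> real"
    by (simp add: inner_vec_def snd\<zeta>)
  show ?thesis
    unfolding \<zeta>_def[symmetric] all_pair_vec D1 D2 ps tnabla_def nabla_def nabla_cov_def P_op_def partials om q
    by (rule normality_equations_algebra[OF pv ld(5)[OF \<zeta>] sym])
qed

end

theorem theorem17p1:
  fixes X :: "'a topology"
    and A :: "('a, real^'n) chart set"
    and L :: "('a, real^'n) bundle_pt \<Rightarrow> real"
    and H \<Omega> :: "('a, real^'n) bundle_pt \<Rightarrow> real"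
    and Q :: "('a, real^'n) bundle_pt \<Rightarrow> ('a, real^'n) components"
    and \<Gamma> :: "('a, real^'n, 'n) connection"
  assumes dim: "CARD('n) \<ge> 2"
    and manifold: "smooth_manifold X A"
    and regular: "regular_lagrangian A L"
    and H: "H = hamiltonian A L"
    and Omega: "\<Omega> = Omega_cot A L"
    and Q: "extended_covector_field A Q"
    and conn: "extended_connection A \<Gamma>"
    and sym: "symmetric_connection A \<Gamma>"
  shows "weak_normality A H \<Omega> Q \<longleftrightarrow>
    (\<forall>z\<in>cotangent_bundle A. snd z \<noteq> zero_vec \<longrightarrow> (\<forall>c\<in>A. fst z \<in> fst c \<longrightarrow> (\<forall>q.
      (\<Sum>r\<in>UNIV. \<Sum>s\<in>UNIV.
         tnabla A c s H z / \<Omega> z *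
         (tnabla A c r (\<lambda>w. Q w c $ s) z + tnabla A c r \<Omega> z / \<Omega> z * Q z c $ s) *
         P_op A H \<Omega> c z q r) = 0 \<and>
      (\<Sum>r\<in>UNIV. \<Sum>s\<in>UNIV.
         ((nabla_cov A \<Gamma> c s Q r z + nabla A \<Gamma> c s \<Omega> z / \<Omega> z * Q z c $ r
           - nabla_cov A \<Gamma> c r Q s z - nabla A \<Gamma> c r \<Omega> z / \<Omega> z * Q z c $ s)
            * (tnabla A c s H z / \<Omega> z)
          + (\<Sum>m\<in>UNIV.
               (nabla A \<Gamma> c r H z / \<Omega> z - Q z c $ r) *
               (tnabla A c m (\<lambda>w. Q w c $ s) z + tnabla A c m \<Omega> z / \<Omega> z * Q z c $ s) *
               (tnabla A c s H z / \<Omega> z) * snd z c $ m)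
          - (nabla A \<Gamma> c s H z / \<Omega> z - Q z c $ s) *
            (tnabla A c s (\<lambda>w. Q w c $ r) z + tnabla A c s \<Omega> z / \<Omega> z * Q z c $ r))
         * P_op A H \<Omega> c z r q) = 0)))"
proof -
  interpret regular_system_field X A L Q
    by unfold_locales (fact manifold regular Q)+
  have symz: "\<Gamma> c z k i j = \<Gamma> c z k j i" if "z \<in> nonzero_part CM" "c \<in> A" "fst z \<in> fst c" for c z k i j
    using sym that unfolding symmetric_connection_def nonzero_part_def by blast
  have nz: "(\<forall>z\<in>CM. snd z \<noteq> zero_vec \<longrightarrow> R z) \<longleftrightarrow> (\<forall>z\<in>nonzero_part CM. R z)" for R
    unfolding nonzero_part_def by blast
  show ?thesis
    unfolding H Omega weak_normality_pointwise nz
    by (intro ball_cong refl imp_cong normality_equations_at_point symz)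
qed

end
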